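(* Let $t$ be an indeterminate over the field $\mathbb{F}_2$ with two elements, and put $R=\mathbb{F}_2[t^{-1}]$, $L=\mathbb{F}_2[t,t^{-1}]$, $K=\mathbb{F}_2(t)$ and $Q=\mathrm{SL}_3(R)$. Then the group $$G=\left\{\begin{pmatrix}t^kA&v\\0&1\end{pmatrix} : A\in Q,\ v\in L^3,\ k\in\mathbb{Z}\right\}\leq \mathrm{GL}_4(K)$$ (block matrices with upper-left block $t^kA$ of size $3\times 3$ and $v$ a column vector) is finitely generated, does not have Kazhdan's property (T), is ICC, is not inner amenable, and is not properly proximal.
   Context: All groups are regarded as discrete groups. A group is ICC if the conjugacy class of every non-identity element is infinite. A mean on a set $X$ is a positive unital linear functional $m$ on $\ell^\infty(X,\mathbb{R})$; for $E\subseteq X$ write $m(E)=m(\mathbf{1}_E)$. A mean is atomless if $m(\{x\})=0$ for every $x\in X$. A group $H$ is inner amenable if there is an atomless mean on $H$ that is invariant under the conjugation action of $H$ on itself. For a countably infinite group $H$, proper proximality is characterized as follows: $H$ is properly proximal if and only if the algebra $(\ell^\infty(H)/c_0(H))^{H_r}$ has no state invariant under left translation by $H$. Here $H_r$ denotes the right translation action of $H$, the superscript denotes the fixed-point subalgebra of $\ell^\infty(H)/c_0(H)$ under this action, and left translation acts on this subalgebra since it commutes with right translation. *)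

theory Defs
  imports
    "HOL-Analysis.Elementary_Normed_Spaces"
    "HOL-Library.Nonpos_Ints"
    "HOL-Library.Z2"
    "HOL-Algebra.Generated_Groups"
    "HOL-Algebra.Group_Action"
    "HOL-Algebra.Module"
    "HOL-Algebra.QuotRing"
    "Jordan_Normal_Form.Determinant"
begin

section \<open>Finite generation and conjugacy classes\<close>

definition finitely_generated :: "('a, 'b) monoid_scheme \<Rightarrow> bool" where
  "finitely_generated G \<longleftrightarrow>
     (\<exists>S. finite S \<and> S \<subseteq> carrier G \<and> generate G S = carrier G)"

definition conjugacy_class :: "('a, 'b) monoid_scheme \<Rightarrow> 'a \<Rightarrow> 'a set" where
  "conjugacy_class G g = {x \<otimes>\<^bsub>G\<^esub> g \<otimes>\<^bsub>G\<^esub> inv\<^bsub>G\<^esub> x | x. x \<in> carrier G}"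

definition ICC :: "('a, 'b) monoid_scheme \<Rightarrow> bool" where
  "ICC G \<longleftrightarrow> (\<forall>g \<in> carrier G. g \<noteq> \<one>\<^bsub>G\<^esub> \<longrightarrow> infinite (conjugacy_class G g))"


section \<open>Unitary representations and Kazhdan's property (T)\<close>

definition complex_ring :: "complex ring" where
  "complex_ring = \<lparr>carrier = UNIV, monoid.mult = (*), one = 1, zero = 0, add = (+)\<rparr>"

text \<open>Hilbert spaces are given by explicit carriers, because the definition of property (T)
  quantifies over all of them.\<close>

record 'h inner_module = "(complex, 'h) module" +
  cinner :: "'h \<Rightarrow> 'h \<Rightarrow> complex"

definition cnorm :: "('h, 'm) inner_module_scheme \<Rightarrow> 'h \<Rightarrow> real" where
  "cnorm H x = sqrt (Re (cinner H x x))"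

locale complex_hilbert_space = module complex_ring H
  for H :: "('h, 'm) inner_module_scheme" (structure) +
  assumes cinner_add:
      "\<lbrakk>x \<in> carrier H; y \<in> carrier H; z \<in> carrier H\<rbrakk>
        \<Longrightarrow> cinner H (x \<oplus> y) z = cinner H x z + cinner H y z"
    and cinner_smult:
      "\<lbrakk>x \<in> carrier H; y \<in> carrier H\<rbrakk> \<Longrightarrow> cinner H (c \<odot> x) y = c * cinner H x y"
    and cinner_commute:
      "\<lbrakk>x \<in> carrier H; y \<in> carrier H\<rbrakk> \<Longrightarrow> cinner H y x = cnj (cinner H x y)"
    and cinner_pos:
      "\<lbrakk>x \<in> carrier H; x \<noteq> \<zero>\<rbrakk> \<Longrightarrow> Re (cinner H x x) > 0"
    and complete:
      "\<lbrakk>\<And>n. X n \<in> carrier H;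
        \<And>e. e > 0 \<Longrightarrow> \<exists>N. \<forall>m\<ge>N. \<forall>n\<ge>N. cnorm H (X m \<ominus> X n) < e\<rbrakk>
        \<Longrightarrow> \<exists>x \<in> carrier H. (\<lambda>n. cnorm H (X n \<ominus> x)) \<longlonglongrightarrow> 0"

locale unitary_representation =
  complex_hilbert_space H + group_action G "carrier H" \<pi>
  for G :: "('a, 'b) monoid_scheme" and H :: "('h, 'm) inner_module_scheme"
    and \<pi> :: "'a \<Rightarrow> 'h \<Rightarrow> 'h" +
  assumes rep_add:
      "\<lbrakk>g \<in> carrier G; x \<in> carrier H; y \<in> carrier H\<rbrakk>
        \<Longrightarrow> \<pi> g (x \<oplus>\<^bsub>H\<^esub> y) = \<pi> g x \<oplus>\<^bsub>H\<^esub> \<pi> g y"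
    and rep_smult:
      "\<lbrakk>g \<in> carrier G; x \<in> carrier H\<rbrakk> \<Longrightarrow> \<pi> g (c \<odot>\<^bsub>H\<^esub> x) = c \<odot>\<^bsub>H\<^esub> \<pi> g x"
    and rep_isometric:
      "\<lbrakk>g \<in> carrier G; x \<in> carrier H; y \<in> carrier H\<rbrakk>
        \<Longrightarrow> cinner H (\<pi> g x) (\<pi> g y) = cinner H x y"

definition has_almost_invariant_vector ::
  "('h, 'm) inner_module_scheme \<Rightarrow> ('a \<Rightarrow> 'h \<Rightarrow> 'h) \<Rightarrow> 'a set \<Rightarrow> real \<Rightarrow> bool" where
  "has_almost_invariant_vector H \<pi> S \<epsilon> \<longleftrightarrow>
     (\<exists>x \<in> carrier H. x \<noteq> \<zero>\<^bsub>H\<^esub> \<and>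
        (\<forall>s\<in>S. cnorm H (\<pi> s x \<ominus>\<^bsub>H\<^esub> x) < \<epsilon> * cnorm H x))"

definition has_nonzero_invariant_vector ::
  "('a, 'b) monoid_scheme \<Rightarrow> ('h, 'm) inner_module_scheme \<Rightarrow> ('a \<Rightarrow> 'h \<Rightarrow> 'h) \<Rightarrow> bool" where
  "has_nonzero_invariant_vector G H \<pi> \<longleftrightarrow>
     (\<exists>x \<in> carrier H. x \<noteq> \<zero>\<^bsub>H\<^esub> \<and> (\<forall>g \<in> carrier G. \<pi> g x = x))"

text \<open>HOL cannot quantify over types inside a definition, so the Hilbert spaces range over those
  whose underlying set consists of functions \<open>'a \<Rightarrow> complex\<close>, where \<open>'a\<close> is the type of
  the group elements. This is no restriction: if \<open>(S, \<epsilon>)\<close> is a Kazhdan pair for these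
  spaces and \<open>x\<close> is an \<open>(S, \<epsilon>)\<close>-invariant vector of an arbitrary unitary
  representation, then the closed linear span of the orbit of \<open>x\<close> is a subrepresentation
  containing \<open>x\<close> whose Hilbert dimension is at most the cardinality of the group, so it is
  isometric to a closed subspace of \<open>\<ell>\<^sup>2(G)\<close>, which is a set of such functions.\<close>

definition kazhdan_property_T :: "('a, 'b) monoid_scheme \<Rightarrow> bool" where
  "kazhdan_property_T G \<longleftrightarrow>
     (\<exists>S \<epsilon>. finite S \<and> S \<subseteq> carrier G \<and> \<epsilon> > 0 \<and>
        (\<forall>(H :: ('a \<Rightarrow> complex) inner_module) \<pi>.
           unitary_representation G H \<pi> \<longrightarrow> has_almost_invariant_vector H \<pi> S \<epsilon> \<longrightarrow>
           has_nonzero_invariant_vector G H \<pi>))"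


section \<open>Means and inner amenability\<close>

text \<open>Functions on a set are represented by extensional functions on the ambient type.\<close>

definition linf :: "'a set \<Rightarrow> ('a \<Rightarrow> 'c::real_normed_vector) set" where
  "linf X = {f \<in> extensional X. bounded (f ` X)}"

locale mean =
  fixes X :: "'a set" and m :: "('a \<Rightarrow> real) \<Rightarrow> real"
  assumes mean_add: "\<lbrakk>f \<in> linf X; g \<in> linf X\<rbrakk> \<Longrightarrow> m (\<lambda>x\<in>X. f x + g x) = m f + m g"
    and mean_scale: "f \<in> linf X \<Longrightarrow> m (\<lambda>x\<in>X. c * f x) = c * m f"
    and mean_nonneg: "\<lbrakk>f \<in> linf X; \<And>x. x \<in> X \<Longrightarrow> 0 \<le> f x\<rbrakk> \<Longrightarrow> 0 \<le> m f"
    and mean_one: "m (\<lambda>x\<in>X. 1) = 1"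

definition mean_of_set :: "'a set \<Rightarrow> (('a \<Rightarrow> real) \<Rightarrow> real) \<Rightarrow> 'a set \<Rightarrow> real" where
  "mean_of_set X m E = m (\<lambda>x\<in>X. indicator E x)"

definition atomless_mean :: "'a set \<Rightarrow> (('a \<Rightarrow> real) \<Rightarrow> real) \<Rightarrow> bool" where
  "atomless_mean X m \<longleftrightarrow> mean X m \<and> (\<forall>x\<in>X. mean_of_set X m {x} = 0)"

definition conj_invariant_mean ::
  "('a, 'b) monoid_scheme \<Rightarrow> (('a \<Rightarrow> real) \<Rightarrow> real) \<Rightarrow> bool" where
  "conj_invariant_mean G m \<longleftrightarrow>
     (\<forall>g \<in> carrier G. \<forall>f \<in> linf (carrier G).
        m (\<lambda>x\<in>carrier G. f (inv\<^bsub>G\<^esub> g \<otimes>\<^bsub>G\<^esub> x \<otimes>\<^bsub>G\<^esub> g)) = m f)"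

definition inner_amenable :: "('a, 'b) monoid_scheme \<Rightarrow> bool" where
  "inner_amenable G \<longleftrightarrow> (\<exists>m. atomless_mean (carrier G) m \<and> conj_invariant_mean G m)"


section \<open>Proper proximality\<close>

definition linf_ring :: "'a set \<Rightarrow> ('a \<Rightarrow> complex) ring" where
  "linf_ring X = \<lparr>carrier = linf X,
     monoid.mult = (\<lambda>f g. \<lambda>x\<in>X. f x * g x), one = (\<lambda>x\<in>X. 1),
     zero = (\<lambda>x\<in>X. 0), add = (\<lambda>f g. \<lambda>x\<in>X. f x + g x)\<rparr>"

definition c0 :: "'a set \<Rightarrow> ('a \<Rightarrow> complex) set" where
  "c0 X = {f \<in> extensional X. \<forall>\<epsilon>>0. finite {x \<in> X. cmod (f x) \<ge> \<epsilon>}}"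

abbreviation linf_mod_c0 :: "'a set \<Rightarrow> ('a \<Rightarrow> complex) set ring" where
  "linf_mod_c0 X \<equiv> linf_ring X Quot c0 X"

definition left_translate ::
  "('a, 'b) monoid_scheme \<Rightarrow> 'a \<Rightarrow> ('a \<Rightarrow> complex) \<Rightarrow> 'a \<Rightarrow> complex" where
  "left_translate G g f = (\<lambda>x\<in>carrier G. f (inv\<^bsub>G\<^esub> g \<otimes>\<^bsub>G\<^esub> x))"

definition right_translate ::
  "('a, 'b) monoid_scheme \<Rightarrow> 'a \<Rightarrow> ('a \<Rightarrow> complex) \<Rightarrow> 'a \<Rightarrow> complex" where
  "right_translate G g f = (\<lambda>x\<in>carrier G. f (x \<otimes>\<^bsub>G\<^esub> g))"

text \<open>Elements of the quotient are cosets of \<open>c0\<close>. Since \<open>c0\<close> is invariant under both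
  translations and under complex conjugation, the induced maps on the quotient send a coset to its
  image. Scalars act through the classes of constant functions (the image of a coset under
  pointwise multiplication by \<open>0\<close> would not be a coset).\<close>

definition right_fixed :: "('a, 'b) monoid_scheme \<Rightarrow> ('a \<Rightarrow> complex) set set" where
  "right_fixed G = {C \<in> carrier (linf_mod_c0 (carrier G)).
     \<forall>g \<in> carrier G. right_translate G g ` C = C}"

definition const_class :: "'a set \<Rightarrow> complex \<Rightarrow> ('a \<Rightarrow> complex) set" where
  "const_class X c = c0 X +>\<^bsub>linf_ring X\<^esub> (\<lambda>x\<in>X. c)"

definition star_class :: "'a set \<Rightarrow> ('a \<Rightarrow> complex) set \<Rightarrow> ('a \<Rightarrow> complex) set" where
  "star_class X C = (\<lambda>f. \<lambda>x\<in>X. cnj (f x)) ` C"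

text \<open>A state on a unital C*-algebra is a unital linear functional that is nonnegative on all
  elements of the form \<open>a\<^sup>* a\<close>.\<close>

definition state_on_right_fixed ::
  "('a, 'b) monoid_scheme \<Rightarrow> (('a \<Rightarrow> complex) set \<Rightarrow> complex) \<Rightarrow> bool" where
  "state_on_right_fixed G \<phi> \<longleftrightarrow>
     (let A = linf_mod_c0 (carrier G) in
        (\<forall>C \<in> right_fixed G. \<forall>D \<in> right_fixed G. \<phi> (C \<oplus>\<^bsub>A\<^esub> D) = \<phi> C + \<phi> D) \<and>
        (\<forall>c. \<forall>C \<in> right_fixed G. \<phi> (const_class (carrier G) c \<otimes>\<^bsub>A\<^esub> C) = c * \<phi> C) \<and>
        (\<forall>C \<in> right_fixed G. \<phi> (star_class (carrier G) C \<otimes>\<^bsub>A\<^esub> C) \<in> \<real>\<^sub>\<ge>\<^sub>0) \<and>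
        \<phi> \<one>\<^bsub>A\<^esub> = 1)"

definition left_invariant_state ::
  "('a, 'b) monoid_scheme \<Rightarrow> (('a \<Rightarrow> complex) set \<Rightarrow> complex) \<Rightarrow> bool" where
  "left_invariant_state G \<phi> \<longleftrightarrow> state_on_right_fixed G \<phi> \<and>
     (\<forall>g \<in> carrier G. \<forall>C \<in> right_fixed G. \<phi> (left_translate G g ` C) = \<phi> C)"

text \<open>This is the characterization of proper proximality valid for countably infinite groups; the
  notion is only meant to be used for such groups.\<close>

definition properly_proximal :: "('a, 'b) monoid_scheme \<Rightarrow> bool" where
  "properly_proximal G \<longleftrightarrow> \<not> (\<exists>\<phi>. left_invariant_state G \<phi>)"


section \<open>The group\<close>

text \<open>The type \<open>bit\<close> is the field with two elements, so \<open>bit poly fract\<close> is the field of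
  rational functions over it.\<close>

type_synonym K = "bit poly fract"

definition const_K :: "bit \<Rightarrow> K" where
  "const_K b = to_fract [:b:]"

definition t_K :: K where
  "t_K = to_fract [:0, 1:]"

definition R_ring :: "K set" where
  "R_ring = {\<Sum>i\<le>n. const_K (a i) * inverse t_K ^ i | (a :: nat \<Rightarrow> bit) n. True}"

definition L_ring :: "K set" where
  "L_ring = {\<Sum>i\<in>{- int n..int n}. const_K (a i) * t_K powi i | (a :: int \<Rightarrow> bit) n. True}"

definition SL3_R :: "K mat set" where
  "SL3_R = {A \<in> carrier_mat 3 3. elements_mat A \<subseteq> R_ring \<and> det A = 1}"

definition GL4 :: "K mat monoid" where
  "GL4 = units_of (ring_mat TYPE(K) 4 ())"

definition G_set :: "K mat set" where
  "G_set = {four_block_mat (t_K powi k \<cdot>\<^sub>m A) (mat_of_cols 3 [v]) (0\<^sub>m 1 3) (1\<^sub>m 1) | k A v.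
     A \<in> SL3_R \<and> v \<in> carrier_vec 3 \<and> set\<^sub>v v \<subseteq> L_ring}"

definition group_G :: "K mat monoid" where
  "group_G = GL4\<lparr>carrier := G_set\<rparr>"

end

theory Submission
  imports Defs "HOL-Analysis.Complex_Analysis_Basics"
begin

text \<open>
Elements of the group are affine maps \<open>x \<mapsto> t\<^sup>k A x + v\<close> of \<open>K\<^sup>3\<close>. Write \<open>s = t\<^sup>-\<^sup>1\<close>, so that \<open>R\<close> is the polynomial
ring in \<open>s\<close>.

The group is generated by the elementary matrices with entries \<open>1\<close> and \<open>s\<close>, the scalar \<open>t\<close>, and the
translations by the basis vectors: row reduction shows that \<open>Q\<close> is generated by elementary matrices
(\<open>left_invertible_imp_elem_mats\<close>), the commutator relation reduces them to finitely many
(\<open>generate_addrow_mat\<close>), and conjugation by powers of \<open>t\<close> yields all translations. Property (T) fails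
because the exponent \<open>k\<close> defines a homomorphism onto \<open>\<int>\<close>, which has characters close to the trivial one.
Infinitely many conjugates of a nontrivial element are found by conjugating with translations or with
powers of \<open>t\<close>.

Inner amenability fails for an elementary reason. The translation part \<open>v\<close> is equivariant for \<open>Q\<close>, and no
\<open>Q\<close>-invariant mean lives on the nonzero vectors: at the place \<open>t = 0\<close>, the set of vectors whose \<open>i\<close>-th
coordinate does not exceed the nonzero \<open>j\<close>-th one has infinitely many disjoint translates under the
elementary matrices with entry \<open>s\<^sup>n\<close>, and these sets cover everything except zero. So a
conjugation-invariant mean gives full weight to the elements with \<open>v = 0\<close>; conjugation by translations
then forces it to be concentrated at the identity (\<open>not_inner_amenable_G\<close>).

For proper proximality, a left-invariant state is obtained as an ultralimit of averages over finite sets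
that escape to infinity and are left invariant up to a vanishing proportion and up to right multiplication
by a finite set, which a right-fixed function does not see at infinity
(\<open>escaping_family.not_properly_proximal\<close>). The finite sets consist of the products \<open>t\<^sup>n v\<close> with
\<open>-2N \<le> n \<le> -N\<close> and \<open>v\<close> in the span of \<open>t, \<dots>, t\<^sup>3\<^sup>N\<close> in each coordinate. The latter vectors represent the
finite \<open>Q\<close>-module \<open>t\<^sup>3\<^sup>N R\<^sup>3 / R\<^sup>3\<close>; the remainder in \<open>R\<^sup>3\<close> produced by a fixed element of \<open>Q\<close> has bounded
degree and thus stays in a finite set, independent of \<open>N\<close> (\<open>escaping_family_G\<close>).
\<close>

section \<open>Limits along an ultrafilter\<close>

lemma ultrafilter_exists:
  "\<exists>F :: nat filter. F \<noteq> bot \<and> F \<le> sequentially \<and>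
     (\<forall>P. eventually P F \<or> eventually (\<lambda>n. \<not> P n) F)"
proof -
  define A where "A = {F :: nat filter. F \<noteq> bot \<and> F \<le> sequentially}"
  let ?r = "relation_of (\<ge>) A"
  have "partial_order_on A ?r"
    by (rule partial_order_on_relation_ofI) auto
  moreover have "\<exists>u\<in>A. \<forall>F\<in>C. F \<ge> u" if C: "C \<in> Chains ?r" for C
  proof (cases "C = {}")
    case True
    have "sequentially \<in> A" by (auto simp: A_def)
    with True show ?thesis by auto
  next
    case False
    have sub: "C \<subseteq> A" and lin: "\<And>F F'. F \<in> C \<Longrightarrow> F' \<in> C \<Longrightarrow> F \<le> F' \<or> F' \<le> F"
      using C by (auto simp: Chains_def relation_of_def)
    have "Inf C \<noteq> bot"
    proof
      assume "Inf C = bot"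
      hence "eventually (\<lambda>_. False) (Inf C)" by simp
      moreover have "\<exists>H\<in>C. H \<le> inf F F'" if "F \<in> C" "F' \<in> C" for F F'
        using lin[OF that] that by (metis inf.absorb1 inf.absorb2 order_refl)
      ultimately obtain F where "F \<in> C" "eventually (\<lambda>_. False) F"
        using eventually_Inf_base[OF False] by metis
      thus False using sub by (auto simp: A_def trivial_limit_def)
    qed
    moreover have "Inf C \<le> sequentially"
      using False sub by (metis (mono_tags, lifting) A_def Inf_lower2 ex_in_conv mem_Collect_eq subsetD)
    ultimately show ?thesis by (auto simp: A_def intro!: bexI[of _ "Inf C"] Inf_lower)
  qed
  ultimately obtain F where F: "F \<in> A" and max: "\<And>F'. F' \<in> A \<Longrightarrow> F' \<le> F \<Longrightarrow> F' = F"
    using predicate_Zorn[of A "(\<ge>)"] by metis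
  have "eventually P F \<or> eventually (\<lambda>n. \<not> P n) F" for P
  proof (rule disjCI)
    assume "\<not> eventually (\<lambda>n. \<not> P n) F"
    hence "inf F (principal {n. P n}) \<noteq> bot"
      by (simp add: trivial_limit_def eventually_inf_principal)
    hence "inf F (principal {n. P n}) = F"
      using F by (intro max) (auto simp: A_def intro: le_infI1)
    moreover have "eventually P (inf F (principal {n. P n}))"
      by (simp add: eventually_inf_principal)
    ultimately show "eventually P F" by simp
  qed
  with F show ?thesis by (auto simp: A_def)
qed

text \<open>Along an ultrafilter every bounded sequence converges; this replaces a Banach limit below.\<close>

lemma ultrafilter_limit_exists:
  fixes a :: "'i \<Rightarrow> 'c :: heine_borel"
  assumes ultra: "F \<noteq> bot" "\<And>P. eventually P F \<or> eventually (\<lambda>n. \<not> P n) F"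
    and bdd: "bounded (range a)"
  shows "\<exists>l. (a \<longlongrightarrow> l) F"
proof -
  have "compact (closure (range a))" using bdd by simp
  moreover have "eventually (\<lambda>y. y \<in> closure (range a)) (filtermap a F)"
    unfolding eventually_filtermap
    by (rule always_eventually) (meson closure_subset rangeI subsetD)
  moreover have "filtermap a F \<noteq> bot" using ultra(1) by (simp add: filtermap_bot_iff)
  ultimately obtain l where l: "inf (nhds l) (filtermap a F) \<noteq> bot"
    unfolding compact_filter by blast
  have "eventually (\<lambda>n. a n \<in> U) F" if "open U" "l \<in> U" for U
  proof (rule ccontr)
    assume "\<not> eventually (\<lambda>n. a n \<in> U) F"
    hence "eventually (\<lambda>n. a n \<notin> U) F" using ultra(2) by blast
    hence "eventually (\<lambda>_. False) (inf (nhds l) (filtermap a F))"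
      unfolding eventually_inf eventually_filtermap
      using eventually_nhds_in_open[OF that]
      by (intro exI[of _ "\<lambda>y. y \<in> U"] exI[of _ "\<lambda>y. y \<notin> U"]) auto
    with l show False by (simp add: trivial_limit_def)
  qed
  thus ?thesis by (auto simp: tendsto_def)
qed

section \<open>The quotient algebra of bounded functions modulo functions vanishing at infinity\<close>

lemma linf_ring_simps [simp]:
  "carrier (linf_ring X) = linf X"
  "f \<otimes>\<^bsub>linf_ring X\<^esub> g = (\<lambda>x\<in>X. f x * g x)"
  "f \<oplus>\<^bsub>linf_ring X\<^esub> g = (\<lambda>x\<in>X. f x + g x)"
  "\<one>\<^bsub>linf_ring X\<^esub> = (\<lambda>x\<in>X. 1)" "\<zero>\<^bsub>linf_ring X\<^esub> = (\<lambda>x\<in>X. 0)"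
  by (auto simp: linf_ring_def)

lemma linfI:
  fixes f :: "'a \<Rightarrow> 'c :: real_normed_vector"
  assumes "f \<in> extensional X" "\<And>x. x \<in> X \<Longrightarrow> norm (f x) \<le> B"
  shows "f \<in> linf X"
  using assms by (auto simp: linf_def bounded_iff)

lemma linfE:
  fixes f :: "'a \<Rightarrow> 'c :: real_normed_vector"
  assumes "f \<in> linf X"
  obtains B where "B \<ge> 0" "\<And>x. x \<in> X \<Longrightarrow> norm (f x) \<le> B"
proof -
  from assms obtain B where B: "\<And>x. x \<in> X \<Longrightarrow> norm (f x) \<le> B" by (auto simp: linf_def bounded_iff)
  show ?thesis using B by (intro that[of "max B 0"]) (auto simp: le_max_iff_disj)
qed

lemma linf_add: "f \<in> linf X \<Longrightarrow> g \<in> linf X \<Longrightarrow> (\<lambda>x\<in>X. f x + g x) \<in> linf X"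
  by (elim linfE) (rule linfI, auto intro: norm_triangle_mono)

lemma linf_mult:
  fixes f g :: "'a \<Rightarrow> complex"
  assumes "f \<in> linf X" "g \<in> linf X"
  shows "(\<lambda>x\<in>X. f x * g x) \<in> linf X"
proof -
  obtain A B where "A \<ge> 0" "B \<ge> 0" "\<And>x. x \<in> X \<Longrightarrow> norm (f x) \<le> A" "\<And>x. x \<in> X \<Longrightarrow> norm (g x) \<le> B"
    using assms by (metis linfE)
  thus ?thesis by (intro linfI[where B = "A * B"]) (auto simp: norm_mult intro: mult_mono)
qed

lemma linf_const: "(\<lambda>x\<in>X. c) \<in> linf X"
  by (rule linfI[where B = "norm c"]) auto

lemma cring_linf_ring: "cring (linf_ring X)"
proof (rule cringI)
  have undef: "f x = undefined" if "f \<in> linf X" "x \<notin> X" for f :: "'a \<Rightarrow> complex" and x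
    using that by (auto simp: linf_def extensional_def)
  show "abelian_group (linf_ring X)"
  proof (rule abelian_groupI)
    fix f assume f: "f \<in> carrier (linf_ring X)"
    have "(\<lambda>x\<in>X. - f x) \<in> linf X" using f by (auto elim!: linfE intro!: linfI)
    thus "\<exists>g\<in>carrier (linf_ring X). g \<oplus>\<^bsub>linf_ring X\<^esub> f = \<zero>\<^bsub>linf_ring X\<^esub>"
      by (intro bexI[of _ "\<lambda>x\<in>X. - f x"]) auto
  qed (auto intro!: ext simp: linf_add linf_const undef algebra_simps)
  show "Group.comm_monoid (linf_ring X)"
    by (rule comm_monoidI)
       (auto intro!: ext simp: linf_mult linf_const undef algebra_simps)
qed (auto intro!: ext simp: algebra_simps)

lemma c0_finite: "f \<in> c0 X \<Longrightarrow> e > 0 \<Longrightarrow> finite {x \<in> X. cmod (f x) \<ge> e}"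
  by (simp add: c0_def)

lemma c0_subset_linf: "c0 X \<subseteq> linf X"
proof
  fix f assume f: "f \<in> c0 X"
  hence fin: "finite {x \<in> X. cmod (f x) \<ge> 1}" by (auto simp: c0_def)
  have "bounded (f ` {x \<in> X. cmod (f x) \<ge> 1} \<union> cball 0 1)"
    using finite_imp_bounded[OF finite_imageI[OF fin]] by auto
  moreover have "f ` X \<subseteq> f ` {x \<in> X. cmod (f x) \<ge> 1} \<union> cball 0 1" by auto
  ultimately have "bounded (f ` X)" by (rule bounded_subset)
  with f show "f \<in> linf X" by (auto simp: c0_def linf_def)
qed

lemma c0_add:
  assumes "f \<in> c0 X" "g \<in> c0 X"
  shows "(\<lambda>x\<in>X. f x + g x) \<in> c0 X"
  unfolding c0_def
proof (safe)
  fix e :: real assume e: "e > 0"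
  have "finite ({x \<in> X. cmod (f x) \<ge> e/2} \<union> {x \<in> X. cmod (g x) \<ge> e/2})"
    using assms e by (intro finite_UnI c0_finite) simp_all
  moreover have "{x \<in> X. e \<le> cmod ((\<lambda>x\<in>X. f x + g x) x)} \<subseteq>
      {x \<in> X. cmod (f x) \<ge> e/2} \<union> {x \<in> X. cmod (g x) \<ge> e/2}"
  proof
    fix x assume "x \<in> {x \<in> X. e \<le> cmod ((\<lambda>x\<in>X. f x + g x) x)}"
    thus "x \<in> {x \<in> X. cmod (f x) \<ge> e/2} \<union> {x \<in> X. cmod (g x) \<ge> e/2}"
      using norm_triangle_ineq[of "f x" "g x"] by auto
  qed
  ultimately show "finite {x \<in> X. e \<le> cmod ((\<lambda>x\<in>X. f x + g x) x)}" by (rule rev_finite_subset)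
qed auto

lemma c0_bounded_mult:
  assumes "f \<in> c0 X" "g \<in> linf X"
  shows "(\<lambda>x\<in>X. g x * f x) \<in> c0 X"
  unfolding c0_def
proof (safe)
  fix e :: real assume e: "e > 0"
  obtain B where B: "B \<ge> 0" "\<And>x. x \<in> X \<Longrightarrow> norm (g x) \<le> B" using assms(2) by (metis linfE)
  have "finite {x \<in> X. cmod (f x) \<ge> e / (B + 1)}"
    using assms(1) e B(1) by (auto simp: c0_def)
  moreover have "{x \<in> X. e \<le> cmod ((\<lambda>x\<in>X. g x * f x) x)} \<subseteq> {x \<in> X. cmod (f x) \<ge> e / (B + 1)}"
  proof clarsimp
    fix x assume x: "x \<in> X" "e \<le> cmod (g x * f x)"
    have "cmod (g x * f x) \<le> (B + 1) * cmod (f x)"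
      using B(2)[OF x(1)] by (auto simp: norm_mult intro!: mult_right_mono)
    thus "e / (B + 1) \<le> cmod (f x)" using x B(1) by (simp add: divide_le_eq mult.commute)
  qed
  ultimately show "finite {x \<in> X. e \<le> cmod ((\<lambda>x\<in>X. g x * f x) x)}" by (rule rev_finite_subset)
qed auto

lemma ideal_c0: "ideal (c0 X) (linf_ring X)"
proof -
  interpret cring "linf_ring X" by (rule cring_linf_ring)
  have neg: "(\<lambda>x\<in>X. - f x) \<in> c0 X" if "f \<in> c0 X" for f
    using c0_bounded_mult[OF that, of "\<lambda>x\<in>X. -1"] by (simp add: linfI[where B = 1] cong: restrict_cong)
  have inv: "\<ominus>\<^bsub>linf_ring X\<^esub> f = (\<lambda>x\<in>X. - f x)" if "f \<in> c0 X" for f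
    by (rule minus_equality)
       (use that neg[OF that] c0_subset_linf[of X] in auto)
  show ?thesis
  proof (rule idealI)
    show "subgroup (c0 X) (add_monoid (linf_ring X))"
    proof (rule add.subgroupI)
      show "c0 X \<noteq> {}" by (auto simp: c0_def intro!: exI[of _ "\<lambda>x\<in>X. 0"])
    qed (use c0_subset_linf neg inv c0_add in auto)
  next
    fix f g assume "f \<in> c0 X" "g \<in> carrier (linf_ring X)"
    thus "g \<otimes>\<^bsub>linf_ring X\<^esub> f \<in> c0 X" "f \<otimes>\<^bsub>linf_ring X\<^esub> g \<in> c0 X"
      using c0_bounded_mult[of f X g] by (auto simp: mult.commute)
  qed (rule ring_axioms)
qed

text \<open>The class of a bounded function in the quotient algebra, as a coset of the functions vanishing
  at infinity.\<close>

definition c0_class :: "'a set \<Rightarrow> ('a \<Rightarrow> complex) \<Rightarrow> ('a \<Rightarrow> complex) set" where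
  "c0_class X f = c0 X +>\<^bsub>linf_ring X\<^esub> f"

lemma mem_c0_class: "g \<in> c0_class X f \<longleftrightarrow> (\<exists>h\<in>c0 X. g = (\<lambda>x\<in>X. h x + f x))"
  by (auto simp: c0_class_def a_r_coset_def')

lemma c0_class_self: "f \<in> linf X \<Longrightarrow> f \<in> c0_class X f"
  unfolding mem_c0_class
  by (intro bexI[of _ "\<lambda>x\<in>X. 0"]) (auto simp: c0_def linf_def extensional_def)

lemma c0_class_closed: "f \<in> linf X \<Longrightarrow> g \<in> c0_class X f \<Longrightarrow> g \<in> linf X"
  using c0_subset_linf unfolding mem_c0_class by (auto intro!: linf_add)

lemma c0_class_add:
  assumes "f \<in> linf X" "g \<in> linf X"
  shows "c0_class X f \<oplus>\<^bsub>linf_mod_c0 X\<^esub> c0_class X g = c0_class X (\<lambda>x\<in>X. f x + g x)"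
proof -
  interpret ideal "c0 X" "linf_ring X" by (rule ideal_c0)
  show ?thesis using a_rcos_sum[of f g] assms by (simp add: FactRing_def c0_class_def)
qed

lemma c0_class_mult:
  assumes "f \<in> linf X" "g \<in> linf X"
  shows "c0_class X f \<otimes>\<^bsub>linf_mod_c0 X\<^esub> c0_class X g = c0_class X (\<lambda>x\<in>X. f x * g x)"
proof -
  interpret ideal "c0 X" "linf_ring X" by (rule ideal_c0)
  show ?thesis using rcoset_mult_add[of f g] assms by (simp add: FactRing_def c0_class_def)
qed

lemma star_c0_class:
  assumes "f \<in> linf X"
  shows "star_class X (c0_class X f) = c0_class X (\<lambda>x\<in>X. cnj (f x))"
proof -
  have c: "(\<lambda>x\<in>X. cnj (h x)) \<in> c0 X" if "h \<in> c0 X" for h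
    using that by (auto simp: c0_def cong: conj_cong)
  show ?thesis
  proof (intro equalityI subsetI)
    fix g assume "g \<in> star_class X (c0_class X f)"
    then obtain h where "h \<in> c0 X" "g = (\<lambda>x\<in>X. cnj ((\<lambda>x\<in>X. h x + f x) x))"
      by (auto simp: star_class_def mem_c0_class)
    thus "g \<in> c0_class X (\<lambda>x\<in>X. cnj (f x))" unfolding mem_c0_class
      by (intro bexI[of _ "\<lambda>x\<in>X. cnj (h x)"]) (auto intro: c)
  next
    fix g assume "g \<in> c0_class X (\<lambda>x\<in>X. cnj (f x))"
    then obtain h where h: "h \<in> c0 X" "g = (\<lambda>x\<in>X. h x + cnj (f x))"
      by (auto simp: mem_c0_class cong: restrict_cong)
    have "g = (\<lambda>x\<in>X. cnj ((\<lambda>x\<in>X. (\<lambda>x\<in>X. cnj (h x)) x + f x) x))" using h by auto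
    thus "g \<in> star_class X (c0_class X f)"
      using c[OF h(1)] unfolding star_class_def
      by (intro image_eqI[of _ _ "\<lambda>x\<in>X. (\<lambda>x\<in>X. cnj (h x)) x + f x"]) (auto simp only: mem_c0_class)
  qed
qed

lemma right_fixedE:
  assumes "C \<in> right_fixed G"
  obtains f where "f \<in> linf (carrier G)" "C = c0_class (carrier G) f"
  using assms by (auto simp: right_fixed_def FactRing_def A_RCOSETS_def' c0_class_def)

text \<open>Every representative of a right-fixed class is almost invariant under right translation: for
  fixed \<open>g\<close>, the difference \<open>f (x g) - f x\<close> tends to zero as \<open>x\<close> tends to infinity.\<close>

lemma right_fixed_almost_invariant:
  assumes C: "C \<in> right_fixed G" and f: "f \<in> C" and g: "g \<in> carrier G" and e: "e > 0"
  shows "finite {x \<in> carrier G. cmod (f (x \<otimes>\<^bsub>G\<^esub> g) - f x) \<ge> e}"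
proof -
  interpret ideal "c0 (carrier G)" "linf_ring (carrier G)" by (rule ideal_c0)
  obtain f0 where f0: "f0 \<in> linf (carrier G)" "C = c0_class (carrier G) f0"
    using right_fixedE[OF C] by metis
  have "C = c0_class (carrier G) f"
    using abelian_group.a_repr_independence'[OF is_abelian_group _ _ a_subgroup,
        folded a_r_coset_def] f f0
    by (simp add: c0_class_def)
  moreover have "right_translate G g f \<in> C"
    using C imageI[OF f, of "right_translate G g"] g by (simp add: right_fixed_def)
  ultimately obtain h where h: "h \<in> c0 (carrier G)"
     "right_translate G g f = (\<lambda>x\<in>carrier G. h x + f x)"
    by (metis mem_c0_class)
  have "f (x \<otimes>\<^bsub>G\<^esub> g) - f x = h x" if "x \<in> carrier G" for x
    using fun_cong[OF h(2), of x] that by (simp add: right_translate_def)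
  hence "{x \<in> carrier G. cmod (f (x \<otimes>\<^bsub>G\<^esub> g) - f x) \<ge> e} = {x \<in> carrier G. cmod (h x) \<ge> e}"
    by (intro Collect_cong conj_cong) auto
  thus ?thesis using c0_finite[OF h(1) e] by simp
qed

section \<open>A criterion for the failure of proper proximality\<close>

text \<open>Finite families of points \<open>x i\<close>, \<open>i \<in> I N\<close>, of the group that leave every finite set and are
  almost invariant under left multiplication by each \<open>g\<close> up to right multiplication by a finite
  set \<open>E\<close>: apart from a vanishing proportion of the indices, \<open>g x i = x (\<beta> i) e\<close> with \<open>e \<in> E\<close> and \<open>\<beta>\<close>
  injective from \<open>I N\<close> to \<open>I N\<close>. The set \<open>E\<close> depends on \<open>g\<close> but not on \<open>N\<close>. Points are indexed, so
  that repetitions count with multiplicity.\<close>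

locale escaping_family = group G for G :: "('a, 'b) monoid_scheme" (structure) +
  fixes I :: "nat \<Rightarrow> 'i set" and x :: "'i \<Rightarrow> 'a"
  assumes finite_index: "finite (I N)"
    and nonempty_index: "I N \<noteq> {}"
    and point_closed: "i \<in> I N \<Longrightarrow> x i \<in> carrier G"
    and escape: "y \<in> carrier G \<Longrightarrow> eventually (\<lambda>N. y \<notin> x ` I N) sequentially"
    and almost_invariant: "g \<in> carrier G \<Longrightarrow>
      \<exists>E J \<beta>. finite E \<and> E \<subseteq> carrier G \<and>
        eventually (\<lambda>N. J N \<subseteq> I N \<and> inj_on (\<beta> N) (J N) \<and> \<beta> N ` J N \<subseteq> I N \<and>
          (\<forall>i\<in>J N. \<exists>e\<in>E. g \<otimes> x i = x (\<beta> N i) \<otimes> e)) sequentially \<and>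
        (\<lambda>N. real (card (I N - J N)) / real (card (I N))) \<longlonglongrightarrow> 0"
begin

definition avg :: "('a \<Rightarrow> complex) \<Rightarrow> nat \<Rightarrow> complex" where
  "avg f N = (\<Sum>i\<in>I N. f (x i)) / of_nat (card (I N))"

lemma card_index_pos: "card (I N) > 0"
  using finite_index nonempty_index by (simp add: card_gt_0_iff)

lemma norm_avg_le:
  assumes "\<And>i. i \<in> I N \<Longrightarrow> cmod (f (x i)) \<le> B"
  shows "cmod (avg f N) \<le> B"
proof -
  have "cmod (\<Sum>i\<in>I N. f (x i)) \<le> real (card (I N)) * B"
    using assms by (intro sum_norm_bound) auto
  thus ?thesis using card_index_pos[of N]
    by (simp add: avg_def norm_divide divide_le_eq mult.commute)
qed

lemma escape_finite:
  assumes "finite Y" "Y \<subseteq> carrier G"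
  shows "eventually (\<lambda>N. \<forall>i\<in>I N. x i \<notin> Y) sequentially"
proof -
  have "eventually (\<lambda>N. \<forall>y\<in>Y. y \<notin> x ` I N) sequentially"
    using assms escape by (intro eventually_ball_finite) auto
  thus ?thesis by eventually_elim auto
qed

lemma avg_c0: "h \<in> c0 (carrier G) \<Longrightarrow> avg h \<longlonglongrightarrow> 0"
proof (rule tendstoI)
  fix e :: real assume h: "h \<in> c0 (carrier G)" and e: "e > 0"
  have "finite {y \<in> carrier G. cmod (h y) \<ge> e/2}" using h e by (intro c0_finite) simp_all
  hence "eventually (\<lambda>N. \<forall>i\<in>I N. x i \<notin> {y \<in> carrier G. cmod (h y) \<ge> e/2}) sequentially"
    by (intro escape_finite) auto
  thus "eventually (\<lambda>N. dist (avg h N) 0 < e) sequentially"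
  proof eventually_elim
    case (elim N)
    have "cmod (avg h N) \<le> e/2"
      using elim point_closed by (intro norm_avg_le) force
    thus ?case using e by simp
  qed
qed

text \<open>Right-fixed functions do not notice the factors from \<open>E\<close> far out in the group, so their averages
  are asymptotically invariant under left translation.\<close>

lemma avg_left_translate:
  assumes C: "C \<in> right_fixed G" and f: "f \<in> C" and g: "g \<in> carrier G"
  shows "(\<lambda>N. avg (\<lambda>y. f (g \<otimes> y)) N - avg f N) \<longlonglongrightarrow> 0"
proof -
  from almost_invariant[OF g] obtain E J \<beta> where *: "finite E \<and> E \<subseteq> carrier G \<and>
        eventually (\<lambda>N. J N \<subseteq> I N \<and> inj_on (\<beta> N) (J N) \<and> \<beta> N ` J N \<subseteq> I N \<and>
          (\<forall>i\<in>J N. \<exists>e\<in>E. g \<otimes> x i = x (\<beta> N i) \<otimes> e)) sequentially \<and>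
        (\<lambda>N. real (card (I N - J N)) / real (card (I N))) \<longlonglongrightarrow> 0"
    by (elim exE) (rule that)
  note E = *[THEN conjunct1] *[THEN conjunct2, THEN conjunct1]
  note ev = *[THEN conjunct2, THEN conjunct2, THEN conjunct1]
  note lim = *[THEN conjunct2, THEN conjunct2, THEN conjunct2]
  obtain f0 where f0: "f0 \<in> linf (carrier G)" "C = c0_class (carrier G) f0"
    using right_fixedE[OF C] by metis
  obtain B where B: "B \<ge> 0" "\<And>y. y \<in> carrier G \<Longrightarrow> cmod (f y) \<le> B"
    using linfE[OF c0_class_closed[OF f0(1)]] f f0(2) by metis
  show ?thesis
  proof (rule tendstoI)
    fix d :: real assume d: "d > 0"
    define Y where "Y = (\<Union>e\<in>E. {y \<in> carrier G. cmod (f (y \<otimes> e) - f y) \<ge> d/2})"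
    have "finite Y" unfolding Y_def
      using E d by (intro finite_UN_I right_fixed_almost_invariant[OF C f]) auto
    hence "eventually (\<lambda>N. \<forall>i\<in>I N. x i \<notin> Y) sequentially"
      by (rule escape_finite) (auto simp: Y_def)
    moreover have "eventually (\<lambda>N. 2 * B * (real (card (I N - J N)) / real (card (I N))) < d/2) sequentially"
      using d by (intro order_tendstoD(2)[OF tendsto_mult_right_zero[OF lim]]) simp
    ultimately show "eventually (\<lambda>N. dist (avg (\<lambda>y. f (g \<otimes> y)) N - avg f N) 0 < d) sequentially"
      using ev
    proof eventually_elim
      case (elim N)
      define n where "n = real (card (I N))"
      have n: "n > 0" using card_index_pos[of N] by (simp add: n_def)
      have J: "J N \<subseteq> I N" "inj_on (\<beta> N) (J N)" "\<beta> N ` J N \<subseteq> I N"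
        and step: "\<forall>i\<in>J N. \<exists>e\<in>E. g \<otimes> x i = x (\<beta> N i) \<otimes> e" using elim(3) by auto
      have fin: "finite (I N)" "finite (J N)" using finite_index J(1) finite_subset by blast+
      \<comment> \<open>As \<open>\<beta>\<close> is injective, the indices it misses are as few as those where it is undefined.\<close>
      have c: "card (I N - \<beta> N ` J N) = card (I N - J N)"
        using J fin by (simp add: card_Diff_subset card_image)
      let ?a = "\<Sum>i\<in>I N - J N. f (g \<otimes> x i)" and ?b = "\<Sum>i\<in>I N - \<beta> N ` J N. f (x i)"
        and ?c = "\<Sum>i\<in>J N. f (g \<otimes> x i) - f (x (\<beta> N i))"
      have a: "cmod ?a \<le> real (card (I N - J N)) * B"
        using B(2) point_closed g by (intro sum_norm_bound) auto
      have b: "cmod ?b \<le> real (card (I N - J N)) * B"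
        unfolding c[symmetric] using B(2) point_closed by (intro sum_norm_bound) auto
      have d': "cmod ?c \<le> real (card (J N)) * (d/2)"
      proof (intro sum_norm_bound)
        fix i assume i: "i \<in> J N"
        then obtain e where e: "e \<in> E" "g \<otimes> x i = x (\<beta> N i) \<otimes> e" using step by blast
        have "\<beta> N i \<in> I N" using J(3) i by auto
        hence "x (\<beta> N i) \<notin> Y" "x (\<beta> N i) \<in> carrier G" using elim(1) point_closed by auto
        thus "cmod (f (g \<otimes> x i) - f (x (\<beta> N i))) \<le> d/2" using e by (auto simp: Y_def)
      qed
      have eq: "(\<Sum>i\<in>I N. f (g \<otimes> x i)) - (\<Sum>i\<in>I N. f (x i)) = ?a - ?b + ?c"
        using sum.subset_diff[OF J(1) fin(1), of "\<lambda>i. f (g \<otimes> x i)"]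
          sum.subset_diff[OF J(3) fin(1), of "\<lambda>i. f (x i)"] sum.reindex[OF J(2), of "\<lambda>i. f (x i)"]
        by (simp add: sum_subtractf)
      have "cmod ((\<Sum>i\<in>I N. f (g \<otimes> x i)) - (\<Sum>i\<in>I N. f (x i))) \<le>
          real (card (I N - J N)) * B + real (card (I N - J N)) * B + real (card (J N)) * (d/2)"
        unfolding eq using norm_triangle_ineq[of "?a - ?b" ?c] norm_triangle_ineq4[of ?a ?b] a b d' by linarith
      also have "\<dots> \<le> (2 * B * (real (card (I N - J N)) / n) + d/2) * n"
      proof -
        have "real (card (J N)) * (d/2) \<le> n * (d/2)"
          using d card_mono[OF fin(1) J(1)] by (intro mult_right_mono) (simp_all add: n_def)
        moreover have "2 * B * (real (card (I N - J N)) / n) * n = 2 * B * real (card (I N - J N))"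
          using n by simp
        ultimately show ?thesis unfolding distrib_right by (simp add: mult.commute[of n])
      qed
      finally have "cmod ((\<Sum>i\<in>I N. f (g \<otimes> x i)) - (\<Sum>i\<in>I N. f (x i))) / n
          \<le> 2 * B * (real (card (I N - J N)) / n) + d/2"
        using n by (simp only: pos_divide_le_eq)
      moreover have "cmod (avg (\<lambda>y. f (g \<otimes> y)) N - avg f N) =
          cmod ((\<Sum>i\<in>I N. f (g \<otimes> x i)) - (\<Sum>i\<in>I N. f (x i))) / n"
        by (simp only: avg_def diff_divide_distrib[symmetric] norm_divide norm_of_nat n_def)
      ultimately have "cmod (avg (\<lambda>y. f (g \<otimes> y)) N - avg f N)
          \<le> 2 * B * (real (card (I N - J N)) / n) + d/2" by simp
      also have "\<dots> < d" using elim(2) by (simp add: n_def)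
      finally show ?case by simp
    qed
  qed
qed

text \<open>The limit of the averages along an ultrafilter is a left-invariant state on the right-fixed
  algebra. It is defined on a class through an arbitrary representative, which is harmless because
  the averages of functions vanishing at infinity tend to zero.\<close>

theorem not_properly_proximal: "\<not> properly_proximal G"
proof -
  obtain F :: "nat filter" where F: "F \<noteq> bot" "F \<le> sequentially"
    and ultra: "\<And>P. eventually P F \<or> eventually (\<lambda>n. \<not> P n) F"
    using ultrafilter_exists by metis
  define \<phi> where "\<phi> C = Lim F (avg (SOME f. f \<in> C))" for C
  let ?X = "carrier G"
  have to_F: "(a \<longlongrightarrow> l) F" if "a \<longlonglongrightarrow> l" for a :: "nat \<Rightarrow> complex" and l
    using F(2) that by (rule tendsto_mono)
  have avg_cong: "avg f = avg f'" if "\<And>y. y \<in> ?X \<Longrightarrow> f y = f' y" for f f'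
    unfolding avg_def using that point_closed by (auto intro!: sum.cong)
  have avg_add: "avg (\<lambda>y. f y + f' y) N = avg f N + avg f' N" for f f' N
    by (simp add: avg_def sum.distrib add_divide_distrib)
  have lim_exists: "(avg f \<longlongrightarrow> Lim F (avg f)) F" if f: "f \<in> linf ?X" for f
  proof -
    obtain B where B: "\<And>y. y \<in> ?X \<Longrightarrow> cmod (f y) \<le> B" using linfE[OF f] by metis
    have "\<And>N. cmod (avg f N) \<le> B" by (intro norm_avg_le B point_closed)
    hence "bounded (range (avg f))" unfolding bounded_iff by blast
    from ultrafilter_limit_exists[OF F(1) ultra this]
    obtain l where "(avg f \<longlongrightarrow> l) F" by (rule exE)
    thus ?thesis using tendsto_Lim[OF F(1)] by metis
  qed
  have \<phi>: "(avg f' \<longlongrightarrow> \<phi> (c0_class ?X f)) F" if f: "f \<in> linf ?X" and f': "f' \<in> c0_class ?X f" for f f'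
  proof -
    have "(avg k \<longlongrightarrow> Lim F (avg f)) F" if k: "k \<in> c0_class ?X f" for k
    proof -
      from k[unfolded mem_c0_class]
      obtain h where h: "h \<in> c0 ?X" "k = (\<lambda>y\<in>?X. h y + f y)" by (rule bexE)
      have "avg k = avg (\<lambda>y. h y + f y)" by (rule avg_cong) (simp add: h(2))
      hence "avg k = (\<lambda>N. avg h N + avg f N)" by (simp add: avg_add fun_eq_iff)
      thus ?thesis using tendsto_add[OF to_F[OF avg_c0[OF h(1)]] lim_exists[OF f]] by simp
    qed
    moreover have "(SOME k. k \<in> c0_class ?X f) \<in> c0_class ?X f"
      using f' by (intro someI_ex[of "\<lambda>k. k \<in> c0_class ?X f"]) auto
    ultimately show ?thesis using f' tendsto_Lim[OF F(1)] by (metis \<phi>_def)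
  qed
  have unique: "a = b" if "(u \<longlongrightarrow> a) F" "(u \<longlongrightarrow> b) F" for u :: "nat \<Rightarrow> complex" and a b
    using that F(1) by (rule tendsto_unique[rotated])
  have "state_on_right_fixed G \<phi>"
    unfolding state_on_right_fixed_def Let_def
  proof (intro conjI ballI allI)
    fix C D assume "C \<in> right_fixed G" "D \<in> right_fixed G"
    then obtain f k where C: "f \<in> linf ?X" "C = c0_class ?X f" and D: "k \<in> linf ?X" "D = c0_class ?X k"
      using right_fixedE by metis
    let ?s = "\<lambda>y\<in>?X. f y + k y"
    have "avg ?s = (\<lambda>N. avg f N + avg k N)"
      using avg_cong[of ?s "\<lambda>y. f y + k y"] by (auto simp: avg_add)
    moreover have "(avg ?s \<longlongrightarrow> \<phi> (c0_class ?X ?s)) F"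
      using C D by (intro \<phi> c0_class_self linf_add)
    moreover have "((\<lambda>N. avg f N + avg k N) \<longlongrightarrow> \<phi> C + \<phi> D) F"
      using \<phi>[OF C(1) c0_class_self[OF C(1)]] \<phi>[OF D(1) c0_class_self[OF D(1)]] C D
      by (auto intro: tendsto_add)
    ultimately have "\<phi> (c0_class ?X ?s) = \<phi> C + \<phi> D" by (metis unique)
    thus "\<phi> (C \<oplus>\<^bsub>linf_mod_c0 ?X\<^esub> D) = \<phi> C + \<phi> D"
      using C D by (simp add: c0_class_add)
  next
    fix c :: complex and C assume "C \<in> right_fixed G"
    then obtain f where C: "f \<in> linf ?X" "C = c0_class ?X f" using right_fixedE by metis
    let ?s = "\<lambda>y\<in>?X. (\<lambda>y\<in>?X. c) y * f y"
    have "avg ?s = (\<lambda>N. c * avg f N)"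
      using avg_cong[of ?s "\<lambda>y. c * f y"] by (auto simp: avg_def sum_distrib_left)
    moreover have "(avg ?s \<longlongrightarrow> \<phi> (c0_class ?X ?s)) F"
      using C by (intro \<phi> c0_class_self linf_mult linf_const)
    moreover have "((\<lambda>N. c * avg f N) \<longlongrightarrow> c * \<phi> C) F"
      using \<phi>[OF C(1) c0_class_self[OF C(1)]] C by (auto intro: tendsto_mult)
    ultimately have "\<phi> (c0_class ?X ?s) = c * \<phi> C" by (metis unique)
    moreover have "const_class ?X c = c0_class ?X (\<lambda>y\<in>?X. c)"
      by (simp add: const_class_def c0_class_def)
    ultimately show "\<phi> (const_class ?X c \<otimes>\<^bsub>linf_mod_c0 ?X\<^esub> C) = c * \<phi> C"
      using C c0_class_mult[OF linf_const C(1), of c] by simp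
  next
    fix C assume "C \<in> right_fixed G"
    then obtain f where C: "f \<in> linf ?X" "C = c0_class ?X f" using right_fixedE by metis
    let ?c = "\<lambda>y\<in>?X. cnj (f y)"
    let ?s = "\<lambda>y\<in>?X. ?c y * f y"
    have c: "?c \<in> linf ?X" using C(1) by (auto elim!: linfE intro!: linfI)
    have "avg ?s N \<in> \<real>\<^sub>\<ge>\<^sub>0" for N
    proof -
      have "avg ?s N = avg (\<lambda>y. complex_of_real ((cmod (f y))\<^sup>2)) N"
        by (subst avg_cong[of _ "\<lambda>y. complex_of_real ((cmod (f y))\<^sup>2)"])
           (auto simp: complex_norm_square mult.commute simp del: of_real_power)
      also have "\<dots> = of_real ((\<Sum>i\<in>I N. (cmod (f (x i)))\<^sup>2) / real (card (I N)))"
        by (simp add: avg_def)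
      also have "\<dots> \<in> \<real>\<^sub>\<ge>\<^sub>0"
        unfolding nonneg_Reals_of_real_iff by (intro divide_nonneg_nonneg sum_nonneg) auto
      finally show ?thesis .
    qed
    moreover have "(avg ?s \<longlongrightarrow> \<phi> (c0_class ?X ?s)) F"
      using C c by (intro \<phi> c0_class_self linf_mult)
    ultimately have "\<phi> (c0_class ?X ?s) \<in> \<real>\<^sub>\<ge>\<^sub>0"
      using F(1) by (intro Lim_in_closed_set[OF closed_nonneg_Reals_complex]) auto
    thus "\<phi> (star_class ?X C \<otimes>\<^bsub>linf_mod_c0 ?X\<^esub> C) \<in> \<real>\<^sub>\<ge>\<^sub>0"
      using C c by (simp add: star_c0_class c0_class_mult)
  next
    let ?s = "\<lambda>y\<in>?X. 1"
    have "avg ?s = (\<lambda>N. 1)"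
      using avg_cong[of ?s "\<lambda>y. 1"] card_index_pos by (auto simp: avg_def)
    moreover have "(avg ?s \<longlongrightarrow> \<phi> (c0_class ?X ?s)) F"
      by (intro \<phi> c0_class_self linf_const)
    moreover have "((\<lambda>N. 1) \<longlongrightarrow> (1::complex)) F" by simp
    ultimately have "\<phi> (c0_class ?X ?s) = 1" by (metis unique)
    thus "\<phi> \<one>\<^bsub>linf_mod_c0 ?X\<^esub> = 1"
      by (simp add: FactRing_def c0_class_def)
  qed
  moreover have "\<phi> (left_translate G g ` C) = \<phi> C" if g: "g \<in> ?X" and CR: "C \<in> right_fixed G" for g C
  proof -
    obtain f where C: "f \<in> linf ?X" "C = c0_class ?X f" using right_fixedE[OF CR] by metis
    have "(avg k \<longlongrightarrow> \<phi> C) F" if k: "k \<in> left_translate G g ` C" for k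
    proof -
      from k obtain k' where k': "k' \<in> C" "k = left_translate G g k'" by blast
      have "avg k = avg (\<lambda>y. k' (inv g \<otimes> y))" using k' by (intro avg_cong) (simp add: left_translate_def)
      hence "((\<lambda>N. avg k N - avg k' N) \<longlongrightarrow> 0) F"
        using avg_left_translate[OF CR k'(1), of "inv g"] g to_F by simp
      from tendsto_add[OF this \<phi>[OF C(1), of k']] show ?thesis using k'(1) C by simp
    qed
    moreover have "(SOME k. k \<in> left_translate G g ` C) \<in> left_translate G g ` C"
      using c0_class_self[OF C(1)] C(2) by (intro someI_ex[of "\<lambda>k. k \<in> left_translate G g ` C"]) auto
    ultimately show ?thesis using tendsto_Lim[OF F(1)] by (metis \<phi>_def)
  qed
  ultimately show ?thesis by (auto simp: properly_proximal_def left_invariant_state_def)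
qed

end

section \<open>Elementary matrices over Euclidean rings\<close>

text \<open>The products of elementary matrices, that is, the matrices obtained from the identity by
  adding multiples of rows to other rows.\<close>

inductive_set elem_mats :: "nat \<Rightarrow> 'a :: comm_ring_1 mat set" for n where
  one: "1\<^sub>m n \<in> elem_mats n"
| step: "\<lbrakk>A \<in> elem_mats n; i < n; j < n; i \<noteq> j\<rbrakk> \<Longrightarrow> addrow_mat n a i j * A \<in> elem_mats n"

text \<open>Invertibility is used only through a left inverse, a property that row operations preserve.\<close>

definition left_invertible :: "nat \<Rightarrow> 'a :: comm_ring_1 mat \<Rightarrow> bool" where
  "left_invertible n A \<longleftrightarrow> A \<in> carrier_mat n n \<and> (\<exists>C\<in>carrier_mat n n. C * A = 1\<^sub>m n)"

text \<open>The first \<open>k\<close> columns agree with those of the identity matrix.\<close>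

definition standard_cols :: "nat \<Rightarrow> nat \<Rightarrow> 'a :: comm_ring_1 mat \<Rightarrow> bool" where
  "standard_cols n k A \<longleftrightarrow> (\<forall>j<k. \<forall>i<n. A $$ (i,j) = (if i = j then 1 else 0))"

lemma addrow_cancel:
  fixes A :: "'a :: comm_ring_1 mat"
  assumes "A \<in> carrier_mat n n" "i < n" "j < n" "i \<noteq> j"
  shows "addrow_mat n (- a) i j * addrow a i j A = A"
proof -
  have "addrow_mat n (- a) i j * (addrow_mat n a i j * A) = (addrow_mat n (- a) i j * addrow_mat n a i j) * A"
    using assms(1) by (intro assoc_mult_mat[symmetric]) auto
  also have "addrow_mat n (- a) i j * addrow_mat n a i j = 1\<^sub>m n"
    using addrow_mat_inv[OF assms(2-4), of "- a"] by simp
  finally show ?thesis using assms by (simp add: addrow_mat[OF assms(1,3)])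
qed

lemma elem_mats_addrowD:
  assumes "A \<in> carrier_mat n n" "i < n" "j < n" "i \<noteq> j" "addrow a i j A \<in> elem_mats n"
  shows "A \<in> elem_mats n"
  using elem_mats.step[OF assms(5,2,3,4), of "- a"] addrow_cancel[OF assms(1-4)] by simp

lemma left_invertible_addrow:
  assumes A: "left_invertible n A" and ij: "i < n" "j < n" "i \<noteq> j"
  shows "left_invertible n (addrow a i j A)"
proof -
  obtain C where C: "C \<in> carrier_mat n n" "C * A = 1\<^sub>m n" and Ac: "A \<in> carrier_mat n n"
    using A by (auto simp: left_invertible_def)
  have "(C * addrow_mat n (- a) i j) * addrow a i j A = C * (addrow_mat n (- a) i j * addrow a i j A)"
    using C Ac by (intro assoc_mult_mat[where ?n\<^sub>2.0 = n and ?n\<^sub>3.0 = n and ?n\<^sub>4.0 = n]) auto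
  hence "(C * addrow_mat n (- a) i j) * addrow a i j A = 1\<^sub>m n"
    using C Ac ij by (simp add: addrow_cancel)
  thus ?thesis using C Ac unfolding left_invertible_def
    by (intro conjI bexI[of _ "C * addrow_mat n (- a) i j"]) auto
qed

lemma standard_cols_addrow:
  assumes "standard_cols n k A" "A \<in> carrier_mat n n" "i < n" "j < n" "k \<le> j" "k \<le> n"
  shows "standard_cols n k (addrow a i j A)"
  using assms by (auto simp: standard_cols_def)

lemma elem_mats_clear_column:
  fixes A :: "'a :: comm_ring_1 mat"
  assumes "left_invertible n A" "standard_cols n k A" "k < n" "A $$ (k,k) = 1"
    and next_col: "\<And>B :: 'a mat. \<lbrakk>left_invertible n B; standard_cols n (Suc k) B\<rbrakk> \<Longrightarrow> B \<in> elem_mats n"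
  shows "A \<in> elem_mats n"
  using assms(1-4)
proof (induction "card {i. i < n \<and> i \<noteq> k \<and> A $$ (i,k) \<noteq> 0}" arbitrary: A rule: less_induct)
  case less
  have Ac: "A \<in> carrier_mat n n" using less.prems(1) by (simp add: left_invertible_def)
  show ?case
  proof (cases "\<exists>i<n. i \<noteq> k \<and> A $$ (i,k) \<noteq> 0")
    case False
    hence "standard_cols n (Suc k) A"
      using less.prems by (auto simp: standard_cols_def less_Suc_eq)
    thus ?thesis using next_col less.prems(1) by blast
  next
    case True
    then obtain i where i: "i < n" "i \<noteq> k" "A $$ (i,k) \<noteq> 0" by blast
    let ?B = "addrow (- (A $$ (i,k))) i k A"
    have "{l. l < n \<and> l \<noteq> k \<and> ?B $$ (l,k) \<noteq> 0} \<subset> {l. l < n \<and> l \<noteq> k \<and> A $$ (l,k) \<noteq> 0}"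
    proof (rule psubsetI)
      show "{l. l < n \<and> l \<noteq> k \<and> ?B $$ (l,k) \<noteq> 0} \<subseteq> {l. l < n \<and> l \<noteq> k \<and> A $$ (l,k) \<noteq> 0}"
      proof clarify
        fix l assume l: "l < n" "?B $$ (l,k) \<noteq> 0" "A $$ (l,k) = 0"
        hence "l \<noteq> i" using i(3) by metis
        thus False using l less.prems(3) Ac by simp
      qed
      have "?B $$ (i,k) = 0" using i less.prems(3,4) Ac by simp
      thus "{l. l < n \<and> l \<noteq> k \<and> ?B $$ (l,k) \<noteq> 0} \<noteq> {l. l < n \<and> l \<noteq> k \<and> A $$ (l,k) \<noteq> 0}"
        using i by blast
    qed
    hence "card {l. l < n \<and> l \<noteq> k \<and> ?B $$ (l,k) \<noteq> 0} < card {l. l < n \<and> l \<noteq> k \<and> A $$ (l,k) \<noteq> 0}"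
      by (intro psubset_card_mono) auto
    hence "?B \<in> elem_mats n"
      using less.prems i Ac
      by (intro less.hyps left_invertible_addrow standard_cols_addrow) auto
    thus ?thesis using elem_mats_addrowD[OF Ac i(1) less.prems(3) i(2)] by blast
  qed
qed

text \<open>The Euclidean algorithm on the entries on and below the diagonal of column \<open>k\<close>: it ends
  with a single nonzero entry, which is a unit because the matrix is invertible and the columns
  before \<open>k\<close> are already standard.\<close>

lemma elem_mats_reduce_column:
  fixes A :: "'a :: euclidean_ring mat"
  assumes units: "\<And>u :: 'a. u dvd 1 \<Longrightarrow> u = 1"
    and "left_invertible n A" "standard_cols n k A" and k: "k < n"
    and next_col: "\<And>B :: 'a mat. \<lbrakk>left_invertible n B; standard_cols n (Suc k) B\<rbrakk> \<Longrightarrow> B \<in> elem_mats n"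
  shows "A \<in> elem_mats n"
  using assms(2,3)
proof (induction "\<Sum>i\<in>{k..<n}. euclidean_size (A $$ (i,k))" arbitrary: A rule: less_induct)
  case less
  have Ac: "A \<in> carrier_mat n n" using less.prems(1) by (simp add: left_invertible_def)
  show ?case
  proof (cases "\<exists>i j. i \<in> {k..<n} \<and> j \<in> {k..<n} \<and> i \<noteq> j \<and> A $$ (i,k) \<noteq> 0 \<and> A $$ (j,k) \<noteq> 0")
    case True
    then obtain i j where ij: "i \<in> {k..<n}" "j \<in> {k..<n}" "i \<noteq> j" "A $$ (i,k) \<noteq> 0" "A $$ (j,k) \<noteq> 0"
      and size: "euclidean_size (A $$ (i,k)) \<le> euclidean_size (A $$ (j,k))"
      by (metis nle_le)
    let ?B = "addrow (- (A $$ (j,k) div A $$ (i,k))) j i A"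
    have Bj: "?B $$ (j,k) = A $$ (j,k) mod A $$ (i,k)"
      using ij k Ac by (simp add: minus_div_mult_eq_mod[symmetric])
    have lt: "euclidean_size (?B $$ (j,k)) < euclidean_size (A $$ (j,k))"
      using mod_size_less[OF ij(4), of "A $$ (j,k)"] size by (simp only: Bj)
    have "(\<Sum>l\<in>{k..<n}. euclidean_size (?B $$ (l,k))) < (\<Sum>l\<in>{k..<n}. euclidean_size (A $$ (l,k)))"
    proof (rule sum_strict_mono_ex1)
      show "\<forall>l\<in>{k..<n}. euclidean_size (?B $$ (l,k)) \<le> euclidean_size (A $$ (l,k))"
      proof
        fix l assume "l \<in> {k..<n}"
        thus "euclidean_size (?B $$ (l,k)) \<le> euclidean_size (A $$ (l,k))"
          using lt Ac k by (cases "l = j") auto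
      qed
    qed (use lt ij in auto)
    hence "?B \<in> elem_mats n"
      using less.prems ij k Ac
      by (intro less.hyps left_invertible_addrow standard_cols_addrow) auto
    thus ?thesis using elem_mats_addrowD[OF Ac, of j i] ij by auto
  next
    case False
    obtain C where C: "C \<in> carrier_mat n n" "C * A = 1\<^sub>m n"
      using less.prems(1) by (auto simp: left_invertible_def)
    have entry: "(\<Sum>i\<in>{0..<n}. C $$ (k,i) * A $$ (i,j)) = (if k = j then 1 else 0)" if "j < n" for j
    proof -
      have "(C * A) $$ (k,j) = (\<Sum>i\<in>{0..<n}. C $$ (k,i) * A $$ (i,j))"
        using C(1) Ac k that by (simp add: scalar_prod_def)
      thus ?thesis using C(2) k that by simp
    qed
    \<comment> \<open>Row \<open>k\<close> of \<open>C A = 1\<close>: the standard columns make the entries of \<open>C\<close> before \<open>k\<close> vanish.\<close>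
    have C0: "C $$ (k,j) = 0" if j: "j < k" for j
    proof -
      have "(\<Sum>i\<in>{0..<n}. C $$ (k,i) * A $$ (i,j)) = (\<Sum>i\<in>{0..<n}. if i = j then C $$ (k,i) else 0)"
        using less.prems(2) j by (intro sum.cong) (auto simp: standard_cols_def)
      also have "\<dots> = C $$ (k,j)" using j k by (simp add: sum.delta)
      finally show ?thesis using entry[of j] j k by simp
    qed
    have "\<exists>i\<in>{k..<n}. A $$ (i,k) \<noteq> 0"
    proof (rule ccontr)
      assume "\<not> ?thesis"
      hence "(\<Sum>i\<in>{0..<n}. C $$ (k,i) * A $$ (i,k)) = 0"
        using C0 by (intro sum.neutral) (auto simp: not_less[symmetric])
      thus False using entry[OF k] by simp
    qed
    then obtain i where i: "i \<in> {k..<n}" "A $$ (i,k) \<noteq> 0" by blast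
    have other: "A $$ (j,k) = 0" if "j \<in> {k..<n}" "j \<noteq> i" for j
      using False that i by blast
    have "(\<Sum>j\<in>{0..<n}. C $$ (k,j) * A $$ (j,k)) = (\<Sum>j\<in>{0..<n}. if j = i then C $$ (k,j) * A $$ (j,k) else 0)"
      using C0 other by (intro sum.cong) (auto simp: not_less[symmetric])
    also have "\<dots> = C $$ (k,i) * A $$ (i,k)" using i by (simp add: sum.delta)
    finally have "1 = A $$ (i,k) * C $$ (k,i)" using entry[OF k] by (simp add: mult.commute)
    hence Ai: "A $$ (i,k) = 1" by (intro units) (rule dvdI)
    show ?thesis
    proof (cases "i = k")
      case True
      thus ?thesis using elem_mats_clear_column[OF less.prems k _ next_col] Ai by blast
    next
      case False
      let ?B = "addrow 1 k i A"
      have "?B $$ (k,k) = 1" using other[of k] Ai k Ac False i by simp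
      hence "?B \<in> elem_mats n"
        using less.prems i k Ac False
        by (intro elem_mats_clear_column[OF _ _ k _ next_col] left_invertible_addrow standard_cols_addrow) auto
      thus ?thesis using elem_mats_addrowD[OF Ac k _ False[symmetric]] i by auto
    qed
  qed
qed

text \<open>Over a Euclidean ring whose only unit is \<open>1\<close>, every invertible matrix is a product of elementary
  matrices. The hypothesis on the units spares the reduction of diagonal matrices.\<close>

theorem left_invertible_imp_elem_mats:
  fixes A :: "'a :: euclidean_ring mat"
  assumes units: "\<And>u :: 'a. u dvd 1 \<Longrightarrow> u = 1" and A: "left_invertible n A"
  shows "A \<in> elem_mats n"
proof -
  have "\<forall>A :: 'a mat. left_invertible n A \<longrightarrow> standard_cols n k A \<longrightarrow> A \<in> elem_mats n" if "k \<le> n" for k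
    using that
  proof (induction k rule: inc_induct)
    case base
    show ?case
    proof (intro allI impI)
      fix A :: "'a mat" assume "left_invertible n A" "standard_cols n n A"
      hence "A = 1\<^sub>m n" by (intro eq_matI) (auto simp: standard_cols_def left_invertible_def)
      thus "A \<in> elem_mats n" by (simp add: elem_mats.one)
    qed
  next
    case (step k)
    thus ?case using elem_mats_reduce_column[OF units] by blast
  qed
  from this[of 0] show ?thesis using A by (simp add: standard_cols_def)
qed

text \<open>The commutator relation, from which the elementary matrices with entries of higher degree are
  generated by those of degree at most one.\<close>

lemma addrow_mat_commutator:
  fixes a b :: "'a :: comm_ring_1"
  assumes "i < n" "j < n" "k < n" "i \<noteq> j" "i \<noteq> k" "k \<noteq> j"
  shows "addrow_mat n a i k * (addrow_mat n b k j * (addrow_mat n (- a) i k * addrow_mat n (- b) k j))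
    = addrow_mat n (a * b) i j"
proof -
  have row: "addrow_mat n c r l * M = addrow c r l M" if "M \<in> carrier_mat n n" "l < n" for c r l and M :: "'a mat"
    using addrow_mat[OF that] by simp
  have "addrow_mat n a i k * (addrow_mat n b k j * (addrow_mat n (- a) i k * addrow_mat n (- b) k j))
     = addrow a i k (addrow b k j (addrow (- a) i k (addrow_mat n (- b) k j)))"
    using assms by (simp add: row)
  also have "\<dots> = addrow_mat n (a * b) i j"
    using assms by (intro eq_matI) (auto simp: algebra_simps)
  finally show ?thesis .
qed

lemma addrow_mat_add:
  fixes a b :: "'a :: comm_ring_1"
  assumes "i < n" "j < n" "i \<noteq> j"
  shows "addrow_mat n a i j * addrow_mat n b i j = addrow_mat n (a + b) i j"
proof -
  have "addrow_mat n a i j * addrow_mat n b i j = addrow a i j (addrow_mat n b i j)"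
    using assms by (simp add: addrow_mat[where n = n and nc = n])
  also have "\<dots> = addrow_mat n (a + b) i j"
    using assms by (intro eq_matI) (auto simp: algebra_simps)
  finally show ?thesis .
qed

section \<open>Laurent polynomials over the field with two elements\<close>

lemma bit_cases: "b = 0 \<or> b = (1 :: bit)"
  by (cases b) auto

lemma const_K_0 [simp]: "const_K 0 = 0" and const_K_1 [simp]: "const_K 1 = 1"
  by (simp_all add: const_K_def one_pCons[symmetric])

lemma const_K_eq_1_iff [simp]: "const_K b = 1 \<longleftrightarrow> b = 1"
  using bit_cases[of b] by auto

lemma const_K_add: "const_K (a + b) = const_K a + const_K b"
  by (simp only: const_K_def to_fract_add[symmetric] add_pCons add_0_left)

lemma to_fract_power: "to_fract (p ^ n) = to_fract p ^ n"
  by (induction n) simp_all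

lemma t_K_nonzero [simp]: "t_K \<noteq> 0"
  by (simp add: t_K_def)

text \<open>In characteristic two, signs disappear; as simplification rules, the following facts remove
  subtraction from all terms over the field.\<close>

lemma K_add_self [simp]: "(x :: K) + x = 0"
proof -
  have "x + x = x * (const_K 1 + const_K 1)"
    by (simp only: distrib_left const_K_1 mult_1_right)
  also have "const_K 1 + const_K 1 = const_K (1 + 1)" by (rule const_K_add[symmetric])
  also have "(1 :: bit) + 1 = 0" by simp
  finally show ?thesis by simp
qed

lemma K_uminus [simp]: "- (x :: K) = x"
  by (rule minus_unique) simp

lemma K_minus [simp]: "(x :: K) - y = x + y"
  using K_uminus[of y] by (simp only: diff_conv_add_uminus)

text \<open>Since the field of constants is \<open>{0, 1}\<close>, the Laurent polynomials whose exponents lie in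
  \<open>B\<close> are the sums of \<open>t\<^sup>i\<close> over the finite subsets of \<open>B\<close>.\<close>

definition lspan :: "int set \<Rightarrow> K set" where
  "lspan B = {\<Sum>i\<in>A. t_K powi i | A. finite A \<and> A \<subseteq> B}"

lemma lspanI: "finite A \<Longrightarrow> A \<subseteq> B \<Longrightarrow> (\<Sum>i\<in>A. t_K powi i) \<in> lspan B"
  by (auto simp: lspan_def)

lemma lspan_0 [simp]: "0 \<in> lspan B"
  using lspanI[of "{}" B] by simp

lemma lspan_powi: "i \<in> B \<Longrightarrow> t_K powi i \<in> lspan B"
  using lspanI[of "{i}" B] by simp

lemma lspan_mono: "B \<subseteq> C \<Longrightarrow> lspan B \<subseteq> lspan C"
  by (auto simp: lspan_def)

lemma sum_powi_add:
  assumes "finite A" "finite B"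
  shows "(\<Sum>i\<in>A. t_K powi i) + (\<Sum>i\<in>B. t_K powi i) = (\<Sum>i\<in>(A - B) \<union> (B - A). t_K powi i)"
proof -
  have "(\<Sum>i\<in>A. t_K powi i) = (\<Sum>i\<in>A - B. t_K powi i) + (\<Sum>i\<in>A \<inter> B. t_K powi i)"
    using assms by (subst sum.union_disjoint[symmetric]) (auto intro: sum.cong)
  moreover have "(\<Sum>i\<in>B. t_K powi i) = (\<Sum>i\<in>B - A. t_K powi i) + (\<Sum>i\<in>A \<inter> B. t_K powi i)"
    using assms by (subst sum.union_disjoint[symmetric]) (auto intro: sum.cong)
  moreover have "(\<Sum>i\<in>(A - B) \<union> (B - A). t_K powi i) = (\<Sum>i\<in>A - B. t_K powi i) + (\<Sum>i\<in>B - A. t_K powi i)"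
    using assms by (intro sum.union_disjoint) auto
  moreover have "x + z + (y + z) = x + y" for x y z :: K
  proof -
    have "x + z + (y + z) = x + y + (z + z)" by (simp only: add_ac)
    thus ?thesis by simp
  qed
  ultimately show ?thesis by metis
qed

lemma lspan_add: "x \<in> lspan B \<Longrightarrow> y \<in> lspan B \<Longrightarrow> x + y \<in> lspan B"
proof -
  assume "x \<in> lspan B" "y \<in> lspan B"
  then obtain A A' where A: "finite A" "A \<subseteq> B" "x = (\<Sum>i\<in>A. t_K powi i)"
    and A': "finite A'" "A' \<subseteq> B" "y = (\<Sum>i\<in>A'. t_K powi i)"
    by (auto simp: lspan_def)
  have "x + y = (\<Sum>i\<in>(A - A') \<union> (A' - A). t_K powi i)"
    unfolding A A' using A(1) A'(1) by (rule sum_powi_add)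
  thus "x + y \<in> lspan B" using A A' by (auto intro!: lspanI)
qed

lemma lspan_sum: "(\<And>i. i \<in> I \<Longrightarrow> f i \<in> lspan B) \<Longrightarrow> (\<Sum>i\<in>I. f i) \<in> lspan B"
  by (induction I rule: infinite_finite_induct) (auto intro: lspan_add)

lemma lspan_mult:
  assumes "x \<in> lspan B" "y \<in> lspan C" "\<And>b c. b \<in> B \<Longrightarrow> c \<in> C \<Longrightarrow> b + c \<in> D"
  shows "x * y \<in> lspan D"
proof -
  from assms(1,2) obtain A A' where A: "A \<subseteq> B" "x = (\<Sum>i\<in>A. t_K powi i)"
    and A': "A' \<subseteq> C" "y = (\<Sum>i\<in>A'. t_K powi i)" by (auto simp: lspan_def)
  have "x * y = (\<Sum>i\<in>A. \<Sum>j\<in>A'. t_K powi (i + j))"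
    by (simp add: A A' sum_product power_int_add)
  also have "\<dots> \<in> lspan D"
    using A A' assms(3) by (intro lspan_sum lspan_powi) blast
  finally show ?thesis .
qed

lemma lspan_split:
  assumes "x \<in> lspan (B \<union> C)"
  obtains y z where "y \<in> lspan B" "z \<in> lspan C" "x = y + z"
proof -
  obtain A where A: "finite A" "A \<subseteq> B \<union> C" "x = (\<Sum>i\<in>A. t_K powi i)"
    using assms by (auto simp: lspan_def)
  have "x = (\<Sum>i\<in>A \<inter> B. t_K powi i) + (\<Sum>i\<in>A - B. t_K powi i)"
    unfolding A(3) using A(1) by (subst sum.union_disjoint[symmetric]) (auto intro: sum.cong)
  thus ?thesis using A by (intro that[of "\<Sum>i\<in>A \<inter> B. t_K powi i" "\<Sum>i\<in>A - B. t_K powi i"] lspanI) auto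
qed

lemma finite_lspan: "finite B \<Longrightarrow> finite (lspan B)"
proof -
  assume "finite B"
  hence "finite ((\<lambda>A. \<Sum>i\<in>A. t_K powi i) ` Pow B)" by simp
  thus ?thesis by (rule rev_finite_subset) (auto simp: lspan_def)
qed

lemma lspan_bounded:
  assumes "x \<in> lspan B"
  obtains n where "x \<in> lspan (B \<inter> {- int n..int n})"
proof -
  obtain A where A: "finite A" "A \<subseteq> B" "x = (\<Sum>i\<in>A. t_K powi i)"
    using assms by (auto simp: lspan_def)
  have "A \<subseteq> {- int (nat (Max (abs ` A)))..int (nat (Max (abs ` A)))}"
  proof
    fix i assume "i \<in> A"
    hence "\<bar>i\<bar> \<le> Max (abs ` A)" using A(1) by (intro Max_ge) auto
    thus "i \<in> {- int (nat (Max (abs ` A)))..int (nat (Max (abs ` A)))}" by auto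
  qed
  thus ?thesis using A by (intro that[of "nat (Max (abs ` A))"]) (simp only: A(3), intro lspanI, auto)
qed

text \<open>The powers of \<open>t\<close> are linearly independent.\<close>

lemma sum_powi_eq_0:
  assumes A: "finite A" and 0: "(\<Sum>i\<in>A. t_K powi i) = 0"
  shows "A = {}"
proof (rule ccontr)
  assume "A \<noteq> {}"
  define m where "m = Min A"
  have m: "m \<in> A" "\<And>i. i \<in> A \<Longrightarrow> m \<le> i" using A \<open>A \<noteq> {}\<close> by (auto simp: m_def)
  define p :: "bit poly" where "p = (\<Sum>i\<in>A. monom 1 (nat (i - m)))"
  have "to_fract p = (\<Sum>i\<in>A. to_fract (monom 1 (nat (i - m))))"
    unfolding p_def using A by (induction A rule: finite_induct) simp_all
  also have "\<dots> = (\<Sum>i\<in>A. t_K powi (i - m))"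
  proof (intro sum.cong refl)
    fix i assume "i \<in> A"
    have "to_fract (monom 1 n) = t_K ^ n" for n
      by (simp add: t_K_def monom_altdef to_fract_power)
    thus "to_fract (monom 1 (nat (i - m))) = t_K powi (i - m)"
      using m(2)[OF \<open>i \<in> A\<close>] by (simp add: power_int_def)
  qed
  also have "\<dots> = (\<Sum>i\<in>A. t_K powi i) * t_K powi (- m)"
    by (simp add: sum_distrib_right power_int_add[symmetric])
  finally have "p = 0" using 0 by simp
  moreover have "coeff p 0 = (\<Sum>i\<in>A. if i = m then 1 else 0)"
    unfolding p_def coeff_sum using m(2) by (intro sum.cong) force+
  ultimately show False using m(1) A by simp
qed

text \<open>In particular the Laurent polynomials with exponents in disjoint sets meet only in zero.\<close>

lemma lspan_disjoint:
  assumes "x \<in> lspan B" "x \<in> lspan C" "B \<inter> C = {}"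
  shows "x = 0"
proof -
  obtain A A' where A: "finite A" "A \<subseteq> B" "x = (\<Sum>i\<in>A. t_K powi i)"
    and A': "finite A'" "A' \<subseteq> C" "x = (\<Sum>i\<in>A'. t_K powi i)"
    using assms by (auto simp: lspan_def)
  have "(\<Sum>i\<in>(A - A') \<union> (A' - A). t_K powi i) = x + x"
    using A A' sum_powi_add[of A A'] by simp
  hence "(A - A') \<union> (A' - A) = {}" using A A' by (intro sum_powi_eq_0) auto
  hence "A = {}" using A A' assms(3) by blast
  thus ?thesis using A by simp
qed

lemma t_K_powi_inj: "t_K powi i = t_K powi j \<longleftrightarrow> i = j"
proof
  assume eq: "t_K powi i = t_K powi j"
  show "i = j"
  proof (rule ccontr)
    assume "i \<noteq> j"
    thus False using lspan_disjoint[of "t_K powi i" "{i}" "{j}"] lspan_powi[of i "{i}"]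
        lspan_powi[of j "{j}"] eq by simp
  qed
qed simp

lemma L_ring_eq: "L_ring = lspan UNIV"
proof (intro equalityI subsetI)
  fix x assume "x \<in> L_ring"
  then obtain a n where x: "x = (\<Sum>i\<in>{- int n..int n}. const_K (a i) * t_K powi i)"
    by (auto simp: L_ring_def)
  have "const_K (a i) * t_K powi i \<in> lspan UNIV" for i
    using bit_cases[of "a i"] by (elim disjE) (simp_all add: lspan_powi)
  thus "x \<in> lspan UNIV" unfolding x by (intro lspan_sum)
next
  fix x assume "x \<in> lspan UNIV"
  then obtain n where "x \<in> lspan (UNIV \<inter> {- int n..int n})" using lspan_bounded by blast
  then obtain A where A: "A \<subseteq> {- int n..int n}" "x = (\<Sum>i\<in>A. t_K powi i)"
    by (auto simp: lspan_def)
  have "x = (\<Sum>i\<in>{- int n..int n}. const_K (if i \<in> A then 1 else 0) * t_K powi i)"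
    unfolding A(2) using A(1) by (intro sum.mono_neutral_cong_left) auto
  thus "x \<in> L_ring" unfolding L_ring_def mem_Collect_eq
    by (intro exI[of _ "\<lambda>i. if i \<in> A then 1 else 0"] exI[of _ n]) simp
qed

lemma inverse_powi: "inverse t_K ^ i = t_K powi (- int i)"
  by (simp add: power_int_minus power_inverse)

lemma R_ring_eq: "R_ring = lspan {..0}"
proof (intro equalityI subsetI)
  fix x assume "x \<in> R_ring"
  then obtain a n where x: "x = (\<Sum>i\<le>n. const_K (a i) * inverse t_K ^ i)"
    by (auto simp: R_ring_def)
  have "const_K (a i) * inverse t_K ^ i \<in> lspan {..0}" for i
    unfolding inverse_powi using bit_cases[of "a i"] by (elim disjE) (simp_all add: lspan_powi)
  thus "x \<in> lspan {..0}" unfolding x by (intro lspan_sum)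
next
  fix x assume "x \<in> lspan {..0}"
  then obtain n where "x \<in> lspan ({..0} \<inter> {- int n..int n})" using lspan_bounded by blast
  then obtain A where A: "A \<subseteq> {- int n..0}" "x = (\<Sum>i\<in>A. t_K powi i)"
    by (auto simp: lspan_def)
  have "x = (\<Sum>i\<in>{- int n..0}. const_K (if i \<in> A then 1 else 0) * t_K powi i)"
    unfolding A(2) using A(1) by (intro sum.mono_neutral_cong_left) auto
  also have "\<dots> = (\<Sum>i\<le>n. const_K (if - int i \<in> A then 1 else 0) * inverse t_K ^ i)"
    unfolding inverse_powi
    by (rule sum.reindex_bij_witness[of _ "\<lambda>i. - int i" "\<lambda>i. nat (- i)"]) auto
  finally show "x \<in> R_ring" unfolding R_ring_def mem_Collect_eq
    by (intro exI[of _ "\<lambda>i. if - int i \<in> A then 1 else 0"] exI[of _ n]) simp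
qed

text \<open>The evaluation \<open>s \<mapsto> t\<^sup>-\<^sup>1\<close> identifies the polynomial ring \<open>\<bbbF>\<^sub>2[s]\<close> with \<open>R\<close>, which makes the
  Euclidean algorithm available.\<close>

definition eval_inv_t :: "bit poly \<Rightarrow> K" where
  "eval_inv_t p = poly (map_poly const_K p) (inverse t_K)"

lemma eval_inv_t_0 [simp]: "eval_inv_t 0 = 0"
  by (simp add: eval_inv_t_def)

lemma eval_inv_t_pCons: "eval_inv_t (pCons a p) = const_K a + inverse t_K * eval_inv_t p"
  by (cases "p = 0 \<and> a = 0") (auto simp: eval_inv_t_def map_poly_pCons)

lemma eval_inv_t_1 [simp]: "eval_inv_t 1 = 1"
  by (simp add: one_pCons eval_inv_t_pCons)

lemma eval_inv_t_s: "eval_inv_t [:0, 1:] = inverse t_K"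
  by (simp add: eval_inv_t_pCons)

lemma eval_inv_t_add: "eval_inv_t (p + q) = eval_inv_t p + eval_inv_t q"
  by (induction p q rule: poly_induct2) (auto simp: eval_inv_t_pCons const_K_add algebra_simps)

lemma eval_inv_t_mult: "eval_inv_t (p * q) = eval_inv_t p * eval_inv_t q"
proof (induction p)
  case (pCons a p)
  have "eval_inv_t (smult a q) = const_K a * eval_inv_t q"
    using bit_cases[of a] by auto
  thus ?case using pCons
    by (simp add: eval_inv_t_pCons eval_inv_t_add algebra_simps)
qed auto

lemma comm_ring_hom_eval_inv_t: "comm_ring_hom eval_inv_t"
  by unfold_locales (auto simp: eval_inv_t_add eval_inv_t_mult)

lemma finite_coeff_eq_1: "finite {n. coeff p n = (1 :: bit)}"
  by (rule finite_subset[of _ "{..degree p}"]) (auto intro: le_degree)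

lemma eval_inv_t_sum: "eval_inv_t p = (\<Sum>i\<in>(\<lambda>n. - int n) ` {n. coeff p n = 1}. t_K powi i)"
proof -
  have "eval_inv_t p = (\<Sum>i\<le>degree p. const_K (coeff p i) * inverse t_K ^ i)"
  proof (cases "p = 0")
    case False
    have "degree (map_poly const_K p) = degree p"
      using False bit_cases[of "lead_coeff p"] by (intro degree_map_poly) auto
    thus ?thesis by (simp add: eval_inv_t_def poly_altdef coeff_map_poly)
  qed simp
  also have "\<dots> = (\<Sum>i\<in>{n. coeff p n = 1}. inverse t_K ^ i)"
    using bit_cases by (intro sum.mono_neutral_cong_right) (auto intro: le_degree)
  also have "\<dots> = (\<Sum>i\<in>(\<lambda>n. - int n) ` {n. coeff p n = 1}. t_K powi i)"
    by (subst sum.reindex) (auto simp: inj_on_def inverse_powi)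
  finally show ?thesis .
qed

lemma eval_inv_t_eq_0: "eval_inv_t p = 0 \<longleftrightarrow> p = 0"
proof
  assume "eval_inv_t p = 0"
  moreover note finite_coeff_eq_1[of p]
  ultimately have "{n. coeff p n = 1} = {}"
    using sum_powi_eq_0[of "(\<lambda>n. - int n) ` {n. coeff p n = 1}"] by (auto simp: eval_inv_t_sum)
  thus "p = 0" using bit_cases by (intro poly_eqI) force
qed simp

lemma eval_inv_t_eq_iff: "eval_inv_t p = eval_inv_t q \<longleftrightarrow> p = q"
proof -
  have "p + q = 0 \<longleftrightarrow> p = q" by (simp add: add_eq_0_iff2) (auto intro!: poly_eqI simp: minus_equation_iff)
  thus ?thesis using eval_inv_t_eq_0[of "p + q"] by (metis K_minus eq_iff_diff_eq_0 eval_inv_t_add)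
qed

lemma range_eval_inv_t: "range eval_inv_t = R_ring"
proof (intro equalityI subsetI)
  fix x assume "x \<in> R_ring"
  then obtain a n where x: "x = (\<Sum>i\<le>n. const_K (a i) * inverse t_K ^ i)"
    by (auto simp: R_ring_def)
  have 1: "\<exists>p. inverse t_K ^ i = eval_inv_t p" for i
  proof (induction i)
    case (Suc i)
    thus ?case by (metis eval_inv_t_mult eval_inv_t_s power_Suc)
  qed (auto intro: exI[of _ 1])
  have 2: "\<exists>p. const_K (a i) * inverse t_K ^ i = eval_inv_t p" for i
    using bit_cases[of "a i"] 1[of i] by (auto intro: exI[of _ 0])
  have "\<exists>p. (\<Sum>i\<le>n. const_K (a i) * inverse t_K ^ i) = eval_inv_t p" for n
  proof (induction n)
    case 0
    show ?case using 2[of 0] by simp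
  next
    case (Suc n)
    then obtain p q where "(\<Sum>i\<le>n. const_K (a i) * inverse t_K ^ i) = eval_inv_t p"
      "const_K (a (Suc n)) * inverse t_K ^ Suc n = eval_inv_t q" using 2[of "Suc n"] by blast
    thus ?case by (intro exI[of _ "p + q"]) (simp add: eval_inv_t_add)
  qed
  thus "x \<in> range eval_inv_t" using x by blast
next
  fix x assume "x \<in> range eval_inv_t"
  thus "x \<in> R_ring" unfolding R_ring_eq eval_inv_t_sum
    by (auto intro!: lspanI finite_imageI finite_coeff_eq_1)
qed

section \<open>The local ring at \<open>t = 0\<close>\<close>

text \<open>The valuation ring of the place \<open>t = 0\<close>, at which \<open>s = t\<^sup>-\<^sup>1\<close> has a pole. It only serves to compare
  the sizes of two coordinates of a vector.\<close>

definition loc_ring :: "K set" where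
  "loc_ring = {to_fract a / to_fract b | a b. poly b 0 \<noteq> 0}"

lemma loc_ring_add: 
  assumes "x \<in> loc_ring" "y \<in> loc_ring" shows "x + y \<in> loc_ring"
proof -
  obtain a b c d where "x = to_fract a / to_fract b" "poly b 0 \<noteq> 0"
    "y = to_fract c / to_fract d" "poly d 0 \<noteq> 0" using assms by (auto simp: loc_ring_def)
  moreover from this have "b \<noteq> 0" "d \<noteq> 0" by auto
  ultimately have "x + y = to_fract (a * d + c * b) / to_fract (b * d)" "poly (b * d) 0 \<noteq> 0"
    by (simp_all add: add_frac_eq)
  thus ?thesis unfolding loc_ring_def by blast
qed

lemma loc_ring_valuation: "x \<in> loc_ring \<or> inverse x \<in> loc_ring"
proof -
  obtain a b where ab: "x = to_fract a / to_fract b" "b \<noteq> 0"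
    by (cases x rule: Fract_cases) (auto simp: Fract_conv_to_fract)
  show ?thesis
  proof (cases "a = 0")
    case True
    have "x = to_fract 0 / to_fract 1" using True ab by simp
    moreover have "poly 1 (0::bit) \<noteq> 0" by simp
    ultimately show ?thesis unfolding loc_ring_def by blast
  next
    case False
    define X :: "bit poly" where "X = [:- 0, 1:]"
    have X: "X dvd p \<longleftrightarrow> poly p 0 = 0" for p unfolding X_def by (rule poly_eq_0_iff_dvd[symmetric])
    have X0: "to_fract X \<noteq> 0" by (simp add: X_def)
    obtain a' m where a': "a = X ^ m * a'" "poly a' 0 \<noteq> 0"
      using order_decomp[OF False, of 0] X unfolding X_def by metis
    obtain b' n where b': "b = X ^ n * b'" "poly b' 0 \<noteq> 0"
      using order_decomp[OF ab(2), of 0] X unfolding X_def by metis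
    show ?thesis
    proof (cases "n \<le> m")
      case True
      hence "x = to_fract (X ^ (m - n) * a') / to_fract b'"
        using X0 unfolding ab a' b' to_fract_mult to_fract_power by (simp add: power_diff)
      thus ?thesis using b' unfolding loc_ring_def by blast
    next
      case False
      hence "inverse x = to_fract (X ^ (n - m) * b') / to_fract a'"
        using X0 unfolding ab a' b' to_fract_mult to_fract_power by (simp add: power_diff)
      thus ?thesis using a' unfolding loc_ring_def by blast
    qed
  qed
qed

lemma inverse_powers_not_in_loc_ring:
  assumes "m < n" shows "inverse t_K ^ m + inverse t_K ^ n \<notin> loc_ring"
proof
  assume "inverse t_K ^ m + inverse t_K ^ n \<in> loc_ring"
  then obtain a b where ab: "inverse t_K ^ m + inverse t_K ^ n = to_fract a / to_fract b" "poly b 0 \<noteq> 0"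
    by (auto simp: loc_ring_def)
  have b: "to_fract b \<noteq> 0" using ab(2) by auto
  have "t_K ^ n * to_fract a = to_fract b * (t_K ^ n * (inverse t_K ^ m + inverse t_K ^ n))"
    using b by (simp add: ab)
  also have "t_K ^ n * (inverse t_K ^ m + inverse t_K ^ n) = t_K ^ (n - m) + 1"
    using assms by (simp add: distrib_left power_inverse power_diff field_simps)
  finally have "to_fract ([:0,1:] ^ n * a) = to_fract (b * ([:0,1:] ^ (n - m) + 1))"
    by (simp only: to_fract_mult to_fract_power to_fract_add to_fract_1 t_K_def)
  hence "[:0,1:] ^ n * a = b * ([:0,1:] ^ (n - m) + 1)" by (simp only: to_fract_eq_iff)
  hence "poly ([:0,1:] ^ n * a) 0 = poly (b * ([:0,1:] ^ (n - m) + 1)) 0" by simp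
  thus False using ab(2) assms by (simp add: poly_power)
qed

section \<open>The group as affine transformations\<close>

text \<open>The affine map \<open>x \<mapsto> M x + v\<close> as a block matrix.\<close>

definition aff :: "K mat \<Rightarrow> K vec \<Rightarrow> K mat" where
  "aff M v = four_block_mat M (mat_of_cols 3 [v]) (0\<^sub>m 1 3) (1\<^sub>m 1)"

text \<open>A copy of \<open>Q\<close> with entries in the polynomial ring in \<open>s = t\<^sup>-\<^sup>1\<close>.\<close>

definition SL3_poly :: "bit poly mat set" where
  "SL3_poly = {B \<in> carrier_mat 3 3. det B = 1}"

text \<open>The linear part \<open>t\<^sup>k B\<close>, for \<open>B\<close> in the polynomial copy of \<open>Q\<close>.\<close>

definition lin :: "int \<Rightarrow> bit poly mat \<Rightarrow> K mat" where
  "lin k B = t_K powi k \<cdot>\<^sub>m map_mat eval_inv_t B"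

text \<open>The vectors in \<open>L\<^sup>3\<close>.\<close>

definition L3 :: "K vec set" where
  "L3 = {v \<in> carrier_vec 3. \<forall>i<3. v $ i \<in> lspan UNIV}"

interpretation eval_hom: comm_ring_hom eval_inv_t
  by (rule comm_ring_hom_eval_inv_t)

lemma aff_carrier: "M \<in> carrier_mat 3 3 \<Longrightarrow> aff M v \<in> carrier_mat 4 4"
  using four_block_carrier_mat[of M 3 3 "1\<^sub>m 1" 1 1 "mat_of_cols 3 [v]" "0\<^sub>m 1 3"] by (simp add: aff_def)

lemma aff_mult:
  assumes "M \<in> carrier_mat 3 3" "M' \<in> carrier_mat 3 3" "v \<in> carrier_vec 3" "v' \<in> carrier_vec 3"
  shows "aff M v * aff M' v' = aff (M * M') (M *\<^sub>v v' + v)"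
proof -
  have "aff M v * aff M' v' = four_block_mat (M * M' + mat_of_cols 3 [v] * 0\<^sub>m 1 3)
      (M * mat_of_cols 3 [v'] + mat_of_cols 3 [v] * 1\<^sub>m 1) (0\<^sub>m 1 3 * M' + 1\<^sub>m 1 * 0\<^sub>m 1 3)
      (0\<^sub>m 1 3 * mat_of_cols 3 [v'] + 1\<^sub>m 1 * 1\<^sub>m 1)"
    unfolding aff_def using assms
    by (intro mult_four_block_mat[where ?nr1.0 = 3 and ?n1.0 = 3 and ?n2.0 = 1 and ?nr2.0 = 1
          and ?nc1.0 = 3 and ?nc2.0 = 1]) auto
  also have "M * M' + mat_of_cols 3 [v] * 0\<^sub>m 1 3 = M * M'"
    using assms by (intro eq_matI) (auto simp: scalar_prod_def)
  also have "M * mat_of_cols 3 [v'] + mat_of_cols 3 [v] * 1\<^sub>m 1 = mat_of_cols 3 [M *\<^sub>v v' + v]"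
    using assms by (intro eq_matI) (auto simp: scalar_prod_def mat_of_cols_index)
  also have "0\<^sub>m 1 3 * M' + 1\<^sub>m 1 * 0\<^sub>m 1 3 = 0\<^sub>m 1 3"
    using assms by (intro eq_matI) (auto simp: scalar_prod_def)
  also have "0\<^sub>m 1 3 * mat_of_cols 3 [v'] + 1\<^sub>m 1 * 1\<^sub>m 1 = 1\<^sub>m 1"
    by (intro eq_matI) (auto simp: scalar_prod_def)
  finally show ?thesis by (simp add: aff_def)
qed

lemma aff_one: "aff (1\<^sub>m 3) (0\<^sub>v 3) = 1\<^sub>m 4"
  by (intro eq_matI) (auto simp: aff_def mat_of_cols_index)

lemma aff_inject:
  assumes "M \<in> carrier_mat 3 3" "M' \<in> carrier_mat 3 3" "v \<in> carrier_vec 3" "v' \<in> carrier_vec 3"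
  shows "aff M v = aff M' v' \<longleftrightarrow> M = M' \<and> v = v'"
proof
  assume eq: "aff M v = aff M' v'"
  have "M $$ (i,j) = M' $$ (i,j)" if "i < 3" "j < 3" for i j
  proof -
    have "aff M v $$ (i,j) = aff M' v' $$ (i,j)" using eq by simp
    thus ?thesis using assms that by (simp add: aff_def)
  qed
  moreover have "v $ i = v' $ i" if "i < 3" for i
  proof -
    have "aff M v $$ (i,3) = aff M' v' $$ (i,3)" using eq by simp
    thus ?thesis using assms that by (simp add: aff_def mat_of_cols_index)
  qed
  ultimately show "M = M' \<and> v = v'" using assms by (intro conjI eq_matI eq_vecI) auto
qed simp

lemma lin_carrier [simp]: "B \<in> carrier_mat 3 3 \<Longrightarrow> lin k B \<in> carrier_mat 3 3"
  by (simp add: lin_def)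

lemma SL3_poly_carrier: "B \<in> SL3_poly \<Longrightarrow> B \<in> carrier_mat 3 3"
  by (simp add: SL3_poly_def)

lemma smult_mat_smult: "a \<cdot>\<^sub>m (b \<cdot>\<^sub>m A) = (a * b) \<cdot>\<^sub>m (A :: 'a :: comm_ring_1 mat)"
  by (intro eq_matI) (auto simp: mult.assoc)

lemma one_smult_mat: "1 \<cdot>\<^sub>m A = (A :: 'a :: comm_ring_1 mat)"
  by (intro eq_matI) auto

lemma lin_mult:
  assumes "B \<in> carrier_mat 3 3" "C \<in> carrier_mat 3 3"
  shows "lin k B * lin l C = lin (k + l) (B * C)"
proof -
  have "lin k B * lin l C = (t_K powi k * t_K powi l) \<cdot>\<^sub>m (map_mat eval_inv_t B * map_mat eval_inv_t C)"
    unfolding lin_def using assms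
    by (simp add: mult_smult_distrib[of _ 3 3 _ 3] mult_smult_assoc_mat[of _ 3 3 _ 3] smult_mat_smult mult.commute)
  thus ?thesis using assms
    by (simp add: lin_def power_int_add eval_hom.mat_hom_mult[of _ 3 3 _ 3])
qed

lemma lin_one: "lin 0 (1\<^sub>m 3) = 1\<^sub>m 3"
  by (simp add: lin_def eval_hom.mat_hom_one one_smult_mat)

lemma det_lin: "B \<in> SL3_poly \<Longrightarrow> det (lin k B) = t_K powi (3 * k)"
  by (auto simp: lin_def SL3_poly_def power_int_mult mult.commute[of 3])

lemma SL3_R_eq: "SL3_R = map_mat eval_inv_t ` SL3_poly"
proof (intro equalityI subsetI)
  fix A assume "A \<in> SL3_R"
  hence A: "A \<in> carrier_mat 3 3" "elements_mat A \<subseteq> R_ring" "det A = 1" by (auto simp: SL3_R_def)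
  define B where "B = map_mat (inv_into UNIV eval_inv_t) A"
  have "eval_inv_t (inv_into UNIV eval_inv_t (A $$ (i,j))) = A $$ (i,j)" if "i < 3" "j < 3" for i j
    using A(1,2) that by (intro f_inv_into_f) (auto simp: range_eval_inv_t intro: elements_matI)
  hence "A = map_mat eval_inv_t B" using A(1) by (intro eq_matI) (auto simp: B_def)
  moreover from this have "eval_inv_t (det B) = eval_inv_t 1" using A(3) by simp
  hence "det B = 1" by (simp only: eval_inv_t_eq_iff)
  ultimately show "A \<in> map_mat eval_inv_t ` SL3_poly" using A(1) by (auto simp: SL3_poly_def B_def)
next
  fix A assume "A \<in> map_mat eval_inv_t ` SL3_poly"
  thus "A \<in> SL3_R" by (auto simp: SL3_R_def SL3_poly_def elements_mat_def range_eval_inv_t[symmetric])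
qed

lemma G_set_eq: "G_set = {aff (lin k B) v | k B v. B \<in> SL3_poly \<and> v \<in> L3}"
proof -
  have "v \<in> carrier_vec 3 \<and> set\<^sub>v v \<subseteq> L_ring \<longleftrightarrow> v \<in> L3" for v
    by (auto simp: L3_def L_ring_eq vec_set_def)
  thus ?thesis unfolding G_set_def SL3_R_eq aff_def lin_def by blast
qed

lemma L3_carrier: "v \<in> L3 \<Longrightarrow> v \<in> carrier_vec 3"
  by (simp add: L3_def)

lemma L3_zero [simp]: "0\<^sub>v 3 \<in> L3"
  by (simp add: L3_def)

lemma L3_add: "v \<in> L3 \<Longrightarrow> w \<in> L3 \<Longrightarrow> v + w \<in> L3"
  by (auto simp: L3_def lspan_add)

lemma L3_unit: "i < 3 \<Longrightarrow> unit_vec 3 i \<in> L3"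
  using lspan_powi[of 0 UNIV] by (auto simp: L3_def)

lemma vec_add_self: "v \<in> carrier_vec n \<Longrightarrow> v + v = 0\<^sub>v n" for v :: "K vec"
  by (intro eq_vecI) auto

lemma lin_vec_entry:
  assumes "B \<in> carrier_mat 3 3" "v \<in> carrier_vec 3" "i < 3"
  shows "(lin k B *\<^sub>v v) $ i = (\<Sum>j\<in>{0..<3}. t_K powi k * eval_inv_t (B $$ (i,j)) * v $ j)"
  using assms by (simp add: lin_def scalar_prod_def)

lemma L3_lin:
  assumes "B \<in> SL3_poly" "v \<in> L3"
  shows "lin k B *\<^sub>v v \<in> L3"
proof -
  have "eval_inv_t p \<in> lspan UNIV" for p
    using range_eval_inv_t lspan_mono[of "{..0}" UNIV] by (auto simp: R_ring_eq)
  hence "t_K powi k * eval_inv_t p * v $ j \<in> lspan UNIV" if "j < 3" for j p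
    using assms(2) that
    by (intro lspan_mult[of _ UNIV _ UNIV] lspan_powi) (auto simp: L3_def)
  hence "(lin k B *\<^sub>v v) $ i \<in> lspan UNIV" if "i < 3" for i
    using that assms L3_carrier[OF assms(2)] SL3_poly_carrier[OF assms(1)]
    by (subst lin_vec_entry) (auto intro!: lspan_sum)
  moreover have "lin k B *\<^sub>v v \<in> carrier_vec 3"
    using assms SL3_poly_carrier L3_carrier by (intro mult_mat_vec_carrier[of _ 3 3]) auto
  ultimately show ?thesis by (simp add: L3_def)
qed

lemma SL3_poly_mult: "B \<in> SL3_poly \<Longrightarrow> C \<in> SL3_poly \<Longrightarrow> B * C \<in> SL3_poly"
  by (auto simp: SL3_poly_def det_mult[of _ 3])

lemma SL3_poly_one [simp]: "1\<^sub>m 3 \<in> SL3_poly"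
  by (simp add: SL3_poly_def)

lemma SL3_poly_inverse:
  assumes "B \<in> SL3_poly"
  obtains C where "C \<in> SL3_poly" "B * C = 1\<^sub>m 3" "C * B = 1\<^sub>m 3"
proof -
  have B: "B \<in> carrier_mat 3 3" "det B = 1" using assms by (auto simp: SL3_poly_def)
  note adj = adj_mat[OF B(1), unfolded B(2)]
  have "det (B * adj_mat B) = 1" using adj by (simp add: one_smult_mat)
  hence "det (adj_mat B) = 1" using B adj(1) by (simp add: det_mult[of _ 3])
  thus ?thesis using adj by (intro that[of "adj_mat B"]) (auto simp: SL3_poly_def one_smult_mat)
qed

lemma aff_lin_mult:
  assumes "B \<in> SL3_poly" "C \<in> SL3_poly" "v \<in> L3" "w \<in> L3"
  shows "aff (lin k B) v * aff (lin l C) w = aff (lin (k + l) (B * C)) (lin k B *\<^sub>v w + v)"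
  using assms by (simp add: aff_mult lin_mult SL3_poly_carrier L3_carrier)

lemma G_set_inverse:
  assumes "B \<in> SL3_poly" "v \<in> L3"
  obtains C w where "C \<in> SL3_poly" "w \<in> L3"
    "aff (lin (- k) C) w * aff (lin k B) v = 1\<^sub>m 4" "aff (lin k B) v * aff (lin (- k) C) w = 1\<^sub>m 4"
proof -
  obtain C where C: "C \<in> SL3_poly" "B * C = 1\<^sub>m 3" "C * B = 1\<^sub>m 3"
    using SL3_poly_inverse[OF assms(1)] .
  let ?w = "lin (- k) C *\<^sub>v v"
  have w: "?w \<in> L3" using C assms by (intro L3_lin)
  have "lin k B *\<^sub>v ?w = (lin k B * lin (- k) C) *\<^sub>v v"
    using C assms SL3_poly_carrier L3_carrier by (intro assoc_mult_mat_vec[symmetric, of _ 3 3 _ 3]) auto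
  hence v: "lin k B *\<^sub>v ?w = v"
    using C assms by (simp add: lin_mult SL3_poly_carrier L3_carrier lin_one)
  show ?thesis
  proof (rule that[OF C(1) w])
    show "aff (lin (- k) C) ?w * aff (lin k B) v = 1\<^sub>m 4"
      using C assms w by (simp add: aff_lin_mult lin_one vec_add_self[OF L3_carrier] aff_one)
    show "aff (lin k B) v * aff (lin (- k) C) ?w = 1\<^sub>m 4"
      using C assms w v by (simp add: aff_lin_mult lin_one vec_add_self[OF L3_carrier] aff_one)
  qed
qed

lemma G_setI: "B \<in> SL3_poly \<Longrightarrow> v \<in> L3 \<Longrightarrow> aff (lin k B) v \<in> G_set"
  unfolding G_set_eq by blast

lemma G_setE:
  assumes "g \<in> G_set"
  obtains k B v where "B \<in> SL3_poly" "v \<in> L3" "g = aff (lin k B) v"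
  using assms unfolding G_set_eq by blast

lemma group_GL4: "group GL4"
proof -
  interpret ring "ring_mat TYPE(K) 4 ()" by (rule ring_mat)
  show ?thesis unfolding GL4_def by (rule units_group)
qed

lemma GL4_simps: "x \<otimes>\<^bsub>GL4\<^esub> y = x * y" "\<one>\<^bsub>GL4\<^esub> = 1\<^sub>m 4"
  by (simp_all add: GL4_def units_of_def ring_mat_def)

lemma subgroup_G_set: "subgroup G_set GL4"
proof -
  interpret group GL4 by (rule group_GL4)
  have sub: "G_set \<subseteq> carrier GL4"
  proof
    fix g assume "g \<in> G_set"
    then obtain k B v where g: "B \<in> SL3_poly" "v \<in> L3" "g = aff (lin k B) v" by (rule G_setE)
    obtain C w where "C \<in> SL3_poly" "w \<in> L3"
      "aff (lin (- k) C) w * aff (lin k B) v = 1\<^sub>m 4" "aff (lin k B) v * aff (lin (- k) C) w = 1\<^sub>m 4"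
      using G_set_inverse[OF g(1,2)] .
    thus "g \<in> carrier GL4" using g
      by (auto simp: GL4_def units_of_def Units_def ring_mat_def intro!: aff_carrier lin_carrier SL3_poly_carrier
          bexI[of _ "aff (lin (- k) C) w"])
  qed
  show ?thesis
  proof (rule subgroupI)
    show "G_set \<noteq> {}" using G_setI[of "1\<^sub>m 3" "0\<^sub>v 3"] by auto
  next
    fix g assume "g \<in> G_set"
    then obtain k B v where g: "B \<in> SL3_poly" "v \<in> L3" "g = aff (lin k B) v" by (rule G_setE)
    obtain C w where C: "C \<in> SL3_poly" "w \<in> L3" "aff (lin (- k) C) w * aff (lin k B) v = 1\<^sub>m 4"
      using G_set_inverse[OF g(1,2)] .
    have "inv\<^bsub>GL4\<^esub> g = aff (lin (- k) C) w"
      using C g sub G_setI by (intro inv_equality) (auto simp: GL4_simps)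
    thus "inv\<^bsub>GL4\<^esub> g \<in> G_set" using C G_setI by simp
  next
    fix g h assume "g \<in> G_set" "h \<in> G_set"
    then obtain k B v l C w where "B \<in> SL3_poly" "v \<in> L3" "g = aff (lin k B) v"
      "C \<in> SL3_poly" "w \<in> L3" "h = aff (lin l C) w" by (elim G_setE)
    thus "g \<otimes>\<^bsub>GL4\<^esub> h \<in> G_set"
      by (auto simp: GL4_simps aff_lin_mult intro!: G_setI SL3_poly_mult L3_add L3_lin)
  qed (rule sub)
qed

interpretation G: group group_G
  unfolding group_G_def by (rule subgroup.subgroup_is_group[OF subgroup_G_set group_GL4])

lemma group_G_simps [simp]:
  "carrier group_G = G_set" "x \<otimes>\<^bsub>group_G\<^esub> y = x * y" "\<one>\<^bsub>group_G\<^esub> = 1\<^sub>m 4"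
  by (simp_all add: group_G_def GL4_simps)

lemma G_inv_eqI: "g \<in> G_set \<Longrightarrow> h \<in> G_set \<Longrightarrow> h * g = 1\<^sub>m 4 \<Longrightarrow> inv\<^bsub>group_G\<^esub> g = h"
  using G.inv_equality[of h g] by simp

text \<open>The identity matrix is written as \<open>lin 0 1\<close> in translations, so that the multiplication rule
  for elements of the form \<open>aff (lin k B) v\<close> applies to them as well.\<close>

abbreviation translation :: "K vec \<Rightarrow> K mat" where
  "translation v \<equiv> aff (lin 0 (1\<^sub>m 3)) v"

abbreviation homog :: "int \<Rightarrow> bit poly mat \<Rightarrow> K mat" where
  "homog k B \<equiv> aff (lin k B) (0\<^sub>v 3)"

lemma lin_zero_vec [simp]: "B \<in> carrier_mat 3 3 \<Longrightarrow> lin k B *\<^sub>v 0\<^sub>v 3 = 0\<^sub>v 3"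
  by (intro eq_vecI) (auto simp: lin_def scalar_prod_def)

lemma lin_one_vec [simp]: "v \<in> carrier_vec 3 \<Longrightarrow> lin 0 (1\<^sub>m 3) *\<^sub>v v = v"
  by (simp add: lin_one)

lemma homog_mult:
  "B \<in> SL3_poly \<Longrightarrow> C \<in> SL3_poly \<Longrightarrow> homog k B * homog l C = homog (k + l) (B * C)"
  by (simp add: aff_lin_mult SL3_poly_carrier)

lemma translation_mult: "v \<in> L3 \<Longrightarrow> w \<in> L3 \<Longrightarrow> translation v * translation w = translation (v + w)"
  by (simp add: aff_lin_mult L3_carrier comm_add_vec[of _ 3])

section \<open>Finite generation\<close>

lemma bit_poly_uminus [simp]: "- p = (p :: bit poly)"
  by (intro poly_eqI) simp

lemma bit_poly_unit: "u dvd 1 \<Longrightarrow> u = (1 :: bit poly)"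
proof -
  assume "u dvd 1"
  hence "u \<noteq> 0" by auto
  hence "degree u = 0" "u \<noteq> 0" using \<open>u dvd 1\<close> is_unit_iff_degree[of u] by auto
  then obtain c where "u = [:c:]" "c \<noteq> 0" by (auto elim: degree_eq_zeroE)
  thus ?thesis using bit_cases[of c] by (simp add: one_pCons)
qed

lemma SL3_poly_elem_mats: "B \<in> SL3_poly \<Longrightarrow> B \<in> elem_mats 3"
  using bit_poly_unit SL3_poly_carrier
  by (intro left_invertible_imp_elem_mats) (auto simp: left_invertible_def intro: SL3_poly_inverse elim: SL3_poly_inverse)

lemma addrow_mat_SL3: "i < 3 \<Longrightarrow> i \<noteq> j \<Longrightarrow> addrow_mat 3 p i j \<in> SL3_poly"
  by (auto simp: SL3_poly_def det_addrow_mat)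

text \<open>Generators: the elementary matrices with entry \<open>1\<close> or \<open>s = t\<^sup>-\<^sup>1\<close>, the scalar \<open>t\<close>, and the translations
  by the standard basis vectors.\<close>

definition gens :: "K mat set" where
  "gens = {homog 0 (addrow_mat 3 p i j) | p i j. p \<in> {1, [:0, 1:]} \<and> i \<in> {..<3} \<and> j \<in> {..<3} \<and> i \<noteq> j}
     \<union> {homog 1 (1\<^sub>m 3)} \<union> (\<lambda>i. translation (unit_vec 3 i)) ` {..<3}"

lemma finite_gens: "finite gens"
proof -
  have "finite ((\<lambda>(p, i, j). homog 0 (addrow_mat 3 p i j)) ` ({1, [:0, 1:]} \<times> {..<3} \<times> {..<3}))"
    by simp
  hence "finite {homog 0 (addrow_mat 3 p i j) | p i j. p \<in> {1, [:0, 1:]} \<and> i \<in> {..<3} \<and> j \<in> {..<3} \<and> i \<noteq> j}"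
    by (rule rev_finite_subset) force
  thus ?thesis by (simp add: gens_def)
qed

lemma gens_subset: "gens \<subseteq> G_set"
  by (auto simp: gens_def intro!: G_setI addrow_mat_SL3 L3_unit)

lemma generate_addrow_mat:
  assumes "i < 3" "j < 3" "i \<noteq> j"
  shows "homog 0 (addrow_mat 3 p i j) \<in> generate group_G gens"
  using assms
proof (induction p arbitrary: i j)
  case 0
  have "addrow_mat 3 (0 :: bit poly) i j = 1\<^sub>m 3" by (intro eq_matI) auto
  thus ?case using generate.one[of group_G gens] by (simp add: lin_one aff_one)
next
  case (pCons a p)
  have mult: "x * y \<in> generate group_G gens" if "x \<in> generate group_G gens" "y \<in> generate group_G gens" for x y
    using generate.eng[OF that] by simp
  have gen: "homog 0 (addrow_mat 3 q i j) \<in> generate group_G gens"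
    if "q \<in> {1, [:0, 1:]}" "i < 3" "j < 3" "i \<noteq> j" for q i j
    using that by (intro generate.incl) (auto simp: gens_def)
  obtain k :: nat where k: "k < 3" "k \<noteq> i" "k \<noteq> j"
  proof -
    have "card {i, j} < card {..<3::nat}" using pCons.prems by simp
    hence "\<not> {..<3} \<subseteq> {i, j}" using card_mono[of "{i,j}" "{..<3}"] by auto
    thus ?thesis using that by auto
  qed
  have s: "homog 0 (addrow_mat 3 ([:0, 1:] * p) i j) \<in> generate group_G gens"
  proof -
    let ?A = "addrow_mat 3 [:0, 1:] i k" and ?B = "addrow_mat 3 p k j"
    have AB: "?A \<in> SL3_poly" "?B \<in> SL3_poly" using k pCons.prems by (auto intro: addrow_mat_SL3)
    have "homog 0 ?A * (homog 0 ?B * (homog 0 ?A * homog 0 ?B)) \<in> generate group_G gens"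
      using k pCons by (intro mult gen pCons.IH) auto
    also have "homog 0 ?A * (homog 0 ?B * (homog 0 ?A * homog 0 ?B)) = homog 0 (?A * (?B * (?A * ?B)))"
      using AB by (simp add: homog_mult SL3_poly_mult)
    also have "?A * (?B * (?A * ?B)) = addrow_mat 3 ([:0, 1:] * p) i j"
      using addrow_mat_commutator[of i 3 j k "[:0, 1:]" p] k pCons.prems by simp
    finally show ?thesis .
  qed
  show ?case
  proof (cases "a = 0")
    case True
    thus ?thesis using s by simp
  next
    case False
    hence p: "pCons a p = 1 + [:0, 1:] * p" using bit_cases[of a] by (simp add: one_pCons)
    have "homog 0 (addrow_mat 3 1 i j) * homog 0 (addrow_mat 3 ([:0, 1:] * p) i j) \<in> generate group_G gens"
      using s gen[of 1 i j] pCons.prems by (intro mult) auto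
    also have "homog 0 (addrow_mat 3 1 i j) * homog 0 (addrow_mat 3 ([:0, 1:] * p) i j) =
        homog (0 + 0) (addrow_mat 3 1 i j * addrow_mat 3 ([:0, 1:] * p) i j)"
      using pCons.prems by (intro homog_mult addrow_mat_SL3)
    also have "\<dots> = homog 0 (addrow_mat 3 (pCons a p) i j)"
      unfolding p by (subst addrow_mat_add) (use pCons.prems in simp_all)
    finally show ?thesis .
  qed
qed

lemma finitely_generated_G: "finitely_generated group_G"
proof -
  let ?\<Gamma> = "generate group_G gens"
  have mult: "x * y \<in> ?\<Gamma>" if "x \<in> ?\<Gamma>" "y \<in> ?\<Gamma>" for x y
    using generate.eng[OF that] by simp
  have one: "1\<^sub>m 4 \<in> ?\<Gamma>" using generate.one[of group_G gens] by simp
  have elem: "B \<in> SL3_poly \<and> homog 0 B \<in> ?\<Gamma>" if "B \<in> elem_mats 3" for B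
    using that
  proof induction
    case one
    thus ?case using \<open>1\<^sub>m 4 \<in> ?\<Gamma>\<close> by (simp add: lin_one aff_one)
  next
    case (step A i j a)
    have E: "addrow_mat 3 a i j \<in> SL3_poly" using step by (intro addrow_mat_SL3)
    have "homog 0 (addrow_mat 3 a i j) * homog 0 A \<in> ?\<Gamma>"
      using step by (intro mult generate_addrow_mat) auto
    thus ?case using E step by (simp add: homog_mult SL3_poly_mult)
  qed
  have t: "homog (int n) (1\<^sub>m 3) \<in> ?\<Gamma>" for n
  proof (induction n)
    case 0
    show ?case using one by (simp add: lin_one aff_one)
  next
    case (Suc n)
    have "homog 1 (1\<^sub>m 3) \<in> ?\<Gamma>" by (rule generate.incl) (simp add: gens_def)
    from mult[OF this Suc] show ?case by (simp add: homog_mult)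
  qed
  have t': "homog k (1\<^sub>m 3) \<in> ?\<Gamma>" for k
  proof (cases "k \<ge> 0")
    case True
    thus ?thesis using t[of "nat k"] by simp
  next
    case False
    have "inv\<^bsub>group_G\<^esub> (homog (- k) (1\<^sub>m 3)) \<in> ?\<Gamma>"
      using t[of "nat (- k)"] False gens_subset by (intro G.generate_m_inv_closed) auto
    also have "inv\<^bsub>group_G\<^esub> (homog (- k) (1\<^sub>m 3)) = homog k (1\<^sub>m 3)"
      by (intro G_inv_eqI) (auto simp: homog_mult lin_one aff_one intro!: G_setI)
    finally show ?thesis .
  qed
  have trans_t: "translation (t_K powi k \<cdot>\<^sub>v unit_vec 3 i) \<in> ?\<Gamma>" if i: "i < 3" for k i
  proof -
    have "translation (unit_vec 3 i) \<in> ?\<Gamma>" using i by (intro generate.incl) (auto simp: gens_def)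
    hence "homog k (1\<^sub>m 3) * (translation (unit_vec 3 i) * homog (- k) (1\<^sub>m 3)) \<in> ?\<Gamma>" by (intro mult t')
    also have "homog k (1\<^sub>m 3) * (translation (unit_vec 3 i) * homog (- k) (1\<^sub>m 3))
        = translation (lin k (1\<^sub>m 3) *\<^sub>v unit_vec 3 i)"
      using i L3_unit[OF i] by (simp add: aff_lin_mult L3_carrier L3_lin)
    also have "lin k (1\<^sub>m 3) *\<^sub>v unit_vec 3 i = t_K powi k \<cdot>\<^sub>v unit_vec 3 i"
      using i by (intro eq_vecI) (auto simp: lin_def)
    finally show ?thesis .
  qed
  have trans_x: "x \<cdot>\<^sub>v unit_vec 3 i \<in> L3 \<and> translation (x \<cdot>\<^sub>v unit_vec 3 i) \<in> ?\<Gamma>"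
    if x: "x \<in> lspan UNIV" and i: "i < 3" for x i
  proof -
    obtain A where A: "finite A" "x = (\<Sum>k\<in>A. t_K powi k)" using x by (auto simp: lspan_def)
    have "translation ((\<Sum>k\<in>A. t_K powi k) \<cdot>\<^sub>v unit_vec 3 i) \<in> ?\<Gamma>" using A(1)
    proof (induction A rule: finite_induct)
      case empty
      have "(0 :: K) \<cdot>\<^sub>v unit_vec 3 i = 0\<^sub>v 3" by (intro eq_vecI) auto
      thus ?case using one by (simp add: lin_one aff_one)
    next
      case (insert k A)
      have L: "y \<cdot>\<^sub>v unit_vec 3 i \<in> L3" if "y \<in> lspan UNIV" for y
        using that i by (auto simp: L3_def)
      have "translation (t_K powi k \<cdot>\<^sub>v unit_vec 3 i) * translation ((\<Sum>k\<in>A. t_K powi k) \<cdot>\<^sub>v unit_vec 3 i) \<in> ?\<Gamma>"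
        using insert trans_t i by (intro mult) auto
      thus ?case using insert
        by (simp add: translation_mult L lspan_powi lspanI add_smult_distrib_vec)
    qed
    thus ?thesis using A x i by (auto simp: L3_def)
  qed
  have trans: "translation v \<in> ?\<Gamma>" if v: "v \<in> L3" for v
  proof -
    let ?e = "\<lambda>i. v $ i \<cdot>\<^sub>v unit_vec 3 i"
    have e: "?e i \<in> L3" "translation (?e i) \<in> ?\<Gamma>" if "i < 3" for i
      using trans_x[of "v $ i" i] v that by (auto simp: L3_def)
    have "translation (?e 0) * (translation (?e 1) * translation (?e 2)) \<in> ?\<Gamma>" using e by (intro mult) auto
    also have "translation (?e 0) * (translation (?e 1) * translation (?e 2)) = translation (?e 0 + (?e 1 + ?e 2))"
      using e by (simp add: translation_mult L3_add)
    also have "?e 0 + (?e 1 + ?e 2) = v"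
    proof (rule eq_vecI)
      fix i assume "i < dim_vec v"
      hence "i = 0 \<or> i = 1 \<or> i = 2" using L3_carrier[OF v] by auto
      thus "(?e 0 + (?e 1 + ?e 2)) $ i = v $ i" by auto
    qed (use L3_carrier[OF v] in auto)
    finally show ?thesis .
  qed
  have "G_set \<subseteq> ?\<Gamma>"
  proof
    fix g assume "g \<in> G_set"
    then obtain k B v where g: "B \<in> SL3_poly" "v \<in> L3" "g = aff (lin k B) v" by (rule G_setE)
    have "translation v * (homog k (1\<^sub>m 3) * homog 0 B) \<in> ?\<Gamma>"
      using trans[OF g(2)] t'[of k] elem[OF SL3_poly_elem_mats[OF g(1)]] by (intro mult) auto
    also have "translation v * (homog k (1\<^sub>m 3) * homog 0 B) = g"
      using g by (simp add: homog_mult aff_lin_mult left_mult_one_mat[of _ 3 3] SL3_poly_carrier L3_carrier)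
    finally show "g \<in> ?\<Gamma>" .
  qed
  moreover have "?\<Gamma> \<subseteq> G_set" using G.generate_incl[of gens] gens_subset by simp
  ultimately show ?thesis
    unfolding finitely_generated_def using finite_gens gens_subset by (intro exI[of _ gens]) auto
qed

section \<open>Conjugacy classes\<close>

lemma translation_self: "v \<in> L3 \<Longrightarrow> translation v * translation v = 1\<^sub>m 4"
  by (simp only: translation_mult vec_add_self[OF L3_carrier]) (simp only: lin_one aff_one)

lemma conj_translation:
  assumes "B \<in> SL3_poly" "v \<in> L3" "w \<in> L3"
  shows "translation w * aff (lin k B) v * translation w = aff (lin k B) (lin k B *\<^sub>v w + (v + w))"
  using assms by (simp add: aff_lin_mult L3_add L3_lin SL3_poly_carrier L3_carrier
      left_mult_one_mat[of _ 3 3] right_mult_one_mat[of _ 3 3])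

lemma translation_conj_class:
  assumes "g \<in> G_set" "w \<in> L3"
  shows "translation w * g * translation w \<in> conjugacy_class group_G g"
proof -
  have w: "translation w \<in> G_set" using assms(2) by (intro G_setI) auto
  hence "inv\<^bsub>group_G\<^esub> translation w = translation w"
    using translation_self[OF assms(2)] by (intro G_inv_eqI)
  thus ?thesis using w unfolding conjugacy_class_def by force
qed

lemma infinite_int_family:
  assumes "\<And>n :: int. f n \<in> A" "inj f"
  shows "infinite A"
proof
  assume "finite A"
  hence "finite (range f)" using assms(1) by (intro finite_subset[of "range f" A]) auto
  thus False using assms(2) infinite_UNIV_int finite_imageD by blast
qed

text \<open>If the linear part of \<open>g\<close> is trivial, conjugation by the scalars \<open>t\<^sup>n\<close> multiplies its translation part
  by \<open>t\<^sup>n\<close>; otherwise conjugation by the translations \<open>t\<^sup>n e\<^sub>j\<close> already yields infinitely many elements.\<close>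

lemma ICC_G: "ICC group_G"
  unfolding ICC_def
proof (intro ballI impI)
  fix g assume "g \<in> carrier group_G" and g1: "g \<noteq> \<one>\<^bsub>group_G\<^esub>"
  hence gG: "g \<in> G_set" by simp
  then obtain k B v where g: "B \<in> SL3_poly" "v \<in> L3" "g = aff (lin k B) v" by (rule G_setE)
  note B = SL3_poly_carrier[OF g(1)] and v = L3_carrier[OF g(2)]
  let ?M = "lin k B"
  have M: "?M \<in> carrier_mat 3 3" using B by simp
  show "infinite (conjugacy_class group_G g)"
  proof (cases "?M = 1\<^sub>m 3")
    case True
    have "v \<noteq> 0\<^sub>v 3" using g1 g(3) True aff_one by auto
    then obtain i where i: "i < 3" "v $ i \<noteq> 0" using v by (metis carrier_vecD eq_vecI index_zero_vec)
    let ?f = "\<lambda>n. homog n (1\<^sub>m 3) * g * inv\<^bsub>group_G\<^esub> (homog n (1\<^sub>m 3))"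
    have f: "?f n = aff ?M (lin n (1\<^sub>m 3) *\<^sub>v v)" for n
    proof -
      have "inv\<^bsub>group_G\<^esub> (homog n (1\<^sub>m 3)) = homog (- n) (1\<^sub>m 3)"
        by (intro G_inv_eqI G_setI) (auto simp: homog_mult lin_one aff_one)
      thus ?thesis using g by (simp add: aff_lin_mult L3_lin SL3_poly_carrier L3_carrier
          left_mult_one_mat[of _ 3 3] right_mult_one_mat[of _ 3 3] SL3_poly_mult)
    qed
    show ?thesis
    proof (rule infinite_int_family)
      show "?f n \<in> conjugacy_class group_G g" for n
        using G_setI[of "1\<^sub>m 3" "0\<^sub>v 3" n] unfolding conjugacy_class_def by force
      show "inj ?f"
      proof (rule injI)
        fix n m assume "?f n = ?f m"
        hence "lin n (1\<^sub>m 3) *\<^sub>v v = lin m (1\<^sub>m 3) *\<^sub>v v"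
          unfolding f using M v by (subst (asm) aff_inject) (auto intro!: mult_mat_vec_carrier[of _ 3 3])
        hence "(lin n (1\<^sub>m 3) *\<^sub>v v) $ i = (lin m (1\<^sub>m 3) *\<^sub>v v) $ i" by simp
        moreover have "(lin l (1\<^sub>m 3) *\<^sub>v v) $ i = t_K powi l * v $ i" for l
          using v i(1) by (simp add: lin_def eval_hom.mat_hom_one)
        ultimately show "n = m" using i(2) by (simp add: t_K_powi_inj)
      qed
    qed
  next
    case False
    have "\<exists>i<3. \<exists>j<3. ?M $$ (i,j) \<noteq> 1\<^sub>m 3 $$ (i,j)"
    proof (rule ccontr)
      assume "\<not> ?thesis"
      hence "?M = 1\<^sub>m 3" using M by (intro eq_matI) auto
      thus False using \<open>?M \<noteq> 1\<^sub>m 3\<close> by blast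
    qed
    then obtain i j where ij: "i < 3" "j < 3" "?M $$ (i,j) \<noteq> 1\<^sub>m 3 $$ (i,j)" by blast
    let ?w = "\<lambda>n. t_K powi n \<cdot>\<^sub>v unit_vec 3 j"
    have w: "?w n \<in> L3" for n using ij(2) by (auto simp: L3_def intro!: lspan_powi)
    let ?f = "\<lambda>n. translation (?w n) * g * translation (?w n)"
    have f: "?f n = aff ?M (?M *\<^sub>v ?w n + (v + ?w n))" for n
      using g w by (simp only: conj_translation)
    show ?thesis
    proof (rule infinite_int_family)
      show "?f n \<in> conjugacy_class group_G g" for n
        using translation_conj_class[OF gG w] .
      show "inj ?f"
      proof (rule injI)
        fix n m assume "?f n = ?f m"
        hence eq: "?M *\<^sub>v ?w n + (v + ?w n) = ?M *\<^sub>v ?w m + (v + ?w m)"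
          unfolding f using M v by (subst (asm) aff_inject) (auto intro!: mult_mat_vec_carrier[of _ 3 3])
        have "(?M *\<^sub>v ?w l + (v + ?w l)) $ i = t_K powi l * (?M $$ (i,j) - 1\<^sub>m 3 $$ (i,j)) + v $ i" for l
        proof -
          have "(?M *\<^sub>v ?w l) $ i = t_K powi l * ?M $$ (i,j)"
            using M v ij(1,2) by (simp add: mult_mat_vec[of _ 3 3] col_def[symmetric])
          moreover have "?w l $ i = t_K powi l * 1\<^sub>m 3 $$ (i,j)" using ij(1,2) by auto
          ultimately show ?thesis using M v ij(1,2) by (simp add: distrib_left add_ac)
        qed
        hence "t_K powi n * (?M $$ (i,j) - 1\<^sub>m 3 $$ (i,j)) = t_K powi m * (?M $$ (i,j) - 1\<^sub>m 3 $$ (i,j))"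
          using arg_cong[OF eq, of "\<lambda>u. u $ i"] by (metis add_right_cancel)
        moreover have "?M $$ (i,j) - 1\<^sub>m 3 $$ (i,j) \<noteq> 0" using ij(3) by (metis right_minus_eq)
        ultimately show "n = m" by (metis mult_right_cancel t_K_powi_inj)
      qed
    qed
  qed
qed

section \<open>Characters and property (T)\<close>

text \<open>The one-dimensional Hilbert space, realized by the constant functions, with the inner product
  read off at an arbitrary point. The ring multiplication and unit are part of the record type but
  play no role.\<close>

definition line :: "('a \<Rightarrow> complex) inner_module" where
  "line = \<lparr>carrier = range (\<lambda>c _. c), monoid.mult = (\<lambda>f g x. f x * g x), one = (\<lambda>_. 1),
     zero = (\<lambda>_. 0), add = (\<lambda>f g x. f x + g x), module.smult = (\<lambda>c f x. c * f x),
     cinner = (\<lambda>f g. f undefined * cnj (g undefined))\<rparr>"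

lemma line_simps:
  "carrier line = range (\<lambda>c _. c)" "f \<oplus>\<^bsub>line\<^esub> g = (\<lambda>x. f x + g x)" "\<zero>\<^bsub>line\<^esub> = (\<lambda>_. 0)"
  "c \<odot>\<^bsub>line\<^esub> f = (\<lambda>x. c * f x)" "cinner line f g = f undefined * cnj (g undefined)"
  by (simp_all add: line_def)

lemma complex_ring_simps:
  "carrier complex_ring = UNIV" "a \<oplus>\<^bsub>complex_ring\<^esub> b = a + b" "a \<otimes>\<^bsub>complex_ring\<^esub> b = a * b"
  "\<one>\<^bsub>complex_ring\<^esub> = 1" "\<zero>\<^bsub>complex_ring\<^esub> = 0"
  by (simp_all add: complex_ring_def)

lemma cring_complex_ring: "cring complex_ring"
proof (rule cringI)
  show "abelian_group complex_ring"
    by (rule abelian_groupI) (auto simp: complex_ring_simps algebra_simps intro: exI[of _ "- _"] add.left_inverse)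
  show "Group.comm_monoid complex_ring"
    by (rule comm_monoidI) (auto simp: complex_ring_simps)
qed (auto simp: complex_ring_simps algebra_simps)

lemma module_line: "module complex_ring (line :: ('a \<Rightarrow> complex) inner_module)"
proof (rule moduleI)
  show "abelian_group (line :: ('a \<Rightarrow> complex) inner_module)"
  proof (rule abelian_groupI)
    fix f :: "'a \<Rightarrow> complex" assume "f \<in> carrier line"
    then obtain c where "f = (\<lambda>_. c)" by (auto simp: line_simps)
    thus "\<exists>g\<in>carrier line. g \<oplus>\<^bsub>line\<^esub> f = \<zero>\<^bsub>line\<^esub>"
      by (intro bexI[of _ "\<lambda>_. - c"]) (auto simp: line_simps)
  qed (auto simp: line_simps algebra_simps)
qed (auto simp: line_simps complex_ring_simps cring_complex_ring algebra_simps)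

lemma line_minus:
  fixes f g :: "'a \<Rightarrow> complex"
  assumes "f \<in> carrier line" "g \<in> carrier line"
  shows "f \<ominus>\<^bsub>line\<^esub> g = (\<lambda>x. f x - g x)"
proof -
  interpret module complex_ring "line :: ('a \<Rightarrow> complex) inner_module" by (rule module_line)
  have "\<ominus>\<^bsub>line\<^esub> g = (\<lambda>x. - g x)"
    using assms by (intro M.minus_equality) (auto simp: line_simps)
  thus ?thesis by (simp add: a_minus_def line_simps)
qed

lemma cnorm_line: "f \<in> carrier line \<Longrightarrow> cnorm line f = cmod (f undefined)"
  by (simp add: cnorm_def line_simps complex_norm_square[symmetric] del: of_real_power)

lemma line_dist:
  fixes f g :: "'a \<Rightarrow> complex"
  assumes "f \<in> carrier line" "g \<in> carrier line"
  shows "cnorm line (f \<ominus>\<^bsub>line\<^esub> g) = cmod (f undefined - g undefined)"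
proof -
  have "(\<lambda>x. f x - g x) \<in> carrier line" using assms by (auto simp: line_simps)
  thus ?thesis by (simp only: line_minus[OF assms] cnorm_line)
qed

lemma complex_hilbert_space_line: "complex_hilbert_space (line :: ('a \<Rightarrow> complex) inner_module)"
proof (intro complex_hilbert_space.intro complex_hilbert_space_axioms.intro)
  show "module complex_ring (line :: ('a \<Rightarrow> complex) inner_module)" by (rule module_line)
next
  fix f :: "'a \<Rightarrow> complex" assume f: "f \<in> carrier line" "f \<noteq> \<zero>\<^bsub>line\<^esub>"
  then obtain c where c: "f = (\<lambda>_. c)" "c \<noteq> 0" by (auto simp: line_simps)
  have "cmod c > 0" using c by simp
  thus "Re (cinner line f f) > 0"
    using c by (simp add: line_simps complex_norm_square[symmetric] del: of_real_power)
next
  fix X :: "nat \<Rightarrow> 'a \<Rightarrow> complex"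
  assume X: "\<And>n. X n \<in> carrier line"
    and C: "\<And>e. e > 0 \<Longrightarrow> \<exists>N. \<forall>m\<ge>N. \<forall>n\<ge>N. cnorm line (X m \<ominus>\<^bsub>line\<^esub> X n) < e"
  have "Cauchy (\<lambda>n. X n undefined)"
    unfolding Cauchy_def dist_norm using C by (simp only: line_dist[OF X X]) blast
  then obtain l where l: "(\<lambda>n. X n undefined) \<longlonglongrightarrow> l" using Cauchy_convergent convergent_def by blast
  have lc: "(\<lambda>_. l) \<in> carrier line" by (auto simp: line_simps)
  have "(\<lambda>n. cnorm line (X n \<ominus>\<^bsub>line\<^esub> (\<lambda>_. l))) = (\<lambda>n. cmod (X n undefined - l))"
    by (simp only: line_dist[OF X lc])
  moreover have "(\<lambda>n. cmod (X n undefined - l)) \<longlonglongrightarrow> 0"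
    using l by (simp add: tendsto_norm_zero_iff LIM_zero_iff)
  ultimately show "\<exists>f\<in>carrier line. (\<lambda>n. cnorm line (X n \<ominus>\<^bsub>line\<^esub> f)) \<longlonglongrightarrow> 0"
    using lc by metis
qed (auto simp: line_simps algebra_simps)

text \<open>The one-dimensional representation defined by a character. It has nonzero invariant vectors only
  if the character is trivial.\<close>

definition char_rep :: "('b \<Rightarrow> complex) \<Rightarrow> 'b \<Rightarrow> ('a \<Rightarrow> complex) \<Rightarrow> 'a \<Rightarrow> complex" where
  "char_rep \<theta> g = (\<lambda>f\<in>carrier line. \<lambda>x. \<theta> g * f x)"

lemma unitary_representation_char_rep:
  fixes G :: "('b, 'm) monoid_scheme"
  assumes G: "group G"
    and unit: "\<And>g. g \<in> carrier G \<Longrightarrow> cmod (\<theta> g) = 1"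
    and mult: "\<And>g h. \<lbrakk>g \<in> carrier G; h \<in> carrier G\<rbrakk> \<Longrightarrow> \<theta> (g \<otimes>\<^bsub>G\<^esub> h) = \<theta> g * \<theta> h"
  shows "unitary_representation G (line :: ('a \<Rightarrow> complex) inner_module) (char_rep \<theta>)"
proof (intro unitary_representation.intro unitary_representation_axioms.intro)
  show "complex_hilbert_space (line :: ('a \<Rightarrow> complex) inner_module)"
    by (rule complex_hilbert_space_line)
  have nz: "\<theta> g \<noteq> 0" if "g \<in> carrier G" for g using unit[OF that] by auto
  have Bij: "char_rep \<theta> g \<in> Bij (carrier (line :: ('a \<Rightarrow> complex) inner_module))" if g: "g \<in> carrier G" for g
  proof -
    have "bij_betw (char_rep \<theta> g) (carrier line) (carrier (line :: ('a \<Rightarrow> complex) inner_module))"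
      by (rule bij_betwI[where g = "\<lambda>f x. f x / \<theta> g"])
         (use nz[OF g] in \<open>auto simp: char_rep_def line_simps\<close>)
    thus ?thesis by (simp add: Bij_def char_rep_def)
  qed
  show "group_action G (carrier (line :: ('a \<Rightarrow> complex) inner_module)) (char_rep \<theta>)"
  proof (intro group_action.intro group_hom.intro group_hom_axioms.intro homI)
    fix g h assume gh: "g \<in> carrier G" "h \<in> carrier G"
    show "char_rep \<theta> (g \<otimes>\<^bsub>G\<^esub> h) =
      char_rep \<theta> g \<otimes>\<^bsub>BijGroup (carrier (line :: ('a \<Rightarrow> complex) inner_module))\<^esub> char_rep \<theta> h"
      using Bij gh by (auto simp: BijGroup_def compose_def char_rep_def mult line_simps intro!: restrict_ext)
  next
    show "char_rep \<theta> g \<in> carrier (BijGroup (carrier (line :: ('a \<Rightarrow> complex) inner_module)))"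
      if "g \<in> carrier G" for g
      using Bij[OF that] by (simp add: BijGroup_def)
  qed (rule G group_BijGroup)+
next
  fix g and f h :: "'a \<Rightarrow> complex"
  assume g: "g \<in> carrier G" and f: "f \<in> carrier line" and h: "h \<in> carrier line"
  have "\<theta> g * cnj (\<theta> g) = 1" using unit[OF g] by (simp add: complex_norm_square[symmetric])
  thus "cinner line (char_rep \<theta> g f) (char_rep \<theta> g h) = cinner line f h"
    using f h by (simp add: char_rep_def line_simps)
qed (auto simp: char_rep_def line_simps algebra_simps)

text \<open>A group with nontrivial unitary characters arbitrarily close to the trivial one on every finite
  set does not have property (T).\<close>

lemma not_kazhdan_property_T_characters:
  fixes G :: "('a, 'b) monoid_scheme"
  assumes G: "group G"
    and chars: "\<And>S \<epsilon>. \<lbrakk>finite S; S \<subseteq> carrier G; \<epsilon> > 0\<rbrakk> \<Longrightarrow>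
      \<exists>\<theta>. (\<forall>g\<in>carrier G. cmod (\<theta> g) = 1) \<and>
        (\<forall>g\<in>carrier G. \<forall>h\<in>carrier G. \<theta> (g \<otimes>\<^bsub>G\<^esub> h) = \<theta> g * \<theta> h) \<and>
        (\<forall>s\<in>S. cmod (\<theta> s - 1) < \<epsilon>) \<and> (\<exists>g\<in>carrier G. \<theta> g \<noteq> 1)"
  shows "\<not> kazhdan_property_T G"
proof
  assume "kazhdan_property_T G"
  then obtain S \<epsilon> where S: "finite S" "S \<subseteq> carrier G" "\<epsilon> > 0"
    and T: "\<And>(H :: ('a \<Rightarrow> complex) inner_module) \<pi>. \<lbrakk>unitary_representation G H \<pi>;
      has_almost_invariant_vector H \<pi> S \<epsilon>\<rbrakk> \<Longrightarrow> has_nonzero_invariant_vector G H \<pi>"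
    unfolding kazhdan_property_T_def by blast
  from chars[OF S] obtain \<theta> where \<theta>: "\<forall>g\<in>carrier G. cmod (\<theta> g) = 1"
    "\<forall>g\<in>carrier G. \<forall>h\<in>carrier G. \<theta> (g \<otimes>\<^bsub>G\<^esub> h) = \<theta> g * \<theta> h"
    "\<forall>s\<in>S. cmod (\<theta> s - 1) < \<epsilon>" "\<exists>g\<in>carrier G. \<theta> g \<noteq> 1" by (elim exE conjE)
  let ?H = "line :: ('a \<Rightarrow> complex) inner_module" and ?\<pi> = "char_rep \<theta>"
  have "unitary_representation G ?H ?\<pi>"
    using G \<theta> by (intro unitary_representation_char_rep) auto
  moreover have "has_almost_invariant_vector ?H ?\<pi> S \<epsilon>"
    unfolding has_almost_invariant_vector_def
  proof (intro bexI conjI ballI)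
    let ?u = "(\<lambda>_. 1) :: 'a \<Rightarrow> complex"
    show one: "?u \<in> carrier ?H" by (auto simp: line_simps)
    show "?u \<noteq> \<zero>\<^bsub>?H\<^esub>" by (auto simp: line_simps fun_eq_iff)
    fix s assume "s \<in> S"
    have "?\<pi> s ?u = (\<lambda>_. \<theta> s)" using one by (simp add: char_rep_def)
    moreover have "(\<lambda>_. \<theta> s) \<in> carrier ?H" by (auto simp: line_simps)
    ultimately show "cnorm ?H (?\<pi> s ?u \<ominus>\<^bsub>?H\<^esub> ?u) < \<epsilon> * cnorm ?H ?u"
      using \<theta>(3) \<open>s \<in> S\<close> one by (simp add: line_dist cnorm_line)
  qed
  ultimately have "has_nonzero_invariant_vector G ?H ?\<pi>" by (rule T)
  then obtain f where f: "f \<in> carrier ?H" "f \<noteq> \<zero>\<^bsub>?H\<^esub>" "\<forall>g\<in>carrier G. ?\<pi> g f = f"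
    unfolding has_nonzero_invariant_vector_def by blast
  then obtain c where c: "f = (\<lambda>_. c)" "c \<noteq> 0" by (auto simp: line_simps)
  obtain g where g: "g \<in> carrier G" "\<theta> g \<noteq> 1" using \<theta>(4) by blast
  have "(\<lambda>x. \<theta> g * f x) = f" using f g(1) by (simp add: char_rep_def)
  hence "\<theta> g * c = c" using c by (simp add: fun_eq_iff)
  thus False using c g(2) by simp
qed

text \<open>The exponent \<open>k\<close> of an element of the group. It is determined by the determinant \<open>t\<^sup>3\<^sup>k\<close>.\<close>

definition exponent :: "K mat \<Rightarrow> int" where
  "exponent g = (THE k. \<exists>B\<in>SL3_poly. \<exists>v\<in>L3. g = aff (lin k B) v)"

lemma exponent_unique:
  assumes "aff (lin k B) v = aff (lin l C) w" "B \<in> SL3_poly" "C \<in> SL3_poly" "v \<in> L3" "w \<in> L3"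
  shows "k = l"
proof -
  have "lin k B = lin l C" using assms by (simp add: aff_inject SL3_poly_carrier L3_carrier)
  hence "t_K powi (3 * k) = t_K powi (3 * l)" using det_lin assms by metis
  thus ?thesis by (simp add: t_K_powi_inj)
qed

lemma exponent_aff: "B \<in> SL3_poly \<Longrightarrow> v \<in> L3 \<Longrightarrow> exponent (aff (lin k B) v) = k"
  unfolding exponent_def
proof (rule the_equality)
  fix l assume B: "B \<in> SL3_poly" "v \<in> L3"
    and "\<exists>C\<in>SL3_poly. \<exists>w\<in>L3. aff (lin k B) v = aff (lin l C) w"
  then obtain C w where "C \<in> SL3_poly" "w \<in> L3" "aff (lin k B) v = aff (lin l C) w" by blast
  thus "l = k" using exponent_unique[of k B v l C w] B by simp
qed blast

lemma exponent_mult: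
  assumes "g \<in> G_set" "h \<in> G_set"
  shows "exponent (g * h) = exponent g + exponent h"
proof -
  obtain k B v l C w where "B \<in> SL3_poly" "v \<in> L3" "g = aff (lin k B) v"
    "C \<in> SL3_poly" "w \<in> L3" "h = aff (lin l C) w" using assms by (elim G_setE)
  thus ?thesis by (simp add: aff_lin_mult exponent_aff SL3_poly_mult L3_add L3_lin)
qed

lemma not_kazhdan_G: "\<not> kazhdan_property_T group_G"
proof (rule not_kazhdan_property_T_characters)
  fix S and \<epsilon> :: real assume S: "finite S" "S \<subseteq> carrier group_G" "\<epsilon> > 0"
  \<comment> \<open>Characters \<open>g \<mapsto> exp (\<i> k / (n + 1))\<close> through the quotient \<open>\<int>\<close>.\<close>
  define \<theta> where "\<theta> n g = cis (inverse (real (Suc n)) * real_of_int (exponent g))" for n :: nat and g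
  have "(\<lambda>n. cis (inverse (real (Suc n)) * a)) \<longlonglongrightarrow> 1" for a
  proof -
    have "(\<lambda>n. inverse (real (Suc n)) * a) \<longlonglongrightarrow> 0"
      using LIMSEQ_inverse_real_of_nat by (rule tendsto_mult_left_zero)
    from tendsto_Complex[OF tendsto_cos[OF this] tendsto_sin[OF this]]
    show ?thesis by (simp add: cis.code one_complex.code)
  qed
  hence lim: "(\<lambda>n. \<theta> n s) \<longlonglongrightarrow> 1" for s unfolding \<theta>_def .
  have "eventually (\<lambda>n. \<forall>s\<in>S. dist (\<theta> n s) 1 < \<epsilon>) sequentially"
    using S lim by (intro eventually_ball_finite ballI) (auto dest: tendstoD)
  then obtain n where n: "\<forall>s\<in>S. dist (\<theta> n s) 1 < \<epsilon>"
    using eventually_happens trivial_limit_sequentially by blast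
  have t: "homog 1 (1\<^sub>m 3) \<in> G_set" by (intro G_setI) auto
  have "inverse (real (Suc n)) \<le> 1" by (simp add: field_simps)
  hence "sin (inverse (real (Suc n))) > 0" using pi_ge_two by (intro sin_gt_zero) auto
  hence "\<theta> n (homog 1 (1\<^sub>m 3)) \<noteq> 1"
    by (auto simp: \<theta>_def exponent_aff complex_eq_iff)
  thus "\<exists>\<theta>. (\<forall>g\<in>carrier group_G. cmod (\<theta> g) = 1) \<and>
        (\<forall>g\<in>carrier group_G. \<forall>h\<in>carrier group_G. \<theta> (g \<otimes>\<^bsub>group_G\<^esub> h) = \<theta> g * \<theta> h) \<and>
        (\<forall>s\<in>S. cmod (\<theta> s - 1) < \<epsilon>) \<and> (\<exists>g\<in>carrier group_G. \<theta> g \<noteq> 1)"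
    using n t by (intro exI[of _ "\<theta> n"])
      (auto simp: \<theta>_def exponent_mult cis_mult distrib_left dist_norm)
qed (rule G.group_axioms)

section \<open>Means\<close>

context mean
begin

lemma indicator_linf: "(\<lambda>x\<in>X. indicator E x :: real) \<in> linf X"
  by (auto simp: linf_def bounded_iff indicator_def intro!: exI[of _ 1])

lemma mean_of_set_nonneg: "0 \<le> mean_of_set X m E"
  unfolding mean_of_set_def by (intro mean_nonneg indicator_linf) auto

lemma mean_of_set_cong: "E \<inter> X = F \<inter> X \<Longrightarrow> mean_of_set X m E = mean_of_set X m F"
  unfolding mean_of_set_def by (intro arg_cong[of _ _ m] restrict_ext) (auto simp: indicator_def)

lemma mean_of_set_disjoint_union:
  assumes "A \<inter> B = {}"
  shows "mean_of_set X m (A \<union> B) = mean_of_set X m A + mean_of_set X m B"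
proof -
  have "(\<lambda>x\<in>X. indicator (A \<union> B) x :: real) =
      (\<lambda>x\<in>X. (\<lambda>x\<in>X. indicator A x) x + (\<lambda>x\<in>X. indicator B x) x)"
    using assms by (intro restrict_ext) (auto simp: indicator_def)
  thus ?thesis unfolding mean_of_set_def using mean_add[OF indicator_linf indicator_linf] by simp
qed

lemma mean_of_set_mono: "A \<subseteq> B \<Longrightarrow> mean_of_set X m A \<le> mean_of_set X m B"
  using mean_of_set_disjoint_union[of A "B - A"] mean_of_set_nonneg[of "B - A"]
  by (simp add: Un_absorb1)

lemma mean_of_set_union_le: "mean_of_set X m (A \<union> B) \<le> mean_of_set X m A + mean_of_set X m B"
  using mean_of_set_disjoint_union[of A "B - A"] mean_of_set_mono[of "B - A" B] by simp

lemma mean_of_set_space: "mean_of_set X m X = 1"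
  unfolding mean_of_set_def using mean_one by (simp cong: restrict_cong)

lemma mean_of_set_empty: "mean_of_set X m {} = 0"
  using mean_of_set_disjoint_union[of "{}" "{}"] by simp

lemma null_UN:
  assumes "finite I" "\<And>i. i \<in> I \<Longrightarrow> mean_of_set X m (A i) = 0"
  shows "mean_of_set X m (\<Union>i\<in>I. A i) = 0"
  using assms
proof (induction I rule: finite_induct)
  case (insert i I)
  thus ?case using mean_of_set_union_le[of "A i" "\<Union>i\<in>I. A i"] mean_of_set_nonneg[of "\<Union>i\<in>insert i I. A i"]
    by simp
qed (simp add: mean_of_set_empty)

text \<open>In particular, a set with infinitely many pairwise disjoint translates is null for every
  invariant mean.\<close>

lemma null_of_disjoint_translates:
  fixes E :: "nat \<Rightarrow> 'a set"
  assumes disj: "\<And>i j. i < j \<Longrightarrow> E i \<inter> E j = {}" and c: "\<And>i. mean_of_set X m (E i) = c"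
  shows "c = 0"
proof (rule ccontr)
  assume "c \<noteq> 0"
  hence "c > 0" using mean_of_set_nonneg[of "E 0"] c[of 0] by simp
  then obtain n where n: "real n * c > 1" using reals_Archimedean3 by blast
  have "mean_of_set X m (\<Union>i<k. E i) = real k * c" for k
  proof (induction k)
    case (Suc k)
    have "(\<Union>i<k. E i) \<inter> E k = {}" using disj by blast
    thus ?case using Suc mean_of_set_disjoint_union[of "\<Union>i<k. E i" "E k"] c
      by (simp add: lessThan_Suc Un_commute algebra_simps)
  qed (simp add: mean_of_set_empty)
  moreover have "mean_of_set X m (\<Union>i<n. E i) \<le> 1"
    using mean_of_set_mono[of "(\<Union>i<n. E i) \<inter> X" X] mean_of_set_space
      mean_of_set_cong[of "(\<Union>i<n. E i) \<inter> X" "\<Union>i<n. E i"] by simp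
  ultimately show False using n by simp
qed

end

lemma conj_invariant_mean_of_set:
  assumes "group G" "mean (carrier G) m" "conj_invariant_mean G m" and g: "g \<in> carrier G"
  shows "mean_of_set (carrier G) m {x. inv\<^bsub>G\<^esub> g \<otimes>\<^bsub>G\<^esub> x \<otimes>\<^bsub>G\<^esub> g \<in> E} = mean_of_set (carrier G) m E"
proof -
  interpret group G by (rule assms(1))
  interpret mean "carrier G" m by (rule assms(2))
  let ?f = "\<lambda>x\<in>carrier G. indicator E x :: real"
  have "m (\<lambda>x\<in>carrier G. ?f (inv\<^bsub>G\<^esub> g \<otimes>\<^bsub>G\<^esub> x \<otimes>\<^bsub>G\<^esub> g)) = m ?f"
    using assms(3) g indicator_linf unfolding conj_invariant_mean_def by blast
  moreover have "(\<lambda>x\<in>carrier G. ?f (inv\<^bsub>G\<^esub> g \<otimes>\<^bsub>G\<^esub> x \<otimes>\<^bsub>G\<^esub> g)) =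
      (\<lambda>x\<in>carrier G. indicator {x. inv\<^bsub>G\<^esub> g \<otimes>\<^bsub>G\<^esub> x \<otimes>\<^bsub>G\<^esub> g \<in> E} x)"
    using g by (intro restrict_ext) (auto simp: indicator_def)
  ultimately show ?thesis by (simp add: mean_of_set_def)
qed

section \<open>Conjugation-invariant means on the group\<close>

lemma aff_translation_entry: "M \<in> carrier_mat 3 3 \<Longrightarrow> i < 3 \<Longrightarrow> aff M v $$ (i,3) = v $ i"
  by (simp add: aff_def mat_of_cols_index)

text \<open>Conjugation by an elementary matrix acts by that matrix on the translation part. In characteristic
  two such a matrix is its own inverse.\<close>

lemma addrow_conj_entries:
  fixes p :: "bit poly"
  assumes g: "g \<in> G_set" and ij: "i < 3" "j < 3" "i \<noteq> j" and l: "l < 3"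
  defines "h \<equiv> homog 0 (addrow_mat 3 p i j)"
  shows "(inv\<^bsub>group_G\<^esub> h * g * h) $$ (l,3) = (if l = i then g $$ (i,3) + eval_inv_t p * g $$ (j,3) else g $$ (l,3))"
proof -
  let ?A = "addrow_mat 3 p i j"
  have A: "?A \<in> SL3_poly" using ij by (intro addrow_mat_SL3)
  obtain k B v where B: "B \<in> SL3_poly" "v \<in> L3" "g = aff (lin k B) v" using g by (rule G_setE)
  have "addrow_mat 3 (0 :: bit poly) i j = 1\<^sub>m 3" by (intro eq_matI) auto
  hence "?A * ?A = 1\<^sub>m 3" using addrow_mat_add[of i 3 j p p] ij bit_poly_uminus[of p]
    by (metis add.right_inverse)
  hence "inv\<^bsub>group_G\<^esub> h = h" unfolding h_def
    using A by (intro G_inv_eqI G_setI) (simp_all add: homog_mult lin_one aff_one)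
  hence "inv\<^bsub>group_G\<^esub> h * g * h = aff (lin k (?A * B * ?A)) (lin 0 ?A *\<^sub>v v)"
    using A B by (simp add: h_def aff_lin_mult SL3_poly_mult SL3_poly_carrier L3_carrier L3_lin)
  moreover have "(lin 0 ?A *\<^sub>v v) $ l = (if l = i then v $ i + eval_inv_t p * v $ j else v $ l)"
  proof -
    have "(lin 0 ?A *\<^sub>v v) $ l = (\<Sum>c\<in>{0..<3}. eval_inv_t (?A $$ (l,c)) * v $ c)"
      using l L3_carrier[OF B(2)] by (simp add: lin_vec_entry)
    also have "\<dots> = (\<Sum>c\<in>{0..<3}. (if c = l then v $ l else 0) +
        (if c = j then (if l = i then eval_inv_t p * v $ j else 0) else 0))"
      using ij l by (intro sum.cong) auto
    also have "\<dots> = v $ l + (if l = i then eval_inv_t p * v $ j else 0)"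
      using ij l by (simp add: sum.distrib)
    finally show ?thesis by simp
  qed
  moreover have "?A * B * ?A \<in> carrier_mat 3 3" using SL3_poly_carrier[OF B(1)]
    by (intro mult_carrier_mat[of _ 3 3]) auto
  ultimately show ?thesis using B ij l
    by (simp add: aff_translation_entry SL3_poly_carrier)
qed

text \<open>The translation part is a map from the group to \<open>L\<^sup>3\<close> that is equivariant for \<open>Q\<close>, and \<open>L\<^sup>3\<close> without
  the origin carries no \<open>Q\<close>-invariant mean. Hence an invariant mean is concentrated on the elements
  without translation part. Those with nontrivial linear part are moved into the complementary null
  set by conjugation with one of three translations, so the mean is concentrated at the identity.\<close>

lemma not_inner_amenable_G: "\<not> inner_amenable group_G"
proof
  assume "inner_amenable group_G"
  then obtain m where m: "mean G_set m" and atomless: "\<And>x. x \<in> G_set \<Longrightarrow> mean_of_set G_set m {x} = 0"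
    and conj: "conj_invariant_mean group_G m"
    by (auto simp: inner_amenable_def atomless_mean_def)
  interpret mean G_set m by (rule m)
  let ?\<mu> = "mean_of_set G_set m"
  have inv: "?\<mu> {x. inv\<^bsub>group_G\<^esub> g * x * g \<in> E} = ?\<mu> E" if "g \<in> G_set" for g E
    using conj_invariant_mean_of_set[OF G.group_axioms _ conj, of g E] m that by simp
  \<comment> \<open>The \<open>j\<close>-th coordinate is not zero and the \<open>i\<close>-th one does not exceed it at the place \<open>t = 0\<close>.\<close>
  define E where "E i j = {g \<in> G_set. g $$ (j,3) \<noteq> 0 \<and> g $$ (i,3) / g $$ (j,3) \<in> loc_ring}" for i j
  have E0: "?\<mu> (E i j) = 0" if ij: "i < 3" "j < 3" "i \<noteq> j" for i j
  proof (rule null_of_disjoint_translates)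
    define h where "h n = homog 0 (addrow_mat 3 ([:0, 1:] ^ n) i j)" for n
    have h: "h n \<in> G_set" for n unfolding h_def using ij by (intro G_setI addrow_mat_SL3) auto
    let ?F = "\<lambda>n. {x. inv\<^bsub>group_G\<^esub> (h n) * x * h n \<in> E i j} \<inter> G_set"
    show "?\<mu> (?F n) = ?\<mu> (E i j)" for n
      using inv[OF h, of n "E i j"] mean_of_set_cong[of "?F n" "{x. inv\<^bsub>group_G\<^esub> (h n) * x * h n \<in> E i j}"] by auto
    have ev: "eval_inv_t ([:0, 1:] ^ n) = inverse t_K ^ n" for n
      by (induction n) (simp, simp only: power_Suc eval_inv_t_mult eval_inv_t_s)
    have F: "x $$ (j,3) \<noteq> 0 \<and> x $$ (i,3) / x $$ (j,3) + inverse t_K ^ n \<in> loc_ring" if "x \<in> ?F n" for x n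
      using that ij addrow_conj_entries[of x i j i "[:0,1:] ^ n"] addrow_conj_entries[of x i j j "[:0,1:] ^ n"]
      by (auto simp: E_def h_def ev add_divide_distrib)
    \<comment> \<open>The ratio of the two coordinates is translated by \<open>s\<^sup>k\<close>, respectively \<open>s\<^sup>n\<close>.\<close>
    show "?F k \<inter> ?F n = {}" if "k < n" for k n
    proof (rule ccontr)
      assume "?F k \<inter> ?F n \<noteq> {}"
      then obtain x where x: "x \<in> ?F k" "x \<in> ?F n" by blast
      let ?y = "x $$ (i,3) / x $$ (j,3)"
      have "(?y + inverse t_K ^ k) + (?y + inverse t_K ^ n) \<in> loc_ring"
        using F[OF x(1)] F[OF x(2)] by (elim conjE) (rule loc_ring_add)
      also have "(?y + inverse t_K ^ k) + (?y + inverse t_K ^ n) = (?y + ?y) + (inverse t_K ^ k + inverse t_K ^ n)"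
        by (simp only: add_ac)
      finally show False using inverse_powers_not_in_loc_ring[OF that] by simp
    qed
  qed
  define N where "N = {g \<in> G_set. \<exists>i<3. g $$ (i,3) \<noteq> 0}"
  \<comment> \<open>Of any two coordinates that are not both zero, one does not exceed the other.\<close>
  have sub: "N \<subseteq> (\<Union>(i,j)\<in>{(i,j). i < 3 \<and> j < 3 \<and> i \<noteq> j}. E i j)"
  proof
    fix g assume "g \<in> N"
    then obtain i where g: "g \<in> G_set" and i: "i < 3" "g $$ (i,3) \<noteq> 0" by (auto simp: N_def)
    obtain j :: nat where j: "j < 3" "j \<noteq> i" by (rule that[of "if i = 0 then 1 else 0"]) auto
    have "g \<in> E i j \<or> g \<in> E j i"
    proof (cases "g $$ (j,3) / g $$ (i,3) \<in> loc_ring")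
      case True
      thus ?thesis using g i by (simp add: E_def)
    next
      case False
      hence "g $$ (i,3) / g $$ (j,3) \<in> loc_ring" using loc_ring_valuation[of "g $$ (j,3) / g $$ (i,3)"] by simp
      moreover have "g $$ (j,3) \<noteq> 0"
      proof
        assume "g $$ (j,3) = 0"
        with False have "0 \<notin> loc_ring" by simp
        thus False using loc_ring_valuation[of 0] by simp
      qed
      ultimately show ?thesis using g by (simp add: E_def)
    qed
    thus "g \<in> (\<Union>(i,j)\<in>{(i,j). i < 3 \<and> j < 3 \<and> i \<noteq> j}. E i j)" using i j by auto
  qed
  have "?\<mu> (\<Union>(i,j)\<in>{(i,j). i < 3 \<and> j < 3 \<and> i \<noteq> j}. E i j) = 0"
  proof (rule null_UN)
    show "finite {(i,j). i < (3::nat) \<and> j < (3::nat) \<and> i \<noteq> j}"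
      by (rule finite_subset[of _ "{..<3} \<times> {..<3}"]) auto
  qed (auto intro: E0)
  hence N0: "?\<mu> N = 0"
    using mean_of_set_mono[OF sub] mean_of_set_nonneg[of N] by linarith
  let ?e = "\<lambda>j. translation (unit_vec 3 j)"
  let ?T = "\<lambda>j. {x. inv\<^bsub>group_G\<^esub> (?e j) * x * ?e j \<in> N}"
  have e: "?e j \<in> G_set" if "j < 3" for j using that by (intro G_setI L3_unit) auto
  have T0: "?\<mu> (\<Union>j\<in>{..<3}. ?T j) = 0"
    using inv[OF e] N0 by (intro null_UN) auto
  have cover: "G_set \<subseteq> N \<union> (\<Union>j\<in>{..<3}. ?T j) \<union> {1\<^sub>m 4}"
  proof
    fix g assume gG: "g \<in> G_set"
    show "g \<in> N \<union> (\<Union>j\<in>{..<3}. ?T j) \<union> {1\<^sub>m 4}"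
    proof (cases "g \<in> N")
      case False
      obtain k B v where g: "B \<in> SL3_poly" "v \<in> L3" "g = aff (lin k B) v" using gG by (rule G_setE)
      let ?M = "lin k B"
      have M: "?M \<in> carrier_mat 3 3" using SL3_poly_carrier[OF g(1)] by simp
      have v: "v \<in> carrier_vec 3" using L3_carrier[OF g(2)] .
      have v0: "v $ i = 0" if "i < 3" for i
        using False gG that g M by (auto simp: N_def aff_translation_entry)
      show ?thesis
      proof (cases "\<exists>i<3. \<exists>j<3. ?M $$ (i,j) \<noteq> 1\<^sub>m 3 $$ (i,j)")
        case True
        then obtain i j where ij: "i < 3" "j < 3" "?M $$ (i,j) \<noteq> 1\<^sub>m 3 $$ (i,j)" by blast
        have inv_e: "inv\<^bsub>group_G\<^esub> (?e j) = ?e j"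
          using e[OF ij(2)] translation_self[OF L3_unit[OF ij(2)]] by (intro G_inv_eqI)
        have c: "?e j * g * ?e j = aff ?M (?M *\<^sub>v unit_vec 3 j + (v + unit_vec 3 j))"
          using g L3_unit[OF ij(2)] by (simp only: conj_translation)
        have "(?e j * g * ?e j) $$ (i,3) = ?M $$ (i,j) - 1\<^sub>m 3 $$ (i,j)"
          unfolding c using M v ij(1,2) v0[OF ij(1)] by (simp add: aff_translation_entry)
        hence "(?e j * g * ?e j) $$ (i,3) \<noteq> 0" using ij(3) by (metis right_minus_eq)
        moreover have "?e j * g * ?e j \<in> G_set"
          unfolding c using g L3_unit[OF ij(2)] by (intro G_setI L3_add L3_lin)
        ultimately have "g \<in> ?T j" using ij(1) inv_e by (auto simp: N_def)
        thus ?thesis using ij(2) by blast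
      next
        case False
        hence "?M = 1\<^sub>m 3" using M by (intro eq_matI) auto
        moreover have "v = 0\<^sub>v 3" using v0 v by (intro eq_vecI) auto
        ultimately show ?thesis using g(3) aff_one by simp
      qed
    qed auto
  qed
  have "1\<^sub>m 4 \<in> G_set" using G.one_closed by simp
  have "?\<mu> G_set \<le> ?\<mu> N + ?\<mu> (\<Union>j\<in>{..<3}. ?T j) + ?\<mu> {1\<^sub>m 4}"
    using mean_of_set_mono[OF cover] mean_of_set_union_le[of "N \<union> (\<Union>j\<in>{..<3}. ?T j)" "{1\<^sub>m 4}"]
      mean_of_set_union_le[of N "\<Union>j\<in>{..<3}. ?T j"] by linarith
  thus False using N0 T0 atomless[OF \<open>1\<^sub>m 4 \<in> G_set\<close>] mean_of_set_space by simp
qed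

section \<open>The group is not properly proximal\<close>

text \<open>The vectors of Laurent polynomials with exponents in \<open>S\<close>.\<close>

definition vec_span :: "int set \<Rightarrow> K vec set" where
  "vec_span S = {v \<in> carrier_vec 3. \<forall>i<3. v $ i \<in> lspan S}"

lemma vec_span_UNIV: "vec_span UNIV = L3"
  by (simp add: vec_span_def L3_def)

lemma vec_span_mono: "S \<subseteq> T \<Longrightarrow> vec_span S \<subseteq> vec_span T"
  using lspan_mono[of S T] by (auto simp: vec_span_def)

lemma vec_span_L3: "vec_span S \<subseteq> L3"
  using vec_span_mono[of S UNIV] by (simp add: vec_span_UNIV)

lemma vec_span_carrier: "v \<in> vec_span S \<Longrightarrow> v \<in> carrier_vec 3"
  by (simp add: vec_span_def)

lemma vec_span_zero: "0\<^sub>v 3 \<in> vec_span S"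
  by (simp add: vec_span_def)

lemma vec_span_add: "v \<in> vec_span S \<Longrightarrow> w \<in> vec_span S \<Longrightarrow> v + w \<in> vec_span S"
  by (auto simp: vec_span_def lspan_add)

lemma finite_vec_span:
  assumes "finite S"
  shows "finite (vec_span S)"
proof (rule finite_imageD)
  let ?f = "\<lambda>v :: K vec. (v $ 0, v $ 1, v $ 2)"
  show "finite (?f ` vec_span S)"
    by (rule finite_subset[of _ "lspan S \<times> lspan S \<times> lspan S"])
       (use finite_lspan[OF assms] in \<open>auto simp: vec_span_def\<close>)
  show "inj_on ?f (vec_span S)"
  proof (rule inj_onI)
    fix v w assume v: "v \<in> vec_span S" and w: "w \<in> vec_span S" and eq: "?f v = ?f w"
    show "v = w"
    proof (rule eq_vecI)
      fix i assume "i < dim_vec w"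
      hence "i = 0 \<or> i = 1 \<or> i = 2" using vec_span_carrier[OF w] by auto
      thus "v $ i = w $ i" using eq by auto
    qed (use vec_span_carrier[OF v] vec_span_carrier[OF w] in auto)
  qed
qed

lemma vec_span_split:
  assumes "v \<in> vec_span (S \<union> T)"
  obtains u w where "u \<in> vec_span S" "w \<in> vec_span T" "v = u + w"
proof -
  have "\<exists>p. fst p \<in> lspan S \<and> snd p \<in> lspan T \<and> v $ i = fst p + snd p" if "i < 3" for i
  proof -
    have "v $ i \<in> lspan (S \<union> T)" using assms that by (simp add: vec_span_def)
    then obtain y z where "y \<in> lspan S" "z \<in> lspan T" "v $ i = y + z" by (rule lspan_split)
    thus ?thesis by (intro exI[of _ "(y, z)"]) simp
  qed
  then obtain p where p: "\<And>i. i < 3 \<Longrightarrow> fst (p i) \<in> lspan S \<and> snd (p i) \<in> lspan T \<and> v $ i = fst (p i) + snd (p i)"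
    by metis
  show ?thesis
  proof (rule that)
    show "vec 3 (\<lambda>i. fst (p i)) \<in> vec_span S" "vec 3 (\<lambda>i. snd (p i)) \<in> vec_span T"
      using p by (auto simp: vec_span_def)
    show "v = vec 3 (\<lambda>i. fst (p i)) + vec 3 (\<lambda>i. snd (p i))"
      using p vec_span_carrier[OF assms] by (intro eq_vecI) auto
  qed
qed

lemma vec_span_disjoint:
  assumes "v \<in> vec_span S" "v \<in> vec_span T" "S \<inter> T = {}"
  shows "v = 0\<^sub>v 3"
  using assms lspan_disjoint[OF _ _ assms(3)] by (intro eq_vecI) (auto simp: vec_span_def)

lemma vec_span_smult:
  assumes "v \<in> vec_span S" "\<And>s. s \<in> S \<Longrightarrow> n + s \<in> T"
  shows "t_K powi n \<cdot>\<^sub>v v \<in> vec_span T"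
proof -
  have "t_K powi n * v $ i \<in> lspan T" if "i < 3" for i
    using assms that by (intro lspan_mult[of _ "{n}" _ S] lspan_powi) (auto simp: vec_span_def)
  thus ?thesis using assms(1) by (auto simp: vec_span_def)
qed

lemma vec_span_bounded:
  assumes "v \<in> L3"
  obtains n where "v \<in> vec_span {- int n..int n}"
proof -
  have "\<exists>n. v $ i \<in> lspan {- int n..int n}" if "i < 3" for i
  proof -
    have "v $ i \<in> lspan UNIV" using assms that by (simp add: L3_def)
    then obtain n where "v $ i \<in> lspan (UNIV \<inter> {- int n..int n})" by (rule lspan_bounded)
    thus ?thesis by auto
  qed
  then obtain n where n: "\<And>i. i < 3 \<Longrightarrow> v $ i \<in> lspan {- int (n i)..int (n i)}" by metis
  have "v $ i \<in> lspan {- int (n 0 + n 1 + n 2)..int (n 0 + n 1 + n 2)}" if "i < 3" for i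
  proof -
    have "i = 0 \<or> i = 1 \<or> i = 2" using that by auto
    hence "{- int (n i)..int (n i)} \<subseteq> {- int (n 0 + n 1 + n 2)..int (n 0 + n 1 + n 2)}" by auto
    thus ?thesis using n[OF that] lspan_mono by blast
  qed
  thus ?thesis using assms by (intro that[of "n 0 + n 1 + n 2"]) (simp add: vec_span_def L3_def)
qed

lemma lin0_vec_span:
  assumes "B \<in> carrier_mat 3 3" "v \<in> vec_span S"
    and "\<And>i j. i < 3 \<Longrightarrow> j < 3 \<Longrightarrow> eval_inv_t (B $$ (i,j)) \<in> lspan D"
    and "\<And>d s. d \<in> D \<Longrightarrow> s \<in> S \<Longrightarrow> d + s \<in> T"
  shows "lin 0 B *\<^sub>v v \<in> vec_span T"
proof -
  have "(lin 0 B *\<^sub>v v) $ i \<in> lspan T" if i: "i < 3" for i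
  proof -
    have "(lin 0 B *\<^sub>v v) $ i = (\<Sum>j\<in>{0..<3}. eval_inv_t (B $$ (i,j)) * v $ j)"
      using assms(1,2) i by (simp add: lin_vec_entry vec_span_carrier)
    also have "\<dots> \<in> lspan T"
      using assms i by (intro lspan_sum lspan_mult[of _ D _ S]) (auto simp: vec_span_def)
    finally show ?thesis .
  qed
  moreover have "lin 0 B *\<^sub>v v \<in> carrier_vec 3"
    using assms(1,2) by (intro mult_mat_vec_carrier[of _ 3 3]) (auto simp: vec_span_carrier)
  ultimately show ?thesis by (simp add: vec_span_def)
qed

lemma eval_inv_t_range: "eval_inv_t p \<in> lspan {..0}"
  using range_eval_inv_t by (auto simp: R_ring_eq)

lemma matrix_entries_bounded:
  fixes B :: "bit poly mat"
  shows "\<exists>d. \<forall>i<3. \<forall>j<3. eval_inv_t (B $$ (i,j)) \<in> lspan {- int d..0}"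
proof -
  have "\<exists>d. eval_inv_t p \<in> lspan {- int d..0}" for p
  proof -
    obtain n where "eval_inv_t p \<in> lspan ({..0} \<inter> {- int n..int n})"
      using lspan_bounded[OF eval_inv_t_range[of p]] .
    moreover have "{..0} \<inter> {- int n..int n} = {- int n..0}" by auto
    ultimately show ?thesis by auto
  qed
  then obtain d where d: "\<And>p. eval_inv_t p \<in> lspan {- int (d p)..0}" by metis
  let ?D = "\<Sum>i<3. \<Sum>j<3. d (B $$ (i,j))"
  have "eval_inv_t (B $$ (i,j)) \<in> lspan {- int ?D..0}" if "i < 3" "j < 3" for i j
  proof -
    have "d (B $$ (i,j)) \<le> (\<Sum>j<3. d (B $$ (i,j)))" using that by (intro member_le_sum) auto
    also have "\<dots> \<le> ?D" using that by (intro member_le_sum[where f = "\<lambda>i. \<Sum>j<3. d (B $$ (i,j))"]) auto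
    finally have "int (d (B $$ (i,j))) \<le> int ?D" by (simp only: of_nat_le_iff)
    hence "{- int (d (B $$ (i,j)))..0} \<subseteq> {- int ?D..0}" by (auto simp del: of_nat_sum)
    thus ?thesis using d lspan_mono by blast
  qed
  thus ?thesis by blast
qed

lemma lin_vec: "B \<in> carrier_mat 3 3 \<Longrightarrow> v \<in> carrier_vec 3 \<Longrightarrow>
    lin k B *\<^sub>v v = t_K powi k \<cdot>\<^sub>v (lin 0 B *\<^sub>v v)"
proof (rule eq_vecI)
  assume B: "B \<in> carrier_mat 3 3" and v: "v \<in> carrier_vec 3"
  have d: "dim_vec (lin l B *\<^sub>v v) = 3" for l using B by (simp add: lin_def)
  thus "dim_vec (lin k B *\<^sub>v v) = dim_vec (t_K powi k \<cdot>\<^sub>v (lin 0 B *\<^sub>v v))" by simp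
  fix i assume "i < dim_vec (t_K powi k \<cdot>\<^sub>v (lin 0 B *\<^sub>v v))"
  hence i: "i < 3" by (simp only: index_smult_vec(2) d)
  have "(t_K powi k \<cdot>\<^sub>v (lin 0 B *\<^sub>v v)) $ i = t_K powi k * (lin 0 B *\<^sub>v v) $ i"
    by (rule index_smult_vec(1)) (simp only: d i)
  also have "\<dots> = (lin k B *\<^sub>v v) $ i"
    unfolding lin_vec_entry[OF B v i] sum_distrib_left by (intro sum.cong) (simp_all add: mult.assoc)
  finally show "(lin k B *\<^sub>v v) $ i = (t_K powi k \<cdot>\<^sub>v (lin 0 B *\<^sub>v v)) $ i" by (rule sym)
qed

lemma lin_one_smult: "v \<in> carrier_vec 3 \<Longrightarrow> lin k (1\<^sub>m 3) *\<^sub>v v = t_K powi k \<cdot>\<^sub>v v"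
  using lin_vec[of "1\<^sub>m 3" v k] by simp

lemma lin0_add: "B \<in> carrier_mat 3 3 \<Longrightarrow> v \<in> carrier_vec 3 \<Longrightarrow> w \<in> carrier_vec 3 \<Longrightarrow>
    lin 0 B *\<^sub>v (v + w) = lin 0 B *\<^sub>v v + lin 0 B *\<^sub>v w"
  by (intro mult_add_distrib_mat_vec[of _ 3 3]) auto

lemma vec_add_cancel: "v \<in> carrier_vec 3 \<Longrightarrow> w \<in> carrier_vec 3 \<Longrightarrow> v + (v + w) = w" for v w :: "K vec"
  by (intro eq_vecI) (auto simp: add.assoc[symmetric])

lemma vec_add_cancel_right:
  "\<lbrakk>a \<in> carrier_vec n; b \<in> carrier_vec n; z \<in> carrier_vec n\<rbrakk> \<Longrightarrow> a + z + (b + z) = a + b" for a b z :: "K vec"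
proof (rule eq_vecI)
  fix i assume "a \<in> carrier_vec n" "b \<in> carrier_vec n" "z \<in> carrier_vec n" "i < dim_vec (a + b)"
  hence "(a + z + (b + z)) $ i = (a $ i + b $ i) + (z $ i + z $ i)" by (simp add: add_ac)
  thus "(a + z + (b + z)) $ i = (a + b) $ i"
    using \<open>a \<in> carrier_vec n\<close> \<open>b \<in> carrier_vec n\<close> \<open>i < dim_vec (a + b)\<close> by simp
qed auto

lemma smult_add_inverse_smult:
  fixes a w :: "K vec"
  assumes "a \<in> carrier_vec n" "w \<in> carrier_vec n" "c * c' = 1"
  shows "c \<cdot>\<^sub>v (a + c' \<cdot>\<^sub>v w) = c \<cdot>\<^sub>v a + w"
  using assms by (intro eq_vecI) (auto simp: distrib_left mult.assoc[symmetric])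

text \<open>The points are \<open>t\<^sup>n v\<close> with \<open>-2N \<le> n \<le> -N\<close> and with \<open>v\<close> a translation whose coordinates are combinations
  of \<open>t, \<dots>, t\<^sup>3\<^sup>N\<close>. The second factor represents \<open>t\<^sup>3\<^sup>N R\<^sup>3 / R\<^sup>3\<close>, on which \<open>Q\<close> acts by permutations, and
  the negative exponents \<open>n\<close> bring every fixed translation into \<open>t\<^sup>3\<^sup>N R\<^sup>3\<close> when it is moved past \<open>t\<^sup>n\<close>.\<close>

definition idx :: "nat \<Rightarrow> (int \<times> K vec) set" where
  "idx N = {- 2 * int N..- int N} \<times> vec_span {1..3 * int N}"

definition pt :: "int \<times> K vec \<Rightarrow> K mat" where
  "pt = (\<lambda>(n, v). aff (lin n (1\<^sub>m 3)) (t_K powi n \<cdot>\<^sub>v v))"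

lemma smult_L3: "v \<in> L3 \<Longrightarrow> t_K powi n \<cdot>\<^sub>v v \<in> L3"
  using vec_span_smult[of v UNIV n UNIV] by (simp add: vec_span_UNIV)

text \<open>For \<open>y = w t\<^sup>k B\<close> one has \<open>y t\<^sup>n v = t\<^sup>n\<^sup>+\<^sup>k (B v + t\<^sup>-\<^sup>n\<^sup>-\<^sup>k w) B\<close>. The vector in parentheses is the sum of the new
  vector \<open>v'\<close>, with exponents in \<open>{1..3N}\<close>, and of an element \<open>u\<close> with exponents in \<open>{-d..0}\<close>, where \<open>d\<close>
  bounds the degrees in \<open>s\<close> of the entries of \<open>B\<close>. So the factor \<open>u B\<close> on the right ranges over a finite set.\<close>

lemma escaping_family_G: "escaping_family group_G idx pt"
proof (intro escaping_family.intro escaping_family_axioms.intro)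
  show "group group_G" by (rule G.group_axioms)
  show fin: "finite (idx N)" for N by (simp add: idx_def finite_vec_span)
  show "idx N \<noteq> {}" for N using vec_span_zero by (auto simp: idx_def)
  show "pt i \<in> carrier group_G" if "i \<in> idx N" for i N
    using that vec_span_L3[of "{1..3 * int N}"] by (auto simp: idx_def pt_def intro!: G_setI smult_L3)
  fix y assume "y \<in> carrier group_G"
  hence yG: "y \<in> G_set" by simp
  have pt_ex: "exponent (pt (n, v)) = n" if "(n, v) \<in> idx N" for n v N
    using that vec_span_L3[of "{1..3 * int N}"] by (auto simp: idx_def pt_def intro!: exponent_aff smult_L3)
  have "y \<notin> pt ` idx N" if "N > nat \<bar>exponent y\<bar>" for N
  proof
    assume "y \<in> pt ` idx N"
    then obtain n v where nv: "(n, v) \<in> idx N" "y = pt (n, v)" by auto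
    hence "exponent y = n" using pt_ex by simp
    moreover have "n \<le> - int N" using nv(1) by (simp add: idx_def)
    ultimately show False using that by linarith
  qed
  thus "eventually (\<lambda>N. y \<notin> pt ` idx N) sequentially"
    using eventually_gt_at_top[of "nat \<bar>exponent y\<bar>"] by (rule eventually_mono[rotated]) auto
  obtain k B w where B: "B \<in> SL3_poly" and w: "w \<in> L3" and y: "y = aff (lin k B) w"
    using yG by (rule G_setE)
  note Bc = SL3_poly_carrier[OF B]
  obtain d where d: "\<And>i j. i < 3 \<Longrightarrow> j < 3 \<Longrightarrow> eval_inv_t (B $$ (i,j)) \<in> lspan {- int d..0}"
    using matrix_entries_bounded[of B] by auto
  obtain c where c: "w \<in> vec_span {- int c..int c}" using w by (rule vec_span_bounded)
  let ?U = "vec_span {- int d..0}"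
  define E where "E = (\<lambda>u. aff (lin 0 B) u) ` ?U"
  define q where "q n v = lin 0 B *\<^sub>v v + t_K powi (- n - k) \<cdot>\<^sub>v w" for n v
  define J where "J N = {i \<in> idx N. fst i + k \<in> {- 2 * int N..- int N}}" for N
  define nxt where "nxt N n v = (SOME v'. v' \<in> vec_span {1..3 * int N} \<and> (\<exists>u\<in>?U. q n v = u + v'))" for N n v
  define \<beta> where "\<beta> N = (\<lambda>(n, v). (n + k, nxt N n v))" for N :: nat
  have nxt: "nxt N n v \<in> vec_span {1..3 * int N} \<and> (\<exists>u\<in>?U. q n v = u + nxt N n v)"
    if N: "N \<ge> c" and J: "(n, v) \<in> J N" for N n v
  proof -
    have v: "v \<in> vec_span {1..3 * int N}" and n: "- 2 * int N \<le> n + k" "n + k \<le> - int N"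
      using J by (auto simp: J_def idx_def)
    have "lin 0 B *\<^sub>v v \<in> vec_span {- int d..3 * int N}"
      by (rule lin0_vec_span[OF Bc v d]) auto
    moreover have "t_K powi (- n - k) \<cdot>\<^sub>v w \<in> vec_span {- int d..3 * int N}"
      using N n by (intro vec_span_smult[OF c]) auto
    ultimately have "q n v \<in> vec_span {- int d..3 * int N}" unfolding q_def by (rule vec_span_add)
    also have "{- int d..3 * int N} = {- int d..0} \<union> {1..3 * int N}" by auto
    finally obtain u v' where "u \<in> ?U" "v' \<in> vec_span {1..3 * int N}" "q n v = u + v'"
      by (rule vec_span_split)
    hence "\<exists>v'. v' \<in> vec_span {1..3 * int N} \<and> (\<exists>u\<in>?U. q n v = u + v')" by blast
    thus ?thesis unfolding nxt_def by (rule someI_ex)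
  qed
  \<comment> \<open>If \<open>v\<close> and \<open>v'\<close> have the same image, then \<open>B (v + v')\<close> lies in \<open>R\<^sup>3\<close>, hence so does \<open>v + v'\<close>.\<close>
  have inj: "inj_on (\<beta> N) (J N)" if N: "N \<ge> c" for N
  proof (rule inj_onI)
    fix p p' assume pp: "p \<in> J N" "p' \<in> J N" "\<beta> N p = \<beta> N p'"
    obtain n v n' v' where p: "p = (n, v)" "p' = (n', v')" by (cases p, cases p')
    have J: "(n, v) \<in> J N" "(n', v') \<in> J N" and eq: "\<beta> N (n, v) = \<beta> N (n', v')"
      using pp p by simp_all
    have n: "n = n'" and nx: "nxt N n v = nxt N n v'" using eq by (auto simp: \<beta>_def)
    have v: "v \<in> vec_span {1..3 * int N}" "v' \<in> vec_span {1..3 * int N}" using J by (auto simp: J_def idx_def)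
    note vc = vec_span_carrier[OF v(1)] vec_span_carrier[OF v(2)]
    obtain u u' where u: "u \<in> ?U" "u' \<in> ?U" "q n v = u + nxt N n v" "q n v' = u' + nxt N n v"
      using nxt[OF N J(1)] nxt[OF N J(2)] n nx by metis
    note uc = vec_span_carrier[OF u(1)] vec_span_carrier[OF u(2)]
    have xc: "nxt N n v \<in> carrier_vec 3" using nxt[OF N J(1)] vec_span_carrier by blast
    have wc: "w \<in> carrier_vec 3" using L3_carrier[OF w] .
    have qc: "lin 0 B *\<^sub>v v \<in> carrier_vec 3" "lin 0 B *\<^sub>v v' \<in> carrier_vec 3"
      using Bc vc by (auto intro!: mult_mat_vec_carrier[of _ 3 3])
    have "lin 0 B *\<^sub>v (v + v') = lin 0 B *\<^sub>v v + lin 0 B *\<^sub>v v'" using Bc vc by (rule lin0_add)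
    also have "\<dots> = q n v + q n v'"
      unfolding q_def n using qc wc by (intro vec_add_cancel_right[symmetric]) auto
    also have "\<dots> = u + u'"
      unfolding u(3,4) using uc xc by (intro vec_add_cancel_right)
    finally have eq': "lin 0 B *\<^sub>v (v + v') = u + u'" .
    have "lin 0 B *\<^sub>v (v + v') \<in> vec_span {..0}"
      unfolding eq' using u vec_span_mono[of "{- int d..0}" "{..0}"] by (intro vec_span_add) auto
    obtain C where C: "C \<in> SL3_poly" "C * B = 1\<^sub>m 3" using SL3_poly_inverse[OF B] by metis
    have "lin 0 C *\<^sub>v (lin 0 B *\<^sub>v (v + v')) \<in> vec_span {..0}"
      by (rule lin0_vec_span[OF SL3_poly_carrier[OF C(1)] \<open>lin 0 B *\<^sub>v (v + v') \<in> vec_span {..0}\<close> eval_inv_t_range]) auto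
    also have "lin 0 C *\<^sub>v (lin 0 B *\<^sub>v (v + v')) = (lin 0 C * lin 0 B) *\<^sub>v (v + v')"
      using SL3_poly_carrier[OF C(1)] Bc vc by (intro assoc_mult_mat_vec[symmetric, of _ 3 3 _ 3]) auto
    also have "\<dots> = v + v'" using SL3_poly_carrier[OF C(1)] Bc vc C(2) by (simp add: lin_mult)
    finally have "v + v' \<in> vec_span {..0}" .
    moreover have "v + v' \<in> vec_span {1..3 * int N}" using v by (rule vec_span_add)
    ultimately have "v + v' = 0\<^sub>v 3" by (rule vec_span_disjoint) auto
    hence "v = v'" using vec_add_cancel[OF vc] vc by simp
    thus "p = p'" using n p by simp
  qed
  have step: "\<exists>e\<in>E. y * pt (n, v) = pt (\<beta> N (n, v)) * e" if N: "N \<ge> c" and J: "(n, v) \<in> J N" for N n v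
  proof -
    obtain u where u: "u \<in> ?U" "q n v = u + nxt N n v" and x: "nxt N n v \<in> vec_span {1..3 * int N}"
      using nxt[OF N J] by blast
    have v: "v \<in> vec_span {1..3 * int N}" using J by (simp add: J_def idx_def)
    have L: "v \<in> L3" "u \<in> L3" "nxt N n v \<in> L3" using v u x vec_span_L3 by blast+
    note Lc = L3_carrier[OF L(1)] L3_carrier[OF L(2)] L3_carrier[OF L(3)] L3_carrier[OF w]
    have Bv: "lin 0 B *\<^sub>v v \<in> carrier_vec 3" using Bc Lc by (auto intro!: mult_mat_vec_carrier[of _ 3 3])
    have "y * pt (n, v) = aff (lin (k + n) B) (lin k B *\<^sub>v (t_K powi n \<cdot>\<^sub>v v) + w)"
      using B w L Bc by (simp add: y pt_def aff_lin_mult smult_L3 right_mult_one_mat[of _ 3 3])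
    also have "lin k B *\<^sub>v (t_K powi n \<cdot>\<^sub>v v) + w = t_K powi (n + k) \<cdot>\<^sub>v q n v"
    proof -
      have "lin k B *\<^sub>v (t_K powi n \<cdot>\<^sub>v v) = t_K powi (n + k) \<cdot>\<^sub>v (lin 0 B *\<^sub>v v)"
        using Bc Lc by (subst lin_vec) (auto intro!: eq_vecI simp: mult_mat_vec[of _ 3 3] power_int_add)
      moreover have "t_K powi (n + k) * t_K powi (- n - k) = 1"
        using power_int_add[of t_K "n + k" "- n - k"] by simp
      ultimately show ?thesis
        unfolding q_def using smult_add_inverse_smult[OF Bv Lc(4)] by simp
    qed
    also have "aff (lin (k + n) B) (t_K powi (n + k) \<cdot>\<^sub>v q n v) = pt (\<beta> N (n, v)) * aff (lin 0 B) u"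
    proof -
      have "t_K powi (n + k) \<cdot>\<^sub>v (u + nxt N n v) = t_K powi (n + k) \<cdot>\<^sub>v u + t_K powi (n + k) \<cdot>\<^sub>v nxt N n v"
        using Lc by (intro smult_add_distrib_vec[of _ 3])
      thus ?thesis using B L Lc Bc
        by (simp add: \<beta>_def pt_def aff_lin_mult smult_L3 lin_one_smult left_mult_one_mat[of _ 3 3] u(2) add.commute)
    qed
    finally show ?thesis using u(1) by (auto simp: E_def)
  qed
  have sub: "\<beta> N ` J N \<subseteq> idx N" if N: "N \<ge> c" for N
  proof
    fix i assume "i \<in> \<beta> N ` J N"
    then obtain n v where nv: "(n, v) \<in> J N" "i = (n + k, nxt N n v)" by (auto simp: \<beta>_def)
    thus "i \<in> idx N" using nxt[OF N nv(1)] by (auto simp: J_def idx_def)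
  qed
  have lim: "(\<lambda>N. real (card (idx N - J N)) / real (card (idx N))) \<longlonglongrightarrow> 0"
  proof (rule tendsto_sandwich[where f = "\<lambda>_. 0" and h = "\<lambda>N. real (2 * nat \<bar>k\<bar>) * inverse (real (Suc N))"])
    have "real (card (idx N - J N)) / real (card (idx N)) \<le> real (2 * nat \<bar>k\<bar>) * inverse (real (Suc N))" for N
    proof -
      let ?V = "vec_span {1..3 * int N}" and ?a = "nat \<bar>k\<bar>"
      \<comment> \<open>The exponents that leave the interval when \<open>k\<close> is added lie near its ends.\<close>
      let ?bad = "{- int N - int ?a + 1..- int N} \<union> {- 2 * int N..- 2 * int N + int ?a - 1}"
      have V: "finite ?V" "card ?V > 0"
        using finite_vec_span[of "{1..3 * int N}"] vec_span_zero by (auto simp: card_gt_0_iff)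
      have "idx N - J N \<subseteq> ?bad \<times> ?V" by (auto simp: idx_def J_def)
      hence "card (idx N - J N) \<le> card (?bad \<times> ?V)" using V by (intro card_mono) auto
      also have "\<dots> \<le> (2 * ?a) * card ?V"
      proof -
        have "card ?bad \<le> 2 * ?a" by (rule order_trans[OF card_Un_le]) simp
        thus ?thesis by (simp add: card_cartesian_product)
      qed
      finally have "card (idx N - J N) \<le> (2 * ?a) * card ?V" .
      hence le: "real (card (idx N - J N)) \<le> real (2 * ?a) * real (card ?V)"
        by (metis of_nat_le_iff of_nat_mult)
      have "card (idx N) = Suc N * card ?V" by (simp add: idx_def card_cartesian_product nat_add_distrib)
      hence c: "real (card (idx N)) = real (Suc N) * real (card ?V)" by (metis of_nat_mult)
      hence "real (card (idx N)) > 0" using V(2) by simp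
      moreover have "real (2 * ?a) * inverse (real (Suc N)) * real (card (idx N)) = real (2 * ?a) * real (card ?V)"
        unfolding c by simp
      ultimately show ?thesis using le by (simp only: pos_divide_le_eq)
    qed
    thus "eventually (\<lambda>N. real (card (idx N - J N)) / real (card (idx N)) \<le> real (2 * nat \<bar>k\<bar>) * inverse (real (Suc N))) sequentially"
      by (intro always_eventually allI)
    show "(\<lambda>N. real (2 * nat \<bar>k\<bar>) * inverse (real (Suc N))) \<longlonglongrightarrow> 0"
      using LIMSEQ_inverse_real_of_nat by (rule tendsto_mult_right_zero)
  qed auto
  have fE: "finite E" "E \<subseteq> G_set"
    using finite_vec_span[of "{- int d..0}"] vec_span_L3[of "{- int d..0}"] B by (auto simp: E_def intro!: G_setI)
  have "eventually (\<lambda>N. J N \<subseteq> idx N \<and> inj_on (\<beta> N) (J N) \<and> \<beta> N ` J N \<subseteq> idx N \<and>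
      (\<forall>i\<in>J N. \<exists>e\<in>E. y * pt i = pt (\<beta> N i) * e)) sequentially"
    using eventually_ge_at_top[of c]
  proof eventually_elim
    case (elim N)
    have "J N \<subseteq> idx N" by (auto simp: J_def)
    thus ?case using inj[OF elim] sub[OF elim] step[OF elim] by (intro conjI ballI) auto
  qed
  thus "\<exists>E J \<beta>. finite E \<and> E \<subseteq> carrier group_G \<and>
        eventually (\<lambda>N. J N \<subseteq> idx N \<and> inj_on (\<beta> N) (J N) \<and> \<beta> N ` J N \<subseteq> idx N \<and>
          (\<forall>i\<in>J N. \<exists>e\<in>E. y \<otimes>\<^bsub>group_G\<^esub> pt i = pt (\<beta> N i) \<otimes>\<^bsub>group_G\<^esub> e)) sequentially \<and>
        (\<lambda>N. real (card (idx N - J N)) / real (card (idx N))) \<longlonglongrightarrow> 0"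
    using fE lim by (intro exI[of _ E] exI[of _ J] exI[of _ \<beta>]) simp
qed

theorem theorem1p1:
  shows "subgroup G_set GL4 \<and>
         finitely_generated group_G \<and>
         \<not> kazhdan_property_T group_G \<and>
         ICC group_G \<and>
         \<not> inner_amenable group_G \<and>
         \<not> properly_proximal group_G"
  using subgroup_G_set finitely_generated_G not_kazhdan_G ICC_G not_inner_amenable_G
    escaping_family.not_properly_proximal[OF escaping_family_G] by blast

end
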